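(* Let $a\in\mathbb R$ with $a\ne k^2$ for all $k\in\mathbb N$. For $L\in\mathbb R$ let $\mathcal A_{KS}(L)$ be the global attractor in $H_0$ of the Kuramoto–Sivashinsky equation $$\partial_t u=-\partial_x^4u-a\partial_x^2u+u\partial_xu+L\partial_x^3u$$ (real-valued, $2\pi$-periodic, zero mean). Then for every $R>0$ there exists $L_0=L_0(R)$ such that for all $L\ge L_0$: if $u(t)$, $t\in\mathbb R$, is a complete trajectory of this equation lying in $\mathcal A_{KS}(L)$ with $\|u(t)\|_H\le R$ for all $t\in\mathbb R$, then $u\equiv0$.
   Context: $H=L^2_{per}(-\pi,\pi)$, $\|u\|_H^2=\frac1{2\pi}\int_{-\pi}^\pi|u|^2dx$; $H_0=\{u\in H:\int_{-\pi}^\pi u\,dx=0\}$. A global attractor is a compact, strictly invariant set attracting every bounded subset of the phase space. *)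

theory Defs
  imports "HOL-Analysis.Analysis"
begin

text \<open>Phase space. Elements of H = L2_per(-pi,pi) are represented by
  2pi-periodic, Borel measurable real functions that are square integrable on
  [-pi,pi]. The norm is ||u||_H^2 = (1/(2pi)) int_{-pi}^{pi} |u|^2.\<close>

definition hnorm :: "(real \<Rightarrow> real) \<Rightarrow> real" where
  "hnorm f = sqrt (inverse (2 * pi) * (LINT x:{-pi..pi}|lborel. (f x)\<^sup>2))"

definition in_H :: "(real \<Rightarrow> real) \<Rightarrow> bool" where
  "in_H f \<longleftrightarrow> f \<in> borel_measurable borel \<and> (\<forall>x. f (x + 2 * pi) = f x)
      \<and> set_integrable lborel {-pi..pi} (\<lambda>x. (f x)\<^sup>2)"

definition in_H0 :: "(real \<Rightarrow> real) \<Rightarrow> bool" where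
  "in_H0 f \<longleftrightarrow> in_H f \<and> (LINT x:{-pi..pi}|lborel. f x) = 0"

definition dx :: "nat \<Rightarrow> (real \<Rightarrow> real \<Rightarrow> real) \<Rightarrow> real \<Rightarrow> real \<Rightarrow> real" where
  "dx k u t x = (deriv ^^ k) (u t) x"

definition dt :: "(real \<Rightarrow> real \<Rightarrow> real) \<Rightarrow> real \<Rightarrow> real \<Rightarrow> real" where
  "dt u t x = deriv (\<lambda>s. u s x) t"

definition ks_classical :: "real \<Rightarrow> real \<Rightarrow> (real \<Rightarrow> real \<Rightarrow> real) \<Rightarrow> bool" where
  "ks_classical a L u \<longleftrightarrow>
     (\<forall>t>0. \<forall>x. u t (x + 2 * pi) = u t x) \<and>
     (\<forall>t>0. \<forall>x. \<forall>k<4. ((\<lambda>y. dx k u t y) has_real_derivative dx (Suc k) u t x) (at x)) \<and>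
     (\<forall>t>0. \<forall>x. ((\<lambda>s. u s x) has_real_derivative dt u t x) (at t)) \<and>
     (\<forall>k\<le>4. continuous_on ({0<..} \<times> UNIV) (\<lambda>(t, x). dx k u t x)) \<and>
     continuous_on ({0<..} \<times> UNIV) (\<lambda>(t, x). dt u t x) \<and>
     (\<forall>t>0. \<forall>x. dt u t x =
         - dx 4 u t x - a * dx 2 u t x + u t x * dx 1 u t x + L * dx 3 u t x)"

definition ks_solution_from :: "real \<Rightarrow> real \<Rightarrow> (real \<Rightarrow> real) \<Rightarrow> (real \<Rightarrow> real \<Rightarrow> real) \<Rightarrow> bool" where
  "ks_solution_from a L u0 u \<longleftrightarrow>
     ks_classical a L u \<and> ((\<lambda>s. hnorm (u s - u0)) \<longlongrightarrow> 0) (at_right 0)"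

text \<open>The solution semigroup S(t) on H_0 (well-posedness of KS in H_0 is classical).\<close>

definition ks_S :: "real \<Rightarrow> real \<Rightarrow> real \<Rightarrow> (real \<Rightarrow> real) \<Rightarrow> (real \<Rightarrow> real)" where
  "ks_S a L t u0 = (if t \<le> 0 then u0
      else THE v. \<exists>u. ks_solution_from a L u0 u \<and> v = u t)"

definition h_compact :: "(real \<Rightarrow> real) set \<Rightarrow> bool" where
  "h_compact A \<longleftrightarrow> (\<forall>f :: nat \<Rightarrow> real \<Rightarrow> real. (\<forall>n. f n \<in> A) \<longrightarrow>
      (\<exists>r g. strict_mono r \<and> g \<in> A \<and> ((\<lambda>n. hnorm (f (r n) - g)) \<longlonglongrightarrow> 0)))"

definition h_bounded :: "(real \<Rightarrow> real) set \<Rightarrow> bool" where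
  "h_bounded B \<longleftrightarrow> (\<exists>M. \<forall>f\<in>B. hnorm f \<le> M)"

definition ks_global_attractor :: "real \<Rightarrow> real \<Rightarrow> (real \<Rightarrow> real) set \<Rightarrow> bool" where
  "ks_global_attractor a L A \<longleftrightarrow>
     (\<forall>f\<in>A. in_H0 f) \<and> h_compact A \<and>
     (\<forall>t\<ge>0. ks_S a L t ` A = A) \<and>
     (\<forall>B. (\<forall>f\<in>B. in_H0 f) \<and> h_bounded B \<longrightarrow>
        (\<forall>\<epsilon>>0. \<exists>T. \<forall>t\<ge>T. \<forall>f\<in>B. \<exists>g\<in>A. hnorm (ks_S a L t f - g) < \<epsilon>))"

definition ks_complete_trajectory :: "real \<Rightarrow> real \<Rightarrow> (real \<Rightarrow> real \<Rightarrow> real) \<Rightarrow> bool" where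
  "ks_complete_trajectory a L u \<longleftrightarrow>
     (\<forall>s. in_H0 (u s)) \<and> (\<forall>s. \<forall>t\<ge>0. ks_S a L t (u s) = u (s + t))"

end

theory Submission
  imports Defs
begin

text \<open>The semigroup is defined by a definite description, so the solution of the initial value
  problem has to be constructed for every square-integrable zero-mean datum and shown to be unique.
  Existence is obtained in Fourier variables from a Picard iteration for the equation whose
  nonlinearity is evaluated at the radial projection of the solution to a ball of \<open>\<ell>\<^sup>2\<close>. This multiplies
  the nonlinearity by a scalar function of time and therefore does not affect the energy balance, and
  the resulting a priori bound shows that the truncation is inactive.

  A trajectory bounded on the whole line is then brought to normal form: with \<open>U\<close> the zero-mean
  primitive of \<open>u\<close>, the function \<open>u + U\<^sup>2 / (6 L)\<close> solves the linear equation up to a remainder of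
  order \<open>1 / L\<close> that is quadratic in \<open>u\<close>. Because \<open>a\<close> is not a square, every Fourier mode of the linear
  equation is hyperbolic, so a bounded solution has modes of size \<open>sup E / L\<close>, where \<open>E\<close> is the energy.
  Dissipation controls all high modes by finitely many low ones, hence \<open>sup E\<close> is at most a
  constant times \<open>(sup E / L)\<^sup>2\<close>, which forces \<open>u = 0\<close> for large \<open>L\<close>.\<close>


section \<open>Fourier coefficients\<close>

text \<open>The quadratic term is only locally Lipschitz in the square-summable norm, so an
  untruncated iteration would converge on short intervals only. After truncation it is globally
  Lipschitz for bounded times, and a weight \<open>exp (- (\<omega> + m^2) * t)\<close> with large
  \<open>m\<close> gives a contraction on every \<open>[0, T]\<close>: the derivative in front of
  the square costs one power of the frequency, and the fourth-order damping returns four.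

  For bounded trajectories the obstacle is that the remainder of the normal form contains
  \<open>u * u_xx\<close>, which the energy \<open>E\<close> does not control at a fixed time. The
  integral \<open>D\<close> of \<open>u_xx^2\<close> does, and \<open>D <= a^2 * E - E'\<close>,
  where the derivative \<open>E'\<close> is harmless once it is moved into the quantity being
  estimated. The growth rates \<open>a * k^2 - k^4\<close> of the modes and all constants depend on
  \<open>a\<close>, the mode and the a priori bound, never on \<open>L\<close>; this allows
  \<open>L\<close> to be chosen last. The neutral mode 0 is excluded by the zero mean.\<close>

abbreviation circ :: "real measure" where
  "circ \<equiv> restrict_space lborel {-pi..pi}"

lemma LINT_circ:
  fixes f :: "real \<Rightarrow> 'a::{banach, second_countable_topology}"
  shows "(LINT x:{-pi..pi}|lborel. f x) = integral\<^sup>L circ f"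
  by (simp add: set_lebesgue_integral_def integral_restrict_space)

lemma set_integrable_circ:
  fixes f :: "real \<Rightarrow> 'a::{banach, second_countable_topology}"
  shows "set_integrable lborel {-pi..pi} f \<longleftrightarrow> integrable circ f"
  by (simp add: set_integrable_def integrable_restrict_space)

lemma finite_measure_circ: "finite_measure circ"
  by (rule finite_measureI) (simp add: emeasure_restrict_space)

lemma measure_circ: "measure circ (space circ) = 2 * pi"
  by (simp add: measure_restrict_space)

lemma measurable_circ: "f \<in> borel_measurable borel \<Longrightarrow> f \<in> borel_measurable circ"
  by (rule measurable_restrict_space1) simp

lemma integrable_circ_continuous:
  fixes f :: "real \<Rightarrow> 'a::{banach, second_countable_topology}"
  assumes "continuous_on {-pi..pi} f"
  shows "integrable circ f"
  using borel_integrable_atLeastAtMost'[OF assms] by (simp add: set_integrable_circ)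

lemma integral_circ_continuous:
  fixes f :: "real \<Rightarrow> 'a::euclidean_space"
  assumes "continuous_on {-pi..pi} f"
  shows "integral\<^sup>L circ f = integral {-pi..pi} f"
  using set_borel_integral_eq_integral(2)[OF borel_integrable_atLeastAtMost'[OF assms]]
  by (simp add: LINT_circ)

lemma integral_circ_cis:
  "integral\<^sup>L circ (\<lambda>x. cis (of_int k * x)) = (if k = 0 then 2 * complex_of_real pi else 0)"
proof (cases "k = 0")
  case True
  have "integral\<^sup>L circ (\<lambda>x. 1::complex) = of_real (2 * pi)"
    using measure_circ by (simp add: scaleR_conv_of_real)
  then show ?thesis using True by simp
next
  case False
  let ?F = "\<lambda>x::real. cis (of_int k * x) / (\<i> * of_int k)"
  have "((\<lambda>x. cis (of_int k * x)) has_integral (?F pi - ?F (-pi))) {-pi..pi}"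
  proof (rule fundamental_theorem_of_calculus)
    fix x
    show "(?F has_vector_derivative cis (of_int k * x)) (at x within {-pi..pi})"
    proof -
      have "((\<lambda>z. exp (\<i> * (of_int k * z)) / (\<i> * of_int k)) has_field_derivative exp (\<i> * (of_int k * of_real x))) (at (of_real x))"
        using False by (auto intro!: derivative_eq_intros simp: field_simps)
      from has_vector_derivative_real_field[OF this] show ?thesis
        by (simp add: cis_conv_exp)
    qed
  qed simp
  moreover have "cis (of_int k * pi) = cis (of_int k * (-pi))"
  proof -
    have "cis (of_int k * pi) = cis (of_int k * (-pi)) * cis (2 * pi * of_int k)"
      by (simp add: cis_mult algebra_simps)
    then show ?thesis
      by (simp add: cis_multiple_2pi)
  qed
  ultimately have "((\<lambda>x. cis (of_int k * x)) has_integral 0) {-pi..pi}"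
    by simp
  then show ?thesis
    using False by (subst integral_circ_continuous)
      (auto intro!: continuous_intros simp: integral_unique)
qed

definition fourier_coeff :: "(real \<Rightarrow> real) \<Rightarrow> int \<Rightarrow> complex" where
  "fourier_coeff f k =
     integral\<^sup>L circ (\<lambda>x. complex_of_real (f x) * cis (- of_int k * x)) / (2 * of_real pi)"

definition trig_sum :: "int set \<Rightarrow> (int \<Rightarrow> complex) \<Rightarrow> real \<Rightarrow> complex" where
  "trig_sum S a x = (\<Sum>k\<in>S. a k * cis (of_int k * x))"

lemma hnorm_nonneg: "0 \<le> hnorm f"
  by (simp add: hnorm_def LINT_circ)

lemma hnorm_sq: "(hnorm f)\<^sup>2 = integral\<^sup>L circ (\<lambda>x. (f x)\<^sup>2) / (2 * pi)"
  unfolding hnorm_def LINT_circ by (subst real_sqrt_pow2) (simp_all add: field_simps)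

context
  fixes f :: "real \<Rightarrow> real"
  assumes f: "in_H f"
begin

lemma in_H_measurable: "f \<in> borel_measurable circ"
  using f by (auto simp: in_H_def intro: measurable_circ)

lemma in_H_integrable_sq: "integrable circ (\<lambda>x. (f x)\<^sup>2)"
  using f by (auto simp: in_H_def set_integrable_circ)

lemma in_H_integrable: "integrable circ f"
proof (rule Bochner_Integration.integrable_bound)
  interpret finite_measure circ by (rule finite_measure_circ)
  show "integrable circ (\<lambda>x. 1 + (f x)\<^sup>2)"
    using in_H_integrable_sq by simp
  have "\<bar>y\<bar> \<le> \<bar>1 + y\<^sup>2\<bar>" for y :: real
    using sum_squares_bound[of "\<bar>y\<bar>" 1] by (simp add: power2_eq_square)
  then show "AE x in circ. norm (f x) \<le> norm (1 + (f x)\<^sup>2)"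
    by (intro AE_I2) simp
qed (rule in_H_measurable)

lemma in_H_integrable_cis:
  "integrable circ (\<lambda>x. complex_of_real (f x) * cis (of_int k * x))"
proof (rule Bochner_Integration.integrable_bound[OF in_H_integrable])
  have "(\<lambda>x. cis (of_int k * x)) \<in> borel_measurable circ"
    by (intro measurable_circ borel_measurable_continuous_onI continuous_intros)
  then show "(\<lambda>x. complex_of_real (f x) * cis (of_int k * x)) \<in> borel_measurable circ"
    using in_H_measurable by measurable
qed (simp add: norm_mult)

text \<open>The coefficients are arbitrary because the identity is used in three ways: with the
  Fourier coefficients it gives Bessel's inequality, with an approximating polynomial Parseval's
  identity, and with the modes of the constructed solution it identifies the coefficients of that
  solution.\<close>

lemma trig_sum_defect:
  assumes "finite S"
  shows "integral\<^sup>L circ (\<lambda>x. (cmod (complex_of_real (f x) - trig_sum S a x))\<^sup>2) / (2 * pi)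
    = (hnorm f)\<^sup>2 - (\<Sum>k\<in>S. (cmod (fourier_coeff f k))\<^sup>2) + (\<Sum>k\<in>S. (cmod (a k - fourier_coeff f k))\<^sup>2)"
proof -
  let ?p = "trig_sum S a"
  have cint: "integrable circ (\<lambda>x. complex_of_real (f x) * cis (- of_int k * x))" for k
    using in_H_integrable_cis[of "-k"] by simp
  have fp: "complex_of_real (f x) * cnj (?p x) = (\<Sum>k\<in>S. cnj (a k) * (complex_of_real (f x) * cis (- of_int k * x)))" for x
    by (simp add: trig_sum_def sum_distrib_left cis_cnj mult_ac)
  have fp_int: "integrable circ (\<lambda>x. complex_of_real (f x) * cnj (?p x))"
    unfolding fp using cint by (intro Bochner_Integration.integrable_sum integrable_mult_right) auto
  have fp_val: "integral\<^sup>L circ (\<lambda>x. complex_of_real (f x) * cnj (?p x)) = (\<Sum>k\<in>S. cnj (a k) * fourier_coeff f k) * (2 * of_real pi)"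
    unfolding fp using cint
    by (simp add: fourier_coeff_def sum_distrib_right)
  have pp: "?p x * cnj (?p x) = (\<Sum>j\<in>S. \<Sum>k\<in>S. a j * cnj (a k) * cis (of_int (j - k) * x))" for x
  proof -
    have "cis (of_int (j - k) * x) = cis (of_int j * x) * cnj (cis (of_int k * x))" for j k
      by (simp add: cis_cnj cis_mult left_diff_distrib)
    then show ?thesis
      unfolding trig_sum_def cnj_sum sum_product
      by (intro sum.cong refl) (simp only: complex_cnj_mult mult_ac)
  qed
  have cis_int: "integrable circ (\<lambda>x. cis (of_int k * x))" for k
    by (intro integrable_circ_continuous continuous_intros)
  have pp_int: "integrable circ (\<lambda>x. ?p x * cnj (?p x))"
    unfolding pp by (intro Bochner_Integration.integrable_sum integrable_mult_right cis_int)
  have "integral\<^sup>L circ (\<lambda>x. ?p x * cnj (?p x)) = (\<Sum>j\<in>S. \<Sum>k\<in>S. a j * cnj (a k) * (if j = k then 2 * of_real pi else 0))"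
    unfolding pp using cis_int integral_circ_cis
    by (simp add: Bochner_Integration.integral_sum del: of_int_diff)
  also have "\<dots> = (\<Sum>j\<in>S. a j * cnj (a j)) * (2 * of_real pi)"
    using assms by (simp add: if_distrib[of "\<lambda>z. _ * z"] sum.delta sum_distrib_right cong: if_cong)
  finally have pp_val: "integral\<^sup>L circ (\<lambda>x. ?p x * cnj (?p x)) = (\<Sum>j\<in>S. a j * cnj (a j)) * (2 * of_real pi)" .
  have expand: "(cmod (complex_of_real y - z))\<^sup>2 = y\<^sup>2 - 2 * Re (complex_of_real y * cnj z) + Re (z * cnj z)" for y z
    unfolding cmod_power2 by (simp add: power2_eq_square algebra_simps)
  have "integral\<^sup>L circ (\<lambda>x. (cmod (complex_of_real (f x) - ?p x))\<^sup>2)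
     = integral\<^sup>L circ (\<lambda>x. (f x)\<^sup>2) - 2 * Re ((\<Sum>k\<in>S. cnj (a k) * fourier_coeff f k) * (2 * of_real pi))
       + Re ((\<Sum>j\<in>S. a j * cnj (a j)) * (2 * of_real pi))"
    unfolding expand
    using fp_int pp_int in_H_integrable_sq
    by (simp add: integral_Re fp_val pp_val integrable_Re del: Re_sum complex_cnj_mult times_complex.sel complex_mult_cnj)
  also have "\<dots> = (2 * pi) * ((hnorm f)\<^sup>2 + (\<Sum>k\<in>S. (cmod (a k))\<^sup>2 - 2 * Re (cnj (a k) * fourier_coeff f k)))"
  proof -
    have *: "Re (w * (2 * of_real pi)) = (2 * pi) * Re w" for w by simp
    have **: "Re (a j * cnj (a j)) = (cmod (a j))\<^sup>2" for j
      by (simp only: complex_norm_square[symmetric] Re_complex_of_real)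
    show ?thesis
      unfolding * Re_sum ** sum_subtractf
      by (simp add: hnorm_sq algebra_simps sum_distrib_left)
  qed
  also have "(\<Sum>k\<in>S. (cmod (a k))\<^sup>2 - 2 * Re (cnj (a k) * fourier_coeff f k))
      = (\<Sum>k\<in>S. (cmod (a k - fourier_coeff f k))\<^sup>2) - (\<Sum>k\<in>S. (cmod (fourier_coeff f k))\<^sup>2)"
    unfolding sum_subtractf[symmetric]
    unfolding cmod_power2 by (intro sum.cong refl) (simp add: power2_eq_square algebra_simps)
  finally show ?thesis by simp
qed

lemma bessel:
  assumes "finite S"
  shows "(\<Sum>k\<in>S. (cmod (fourier_coeff f k))\<^sup>2) \<le> (hnorm f)\<^sup>2"
proof -
  have "0 \<le> integral\<^sup>L circ (\<lambda>x. (cmod (complex_of_real (f x) - trig_sum S (fourier_coeff f) x))\<^sup>2) / (2 * pi)"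
    by simp
  then show ?thesis
    unfolding trig_sum_defect[OF assms] by simp
qed

lemma fourier_coeff_le: "cmod (fourier_coeff f k) \<le> hnorm f"
  using bessel[of "{k}"] hnorm_nonneg[of f] by (simp add: power2_le_iff_abs_le)

end

subsection \<open>Density of trigonometric polynomials\<close>

definition trig_poly :: "(real \<Rightarrow> complex) \<Rightarrow> bool" where
  "trig_poly p \<longleftrightarrow> (\<exists>S a. finite S \<and> p = trig_sum S a)"

lemma trig_poly_monom: "trig_poly (\<lambda>x. c * cis (of_int k * x))"
  unfolding trig_poly_def
  by (rule exI[of _ "{k}"], rule exI[of _ "\<lambda>_. c"]) (auto simp: trig_sum_def)

lemma trig_poly_add:
  assumes "trig_poly p" "trig_poly q"
  shows "trig_poly (\<lambda>x. p x + q x)"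
proof -
  from assms obtain S a T b where S: "finite S" "p = trig_sum S a" and T: "finite T" "q = trig_sum T b"
    by (auto simp: trig_poly_def)
  have "(\<lambda>x. p x + q x) = trig_sum (S \<union> T) (\<lambda>k. (if k \<in> S then a k else 0) + (if k \<in> T then b k else 0))"
  proof
    fix x
    have "trig_sum S a x = (\<Sum>k\<in>S \<union> T. (if k \<in> S then a k else 0) * cis (of_int k * x))"
      unfolding trig_sum_def using S T by (intro sum.mono_neutral_cong_left) auto
    moreover have "trig_sum T b x = (\<Sum>k\<in>S \<union> T. (if k \<in> T then b k else 0) * cis (of_int k * x))"
      unfolding trig_sum_def using S T by (intro sum.mono_neutral_cong_left) auto
    ultimately show "p x + q x = trig_sum (S \<union> T) (\<lambda>k. (if k \<in> S then a k else 0) + (if k \<in> T then b k else 0)) x"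
      using S T by (simp add: trig_sum_def distrib_right sum.distrib)
  qed
  then show ?thesis
    unfolding trig_poly_def using S(1) T(1) by (intro exI conjI) (auto intro: finite_UnI)
qed

lemma trig_poly_sum: "finite I \<Longrightarrow> (\<And>i. i \<in> I \<Longrightarrow> trig_poly (p i)) \<Longrightarrow> trig_poly (\<lambda>x. \<Sum>i\<in>I. p i x)"
proof (induction I rule: finite_induct)
  case empty
  then show ?case using trig_poly_monom[of 0 0] by simp
next
  case (insert i I)
  then show ?case by (simp add: trig_poly_add)
qed

lemma trig_poly_mult:
  assumes "trig_poly p" "trig_poly q"
  shows "trig_poly (\<lambda>x. p x * q x)"
proof -
  from assms obtain S a T b where S: "finite S" "p = trig_sum S a" and T: "finite T" "q = trig_sum T b"
    by (auto simp: trig_poly_def)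
  have "(\<lambda>x. p x * q x) = (\<lambda>x. \<Sum>j\<in>S. \<Sum>k\<in>T. (a j * b k) * cis (of_int (j + k) * x))"
    by (auto simp: S T trig_sum_def sum_product distrib_right simp flip: cis_mult intro!: ext sum.cong)
  moreover have "trig_poly (\<lambda>x. \<Sum>j\<in>S. \<Sum>k\<in>T. (a j * b k) * cis (of_int (j + k) * x))"
    using S T by (intro trig_poly_sum trig_poly_monom) auto
  ultimately show ?thesis by simp
qed

lemma trig_poly_of_real_polynomial_function:
  "real_polynomial_function h \<Longrightarrow> trig_poly (\<lambda>x. complex_of_real (h (cis x)))"
proof (induction h rule: real_polynomial_function.induct)
  case (linear h)
  interpret h: bounded_linear h by fact
  have *: "complex_of_real (h (cis x)) = ((h 1 - \<i> * h \<i>) / 2) * cis (of_int 1 * x) + ((h 1 + \<i> * h \<i>) / 2) * cis (of_int (-1) * x)" for x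
  proof -
    have "cis x = cos x *\<^sub>R 1 + sin x *\<^sub>R \<i>"
      by (simp add: complex_eq_iff)
    then have "h (cis x) = cos x * h 1 + sin x * h \<i>"
      by (metis h.add h.scaleR real_scaleR_def)
    then show ?thesis
      by (simp add: complex_eq_iff field_simps)
  qed
  show ?case
    unfolding * by (intro trig_poly_add trig_poly_monom)
next
  case (const c)
  show ?case using trig_poly_monom[of c 0] by simp
next
  case (add f g)
  then show ?case by (simp add: trig_poly_add)
next
  case (mult f g)
  then show ?case by (simp add: trig_poly_mult)
qed

text \<open>Vanishing near the ends removes the effect of the jump of \<open>Arg\<close> at -1, so
  \<open>g \<circ> Arg\<close> is continuous on the whole circle. Stone-Weierstrass supplies a real
  polynomial in the two coordinates, and its pullback along \<open>cis\<close> is a trigonometric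
  polynomial.\<close>

lemma trig_poly_dense_uniform:
  fixes g :: "real \<Rightarrow> real"
  assumes cont: "continuous_on {-pi..pi} g" and d: "0 < d" "d < pi"
    and supp: "\<And>x. pi - d \<le> \<bar>x\<bar> \<Longrightarrow> g x = 0" and e: "0 < e"
  obtains S a where "finite S" "\<And>x. x \<in> {-pi..pi} \<Longrightarrow> cmod (complex_of_real (g x) - trig_sum S a x) < e"
proof -
  have "continuous_on (sphere 0 1) (g \<circ> Arg)"
    unfolding continuous_on_eq_continuous_within
  proof
    fix z :: complex assume z: "z \<in> sphere 0 1"
    have zc: "cis (Arg w) = w" if "w \<in> sphere 0 1" for w
      using that cis_Arg[of w] by (cases "w = 0") (auto simp: sgn_eq)
    show "continuous (at z within sphere 0 1) (g \<circ> Arg)"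
    proof (cases "z = -1")
      case False
      have "z \<notin> \<real>\<^sub>\<le>\<^sub>0"
        using z False by (auto simp: complex_nonpos_Reals_iff complex_eq_iff cmod_def power2_eq_1_iff)
      then have c: "continuous (at z) Arg"
        by (rule continuous_at_Arg)
      have "Arg z \<noteq> pi" using zc[OF z] False by auto
      then have "Arg z \<in> {-pi<..<pi}" using Arg_bounded[of z] by auto
      then have "isCont g (Arg z)"
        using cont by (metis at_within_interior continuous_on_eq_continuous_within greaterThanLessThan_iff
             interior_atLeastAtMost_real atLeastAtMost_iff less_imp_le)
      then have "continuous (at z) (g \<circ> Arg)"
        using c by (intro continuous_at_compose)
      then show ?thesis
        by (rule continuous_at_imp_continuous_within)
    next
      case True
      \<comment> \<open>\<open>1 + cos (pi - d)\<close> is the distance from -1 to the vertical line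
        through \<open>cis (pi - d)\<close>: points of the circle closer than this have an argument
        beyond \<open>pi - d\<close> in modulus, where \<open>g\<close> is zero.\<close>
      have "\<forall>\<^sub>F w in at z. dist w z < 1 + cos (pi - d)"
      proof -
        have "cos pi < cos (pi - d)"
          using d by (subst cos_mono_less_eq) auto
        then show ?thesis
          by (intro order_tendstoD(2)[OF tendsto_dist[OF tendsto_ident_at tendsto_const]]) auto
      qed
      then have "\<forall>\<^sub>F w in at z within sphere 0 1. dist w z < 1 + cos (pi - d)"
        by (auto simp: eventually_at_filter elim: eventually_mono)
      moreover have "\<forall>\<^sub>F w in at z within sphere 0 1. w \<in> sphere 0 1"
        by (auto simp: eventually_at_filter)
      ultimately have "\<forall>\<^sub>F w in at z within sphere 0 1. (g \<circ> Arg) w = 0"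
      proof eventually_elim
        case (elim w)
        have "\<bar>Re w + 1\<bar> \<le> dist w z"
          using True abs_Re_le_cmod[of "w - z"] by (simp add: dist_norm)
        then have "cos (Arg w) < cos (pi - d)"
          using elim zc[of w] arg_cong[OF zc[of w], of Re] unfolding cis.sel by linarith
        then have "cos \<bar>Arg w\<bar> < cos (pi - d)" by simp
        then have "pi - d < \<bar>Arg w\<bar>"
          using d Arg_bounded[of w] by (subst (asm) cos_mono_less_eq) auto
        then show ?case using supp by simp
      qed
      moreover have "(g \<circ> Arg) z = 0"
        using supp[of pi] d True by (simp add: cis_pi[symmetric] Arg_cis del: cis_pi)
      ultimately show ?thesis
        unfolding continuous_within by (simp add: tendsto_eventually)
    qed
  qed
  then obtain h where h: "real_polynomial_function h" "\<And>z. z \<in> sphere 0 1 \<Longrightarrow> \<bar>(g \<circ> Arg) z - h z\<bar> < e"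
    using Stone_Weierstrass_real_polynomial_function[of "sphere 0 1" "g \<circ> Arg" e] e by auto
  from trig_poly_of_real_polynomial_function[OF h(1)]
  obtain S a where S: "finite S" "(\<lambda>x. complex_of_real (h (cis x))) = trig_sum S a"
    by (auto simp: trig_poly_def)
  show ?thesis
  proof (rule that[OF S(1)])
    fix x :: real assume x: "x \<in> {-pi..pi}"
    have "g (Arg (cis x)) = g x"
    proof (cases "x = -pi")
      case True
      then have "cis x = cis pi" by (simp add: complex_eq_iff)
      then have "Arg (cis x) = pi" using Arg_cis[of pi] by simp
      then show ?thesis using True supp d by simp
    next
      case False
      then show ?thesis using x by (simp add: Arg_cis)
    qed
    then have "\<bar>g x - h (cis x)\<bar> < e"
      using h(2)[of "cis x"] by simp
    moreover have "complex_of_real (g x) - trig_sum S a x = of_real (g x - h (cis x))"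
      by (simp add: S(2)[symmetric])
    ultimately show "cmod (complex_of_real (g x) - trig_sum S a x) < e"
      by (simp only: norm_of_real)
  qed
qed


section \<open>Mean-square approximation and Parseval's identity\<close>

lemma AE_circ_interior: "AE x in circ. x \<in> {-pi<..<pi}"
proof -
  have "AE x in lborel. x \<in> {-pi..pi} \<longrightarrow> x \<in> {-pi<..<pi}"
    using AE_lborel_singleton[of pi] AE_lborel_singleton[of "-pi"]
    by eventually_elim (auto simp: less_le)
  then show ?thesis
    by (subst AE_restrict_space_iff) auto
qed

lemma AE_circ_negligible:
  assumes "negligible N"
  shows "AE x in circ. x \<notin> N"
proof -
  have "AE x in lebesgue. x \<notin> N"
    using assms by (intro AE_not_in) (simp add: negligible_iff_null_sets)
  then have "AE x in lborel. x \<notin> N"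
    by (simp add: AE_completion_iff)
  then show ?thesis
    by (subst AE_restrict_space_iff) (auto elim!: eventually_mono)
qed

lemma continuous_dense_bounded:
  fixes f :: "real \<Rightarrow> real"
  assumes f: "f \<in> borel_measurable borel" and B: "\<And>x. \<bar>f x\<bar> \<le> B" and e: "0 < e"
  obtains g d where "continuous_on UNIV g" "0 < d" "d < pi" "\<And>x. pi - d \<le> \<bar>x\<bar> \<Longrightarrow> g x = 0"
    "integral\<^sup>L circ (\<lambda>x. (f x - g x)\<^sup>2) < e" "\<And>x. \<bar>g x\<bar> \<le> B"
proof -
  have B0: "0 \<le> B" using B[of 0] by linarith
  have "f \<in> borel_measurable (lebesgue_on UNIV)"
    using f by (simp add: lebesgue_on_UNIV_eq measurable_completion)
  then have "f measurable_on UNIV"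
    by (simp add: measurable_on_iff_borel_measurable)
  then obtain N g where N: "negligible N" and g: "\<And>n. continuous_on UNIV (g n)"
    and lim: "\<And>x. x \<notin> N \<Longrightarrow> (\<lambda>n. g n x) \<longlonglongrightarrow> f x"
    unfolding measurable_on_def by auto
  \<comment> \<open>For \<open>n > 0\<close> the first factor is 0 where
    \<open>\<bar>x\<bar> \<ge> pi - 1 / n\<close> and 1 where
    \<open>\<bar>x\<bar> \<le> pi - 2 / n\<close>. Clipping the second factor to
    \<open>[-B, B]\<close> provides the dominating constant \<open>(2 * B)^2\<close>.\<close>
  define h :: "nat \<Rightarrow> real \<Rightarrow> real" where "h = (\<lambda>n x. max 0 (min 1 (real n * (pi - \<bar>x\<bar>) - 1)) * max (-B) (min B (g n x)))"
  have hc: "continuous_on UNIV (h n)" for n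
    unfolding h_def by (intro continuous_intros g)
  have hB: "\<bar>h n x\<bar> \<le> B" for n x
  proof -
    have "\<bar>max 0 (min 1 y) * max (-B) (min B z)\<bar> \<le> 1 * B" for y z
      unfolding abs_mult using B0 by (intro mult_mono) auto
    then show ?thesis unfolding h_def by simp
  qed
  have hlim: "(\<lambda>n. h n x) \<longlonglongrightarrow> f x" if x: "x \<notin> N" "x \<in> {-pi<..<pi}" for x
  proof -
    have "filterlim (\<lambda>n. real n * (pi - \<bar>x\<bar>) - 1) at_top sequentially"
      using x by (intro filterlim_tendsto_add_at_top[OF tendsto_const[of "-1"], simplified]
           filterlim_at_top_mult_tendsto_pos[OF tendsto_const] filterlim_real_sequentially) auto
    then have "\<forall>\<^sub>F n in sequentially. 1 \<le> real n * (pi - \<bar>x\<bar>) - 1"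
      unfolding filterlim_at_top by blast
    then have "\<forall>\<^sub>F n in sequentially. max (-B) (min B (g n x)) = h n x"
      by eventually_elim (simp add: h_def)
    moreover have "(\<lambda>n. max (-B) (min B (g n x))) \<longlonglongrightarrow> max (-B) (min B (f x))"
      using x by (intro tendsto_intros lim)
    moreover have "max (-B) (min B (f x)) = f x"
      using B[of x] by auto
    ultimately show ?thesis
      by (auto intro: Lim_transform_eventually)
  qed
  have "(\<lambda>n. integral\<^sup>L circ (\<lambda>x. (f x - h n x)\<^sup>2)) \<longlonglongrightarrow> integral\<^sup>L circ (\<lambda>x. 0)"
  proof (rule integral_dominated_convergence[where w = "\<lambda>_. (2 * B)\<^sup>2"])
    interpret finite_measure circ by (rule finite_measure_circ)
    show "integrable circ (\<lambda>_. (2 * B)\<^sup>2)" by simp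
    show "(\<lambda>x. (f x - h n x)\<^sup>2) \<in> borel_measurable circ" for n
      by (intro measurable_circ borel_measurable_power borel_measurable_diff f borel_measurable_continuous_onI hc)
    show "AE x in circ. (\<lambda>n. (f x - h n x)\<^sup>2) \<longlonglongrightarrow> 0"
      using AE_circ_negligible[OF N] AE_circ_interior
    proof eventually_elim
      case (elim x)
      then have "(\<lambda>n. (f x - h n x)\<^sup>2) \<longlonglongrightarrow> (f x - f x)\<^sup>2"
        by (intro tendsto_intros hlim)
      then show ?case by simp
    qed
    show "AE x in circ. norm ((f x - h n x)\<^sup>2) \<le> (2 * B)\<^sup>2" for n
    proof (rule AE_I2)
      fix x
      have "\<bar>f x - h n x\<bar> \<le> \<bar>2 * B\<bar>" using B[of x] hB[of n x] by linarith
      then show "norm ((f x - h n x)\<^sup>2) \<le> (2 * B)\<^sup>2"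
        by (simp add: abs_le_square_iff)
    qed
  qed simp
  then have "(\<lambda>n. integral\<^sup>L circ (\<lambda>x. (f x - h n x)\<^sup>2)) \<longlonglongrightarrow> 0" by simp
  then have "\<forall>\<^sub>F n in sequentially. integral\<^sup>L circ (\<lambda>x. (f x - h n x)\<^sup>2) < e"
    using e by (rule order_tendstoD)
  then obtain n0 where n0: "\<And>n. n \<ge> n0 \<Longrightarrow> integral\<^sup>L circ (\<lambda>x. (f x - h n x)\<^sup>2) < e"
    by (auto simp: eventually_sequentially)
  define n where "n = Suc n0"
  show ?thesis
  proof (rule that[of "h n" "1 / real n"])
    show "continuous_on UNIV (h n)" by (rule hc)
    show "0 < 1 / real n" by (simp add: n_def)
    have "1 / real n \<le> 1" by (simp add: n_def)
    then show "1 / real n < pi" using pi_gt3 by linarith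
    show "h n x = 0" if "pi - 1 / real n \<le> \<bar>x\<bar>" for x
    proof -
      have "real n * (pi - \<bar>x\<bar>) - 1 \<le> 0"
        using that by (simp add: n_def field_simps)
      then show ?thesis by (simp add: h_def)
    qed
    show "integral\<^sup>L circ (\<lambda>x. (f x - h n x)\<^sup>2) < e" by (rule n0) (simp add: n_def)
  qed (rule hB)
qed

lemma clip_dense:
  assumes f: "in_H f" and e: "0 < e"
  obtains n :: nat where "integral\<^sup>L circ (\<lambda>x. (f x - max (- real n) (min (real n) (f x)))\<^sup>2) < e"
proof -
  have fm: "f \<in> borel_measurable borel" using f by (simp add: in_H_def)
  have "(\<lambda>n. integral\<^sup>L circ (\<lambda>x. (f x - max (- real n) (min (real n) (f x)))\<^sup>2)) \<longlonglongrightarrow> integral\<^sup>L circ (\<lambda>x. 0)"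
  proof (rule integral_dominated_convergence[where w = "\<lambda>x. (f x)\<^sup>2"])
    show "integrable circ (\<lambda>x. (f x)\<^sup>2)" by (rule in_H_integrable_sq[OF f])
    show "(\<lambda>x. (f x - max (- real n) (min (real n) (f x)))\<^sup>2) \<in> borel_measurable circ" for n
      by (intro measurable_circ borel_measurable_power borel_measurable_diff borel_measurable_max borel_measurable_min fm) auto
    show "AE x in circ. (\<lambda>n. (f x - max (- real n) (min (real n) (f x)))\<^sup>2) \<longlonglongrightarrow> 0"
    proof (rule AE_I2)
      fix x
      obtain m :: nat where "\<bar>f x\<bar> \<le> real m" using real_arch_simple by blast
      then have "\<forall>n\<ge>m. (f x - max (- real n) (min (real n) (f x)))\<^sup>2 = 0"
        by (auto simp: max_def min_def abs_le_iff)
      then show "(\<lambda>n. (f x - max (- real n) (min (real n) (f x)))\<^sup>2) \<longlonglongrightarrow> 0"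
        by (intro tendsto_eventually) (auto simp: eventually_sequentially)
    qed
    show "AE x in circ. norm ((f x - max (- real n) (min (real n) (f x)))\<^sup>2) \<le> (f x)\<^sup>2" for n
    proof (rule AE_I2)
      fix x
      have "\<bar>f x - max (- real n) (min (real n) (f x))\<bar> \<le> \<bar>f x\<bar>" by (auto simp: max_def min_def)
      then show "norm ((f x - max (- real n) (min (real n) (f x)))\<^sup>2) \<le> (f x)\<^sup>2"
        by (simp add: abs_le_square_iff)
    qed
  qed simp
  then have "(\<lambda>n. integral\<^sup>L circ (\<lambda>x. (f x - max (- real n) (min (real n) (f x)))\<^sup>2)) \<longlonglongrightarrow> 0" by simp
  then have "\<forall>\<^sub>F n in sequentially. integral\<^sup>L circ (\<lambda>x. (f x - max (- real n) (min (real n) (f x)))\<^sup>2) < e"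
    using e by (rule order_tendstoD)
  then show ?thesis
    using that by (auto simp: eventually_sequentially)
qed

lemma trig_sum_dense:
  assumes f: "in_H f" and e: "0 < e"
  obtains S a where "finite S" "integral\<^sup>L circ (\<lambda>x. (cmod (complex_of_real (f x) - trig_sum S a x))\<^sup>2) < e"
proof -
  interpret finite_measure circ by (rule finite_measure_circ)
  have fm: "f \<in> borel_measurable borel" using f by (simp add: in_H_def)
  obtain n :: nat where n: "integral\<^sup>L circ (\<lambda>x. (f x - max (- real n) (min (real n) (f x)))\<^sup>2) < e / 9"
    using clip_dense[OF f, of "e / 9"] e by auto
  define c where "c = (\<lambda>x. max (- real n) (min (real n) (f x)))"
  have cm: "c \<in> borel_measurable borel"
    unfolding c_def by (intro borel_measurable_max borel_measurable_min fm) auto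
  obtain g d where g: "continuous_on UNIV g" "0 < d" "d < pi" "\<And>x. pi - d \<le> \<bar>x\<bar> \<Longrightarrow> g x = 0"
    "integral\<^sup>L circ (\<lambda>x. (c x - g x)\<^sup>2) < e / 9" "\<And>x. \<bar>g x\<bar> \<le> real n"
  proof -
    have cb: "\<bar>c x\<bar> \<le> real n" for x by (auto simp: c_def)
    have e9: "0 < e / 9" using e by simp
    show ?thesis
      by (rule continuous_dense_bounded[OF cm cb e9]) (rule that)
  qed
  \<comment> \<open>Chosen so that \<open>3 * d'^2 * (2 * pi) = e / 3\<close>. The other two errors
    contribute \<open>3 * (e / 9)\<close> each, the factor 3 coming from the square of a sum of
    three terms.\<close>
  define d' where "d' = sqrt (e / (18 * pi))"
  have d': "0 < d'" using e by (simp add: d'_def)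
  obtain S a where S: "finite S" "\<And>x. x \<in> {-pi..pi} \<Longrightarrow> cmod (complex_of_real (g x) - trig_sum S a x) < d'"
    using trig_poly_dense_uniform[OF continuous_on_subset[OF g(1)] g(2,3,4) d'] by auto
  have i1: "integrable circ (\<lambda>x. (f x - c x)\<^sup>2)"
  proof (rule Bochner_Integration.integrable_bound[OF in_H_integrable_sq[OF f]])
    show "(\<lambda>x. (f x - c x)\<^sup>2) \<in> borel_measurable circ"
      by (intro measurable_circ borel_measurable_power borel_measurable_diff cm fm)
    have "\<bar>f x - c x\<bar> \<le> \<bar>f x\<bar>" for x by (auto simp: c_def max_def min_def)
    then show "AE x in circ. norm ((f x - c x)\<^sup>2) \<le> norm ((f x)\<^sup>2)"
      by (intro AE_I2) (simp add: abs_le_square_iff)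
  qed
  have i2: "integrable circ (\<lambda>x. (c x - g x)\<^sup>2)"
  proof (rule integrable_const_bound[where B = "(2 * real n)\<^sup>2"])
    show "(\<lambda>x. (c x - g x)\<^sup>2) \<in> borel_measurable circ"
      by (intro measurable_circ borel_measurable_power borel_measurable_diff cm borel_measurable_continuous_onI g)
    have "\<bar>c x - g x\<bar> \<le> \<bar>2 * real n\<bar>" for x 
      using g(6)[of x] by (auto simp: c_def max_def min_def)
    then have "(c x - g x)\<^sup>2 \<le> (2 * real n)\<^sup>2" for x
      by (simp only: abs_le_square_iff)
    then show "AE x in circ. norm ((c x - g x)\<^sup>2) \<le> (2 * real n)\<^sup>2"
      by (intro AE_I2) simp
  qed
  have "integral\<^sup>L circ (\<lambda>x. (cmod (complex_of_real (f x) - trig_sum S a x))\<^sup>2)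
      \<le> integral\<^sup>L circ (\<lambda>x. 3 * (f x - c x)\<^sup>2 + 3 * (c x - g x)\<^sup>2 + 3 * d'\<^sup>2)"
  proof (rule integral_mono_AE')
    show "integrable circ (\<lambda>x. 3 * (f x - c x)\<^sup>2 + 3 * (c x - g x)\<^sup>2 + 3 * d'\<^sup>2)"
      using i1 i2 by simp
    show "AE x in circ. (cmod (complex_of_real (f x) - trig_sum S a x))\<^sup>2
        \<le> 3 * (f x - c x)\<^sup>2 + 3 * (c x - g x)\<^sup>2 + 3 * d'\<^sup>2"
    proof (rule AE_I2)
      fix x assume "x \<in> space circ"
      then have x: "x \<in> {-pi..pi}" by (simp add: space_restrict_space)
      have "complex_of_real (f x) - trig_sum S a x = of_real (f x - c x) + of_real (c x - g x) + (of_real (g x) - trig_sum S a x)"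
        by simp
      then have "cmod (complex_of_real (f x) - trig_sum S a x) \<le> cmod (of_real (f x - c x)) + cmod (of_real (c x - g x)) + cmod (of_real (g x) - trig_sum S a x)"
        by (simp only:) (intro order_trans[OF norm_triangle_ineq] add_right_mono norm_triangle_ineq)
      also have "\<dots> \<le> \<bar>f x - c x\<bar> + \<bar>c x - g x\<bar> + d'"
        using S(2)[OF x] by (simp add: less_imp_le flip: of_real_diff)
      finally have "(cmod (complex_of_real (f x) - trig_sum S a x))\<^sup>2 \<le> (\<bar>f x - c x\<bar> + \<bar>c x - g x\<bar> + d')\<^sup>2"
        by (intro power_mono) auto
      also have "(p + q + r)\<^sup>2 \<le> 3 * p\<^sup>2 + 3 * q\<^sup>2 + 3 * r\<^sup>2" for p q r :: real
        using sum_squares_bound[of p q] sum_squares_bound[of p r] sum_squares_bound[of q r]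
        by (simp add: power2_eq_square algebra_simps)
      from this[of "\<bar>f x - c x\<bar>" "\<bar>c x - g x\<bar>" d'] have
        "(\<bar>f x - c x\<bar> + \<bar>c x - g x\<bar> + d')\<^sup>2 \<le> 3 * (f x - c x)\<^sup>2 + 3 * (c x - g x)\<^sup>2 + 3 * d'\<^sup>2"
        by simp
      finally show "(cmod (complex_of_real (f x) - trig_sum S a x))\<^sup>2
        \<le> 3 * (f x - c x)\<^sup>2 + 3 * (c x - g x)\<^sup>2 + 3 * d'\<^sup>2" .
    qed
  qed simp
  also have "\<dots> = 3 * integral\<^sup>L circ (\<lambda>x. (f x - c x)\<^sup>2) + 3 * integral\<^sup>L circ (\<lambda>x. (c x - g x)\<^sup>2) + 3 * d'\<^sup>2 * (2 * pi)"
    using i1 i2 measure_circ by simp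
  also have "\<dots> < 3 * (e / 9) + 3 * (e / 9) + 3 * d'\<^sup>2 * (2 * pi)"
    using n g(5) by (simp add: c_def)
  also have "d'\<^sup>2 = e / (18 * pi)" using e by (simp add: d'_def)
  also have "3 * (e / 9) + 3 * (e / 9) + 3 * (e / (18 * pi)) * (2 * pi) = e"
    by (simp add: field_simps)
  finally show ?thesis by (rule that[OF S(1)])
qed

text \<open>Bessel gives one inequality. For the other, the defect identity of an approximating
  polynomial bounds \<open>(hnorm f)^2\<close> by a finite part of the coefficient sum plus the
  approximation error.\<close>

theorem parseval:
  assumes f: "in_H f"
  shows "((\<lambda>k. (cmod (fourier_coeff f k))\<^sup>2) has_sum (hnorm f)\<^sup>2) UNIV"
proof -
  let ?c = "\<lambda>k. (cmod (fourier_coeff f k))\<^sup>2"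
  have sm: "?c summable_on UNIV"
    by (rule nonneg_bdd_above_summable_on) (auto intro!: bdd_aboveI[of _ "(hnorm f)\<^sup>2"] bessel[OF f])
  have "infsum ?c UNIV \<le> (hnorm f)\<^sup>2"
    using sm by (rule infsum_le_finite_sums) (auto intro!: bessel[OF f])
  moreover have "(hnorm f)\<^sup>2 \<le> infsum ?c UNIV"
  proof (rule field_le_epsilon)
    fix e :: real assume e: "0 < e"
    obtain S a where S: "finite S" "integral\<^sup>L circ (\<lambda>x. (cmod (complex_of_real (f x) - trig_sum S a x))\<^sup>2) < e * (2 * pi)"
      using trig_sum_dense[OF f, of "e * (2 * pi)"] e by auto
    then have "integral\<^sup>L circ (\<lambda>x. (cmod (complex_of_real (f x) - trig_sum S a x))\<^sup>2) / (2 * pi) < e"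
      by (simp add: divide_less_eq)
    then have "(hnorm f)\<^sup>2 - sum ?c S + (\<Sum>k\<in>S. (cmod (a k - fourier_coeff f k))\<^sup>2) < e"
      unfolding trig_sum_defect[OF f S(1)] .
    moreover have "0 \<le> (\<Sum>k\<in>S. (cmod (a k - fourier_coeff f k))\<^sup>2)" by (simp add: sum_nonneg)
    moreover have "sum ?c S \<le> infsum ?c UNIV"
      using sm S(1) by (intro finite_sum_le_infsum) auto
    ultimately show "(hnorm f)\<^sup>2 \<le> infsum ?c UNIV + e" by linarith
  qed
  ultimately have "infsum ?c UNIV = (hnorm f)\<^sup>2" by (rule antisym)
  then show ?thesis
    using has_sum_infsum[OF sm] by simp
qed


section \<open>Square-summable sequences\<close>

definition l2 :: "(int \<Rightarrow> complex) \<Rightarrow> bool" where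
  "l2 v \<longleftrightarrow> (\<lambda>k. (cmod (v k))\<^sup>2) summable_on UNIV"

text \<open>For a sequence that is not square summable the infinite sum defaults to 0, so this is a
  norm only in company with \<open>l2\<close>.\<close>

definition n2 :: "(int \<Rightarrow> complex) \<Rightarrow> real" where
  "n2 v = sqrt (\<Sum>\<^sub>\<infinity>k. (cmod (v k))\<^sup>2)"

definition conv :: "(int \<Rightarrow> complex) \<Rightarrow> (int \<Rightarrow> complex) \<Rightarrow> int \<Rightarrow> complex" where
  "conv v w k = (\<Sum>\<^sub>\<infinity>m. v m * w (k - m))"

lemma n2_nonneg [simp]: "0 \<le> n2 v"
  by (simp add: n2_def infsum_nonneg)

lemma n2_sq: "(n2 v)\<^sup>2 = (\<Sum>\<^sub>\<infinity>k. (cmod (v k))\<^sup>2)"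
  by (simp add: n2_def infsum_nonneg)

lemma l2_has_sum: "l2 v \<Longrightarrow> ((\<lambda>k. (cmod (v k))\<^sup>2) has_sum (n2 v)\<^sup>2) UNIV"
  by (simp add: l2_def n2_sq)

lemma L2_set_le_n2: "l2 v \<Longrightarrow> finite S \<Longrightarrow> L2_set (\<lambda>k. cmod (v k)) S \<le> n2 v"
  unfolding L2_set_def n2_def l2_def
  by (intro real_sqrt_le_mono finite_sum_le_infsum) auto

lemma cmod_le_n2: "l2 v \<Longrightarrow> cmod (v k) \<le> n2 v"
  using L2_set_le_n2[of v "{k}"] by simp

text \<open>A uniform bound for the finite sections yields summability and the norm bound together,
  so triangle inequalities and limits can be handled on finite sets.\<close>

lemma l2I:
  assumes "\<And>S. finite S \<Longrightarrow> L2_set (\<lambda>k. cmod (v k)) S \<le> B"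
  shows "l2 v" "n2 v \<le> B"
proof -
  have B0: "0 \<le> B" using assms[of "{}"] by simp
  have le: "(\<Sum>k\<in>S. (cmod (v k))\<^sup>2) \<le> B\<^sup>2" if "finite S" for S
  proof -
    have "(L2_set (\<lambda>k. cmod (v k)) S)\<^sup>2 \<le> B\<^sup>2"
      using assms[OF that] by (intro power_mono) auto
    then show ?thesis by (simp add: L2_set_def sum_nonneg)
  qed
  show *: "l2 v"
    unfolding l2_def by (rule nonneg_bdd_above_summable_on) (auto intro!: bdd_aboveI[of _ "B\<^sup>2"] le)
  have "(n2 v)\<^sup>2 \<le> B\<^sup>2"
    unfolding n2_sq using * by (intro infsum_le_finite_sums) (auto simp: l2_def le)
  then show "n2 v \<le> B" using B0 by (rule power2_le_imp_le)
qed

lemma l2_mono: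
  assumes "l2 w" "\<And>k. cmod (v k) \<le> cmod (w k)"
  shows "l2 v" "n2 v \<le> n2 w"
proof -
  have "L2_set (\<lambda>k. cmod (v k)) S \<le> n2 w" if "finite S" for S
    using L2_set_mono[of S "\<lambda>k. cmod (v k)" "\<lambda>k. cmod (w k)"] L2_set_le_n2[OF assms(1) that] assms(2)
    by force
  then show "l2 v" "n2 v \<le> n2 w" by (auto intro: l2I)
qed

lemma l2_add:
  assumes "l2 v" "l2 w"
  shows "l2 (\<lambda>k. v k + w k)" "n2 (\<lambda>k. v k + w k) \<le> n2 v + n2 w"
proof -
  have "L2_set (\<lambda>k. cmod (v k + w k)) S \<le> n2 v + n2 w" if "finite S" for S
  proof -
    have "L2_set (\<lambda>k. cmod (v k + w k)) S \<le> L2_set (\<lambda>k. cmod (v k) + cmod (w k)) S"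
      by (intro L2_set_mono norm_triangle_ineq) auto
    also have "\<dots> \<le> L2_set (\<lambda>k. cmod (v k)) S + L2_set (\<lambda>k. cmod (w k)) S"
      by (rule L2_set_triangle_ineq)
    finally show ?thesis
      using L2_set_le_n2[OF assms(1) that] L2_set_le_n2[OF assms(2) that] by linarith
  qed
  then show "l2 (\<lambda>k. v k + w k)" "n2 (\<lambda>k. v k + w k) \<le> n2 v + n2 w" by (auto intro: l2I)
qed

lemma l2_scale:
  assumes "l2 v"
  shows "l2 (\<lambda>k. c * v k)" "n2 (\<lambda>k. c * v k) = cmod c * n2 v"
proof -
  show "l2 (\<lambda>k. c * v k)"
    using assms unfolding l2_def norm_mult power_mult_distrib by (rule summable_on_cmult_right)
  show "n2 (\<lambda>k. c * v k) = cmod c * n2 v"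
    using assms unfolding l2_def n2_def norm_mult power_mult_distrib
    by (subst infsum_cmult_right) (auto simp: real_sqrt_mult)
qed

lemma l2_diff:
  assumes "l2 v" "l2 w"
  shows "l2 (\<lambda>k. v k - w k)" "n2 (\<lambda>k. v k - w k) \<le> n2 v + n2 w"
  using l2_add[OF assms(1) l2_scale(1)[OF assms(2), of "-1"]] l2_scale(2)[OF assms(2), of "-1"] by auto

lemma n2_diff_commute: "n2 (\<lambda>k. v k - w k) = n2 (\<lambda>k. w k - v k)"
  by (simp add: n2_def norm_minus_commute)

lemma n2_abs_diff:
  assumes "l2 v" "l2 w"
  shows "\<bar>n2 v - n2 w\<bar> \<le> n2 (\<lambda>k. v k - w k)"
proof -
  have "n2 v \<le> n2 (\<lambda>k. v k - w k) + n2 w"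
    using l2_add(2)[OF l2_diff(1)[OF assms] assms(2)] by simp
  moreover have "n2 w \<le> n2 (\<lambda>k. w k - v k) + n2 v"
    using l2_add(2)[OF l2_diff(1)[OF assms(2,1)] assms(1)] by simp
  ultimately show ?thesis
    using n2_diff_commute[of v w] by linarith
qed

lemma l2_of_real: "l2 (\<lambda>k. complex_of_real (g k)) \<longleftrightarrow> (\<lambda>k. (g k)\<^sup>2) summable_on UNIV"
  by (simp add: l2_def)

lemma l2_dominated:
  assumes "l2 (\<lambda>k. complex_of_real (g k))" "\<And>k. cmod (v k) \<le> g k"
  shows "l2 v"
  by (rule l2_mono(1)[OF assms(1)]) (metis assms(2) abs_ge_self norm_of_real order_trans)

section \<open>Convolution of square-summable sequences\<close>

lemma conv_abs_summable:
  assumes "l2 v" "l2 w"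
  shows "(\<lambda>m. cmod (v m * w (k - m))) summable_on UNIV"
    and "(\<Sum>\<^sub>\<infinity>m. cmod (v m * w (k - m))) \<le> n2 v * n2 w"
proof -
  have le: "(\<Sum>m\<in>S. cmod (v m * w (k - m))) \<le> n2 v * n2 w" if S: "finite S" for S
  proof -
    have "(\<Sum>m\<in>S. cmod (v m * w (k - m))) \<le> L2_set (\<lambda>m. cmod (v m)) S * L2_set (\<lambda>m. cmod (w (k - m))) S"
      using L2_set_mult_ineq[of "\<lambda>m. cmod (v m)" "\<lambda>m. cmod (w (k - m))" S] by (simp add: norm_mult)
    also have "L2_set (\<lambda>m. cmod (w (k - m))) S = L2_set (\<lambda>m. cmod (w m)) ((\<lambda>m. k - m) ` S)"
      unfolding L2_set_def by (subst sum.reindex) (auto simp: inj_on_def)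
    also have "L2_set (\<lambda>m. cmod (v m)) S * \<dots> \<le> n2 v * n2 w"
      using S by (intro mult_mono L2_set_le_n2 assms L2_set_nonneg) auto
    finally show ?thesis .
  qed
  show *: "(\<lambda>m. cmod (v m * w (k - m))) summable_on UNIV"
    by (rule nonneg_bdd_above_summable_on) (auto intro!: bdd_aboveI[of _ "n2 v * n2 w"] le)
  show "(\<Sum>\<^sub>\<infinity>m. cmod (v m * w (k - m))) \<le> n2 v * n2 w"
    using * by (rule infsum_le_finite_sums) (auto intro: le)
qed

lemma conv_le: "l2 v \<Longrightarrow> l2 w \<Longrightarrow> cmod (conv v w k) \<le> n2 v * n2 w"
  unfolding conv_def using norm_infsum_bound[OF conv_abs_summable(1)] conv_abs_summable(2) by (rule order_trans)

lemma conv_has_sum: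
  assumes "l2 v" "l2 w"
  shows "((\<lambda>m. v m * w (k - m)) has_sum conv v w k) UNIV"
  unfolding conv_def by (rule has_sum_infsum[OF abs_summable_summable[OF conv_abs_summable(1)[OF assms]]])

lemma conv_scale: "l2 v \<Longrightarrow> conv (\<lambda>k. c * v k) (\<lambda>k. c * v k) k = c\<^sup>2 * conv v v k"
  unfolding conv_def using infsum_cmult_right'[of "c\<^sup>2" "\<lambda>m. v m * v (k - m)" UNIV]
  by (simp add: power2_eq_square mult_ac)

lemma conv_diff_le:
  assumes "l2 v" "l2 w"
  shows "cmod (conv v v k - conv w w k) \<le> (n2 v + n2 w) * n2 (\<lambda>k. v k - w k)"
proof -
  let ?d = "\<lambda>k. v k - w k"
  have d: "l2 ?d" by (rule l2_diff[OF assms])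
  have h1: "((\<lambda>m. v m * v (k - m) - w m * w (k - m)) has_sum (conv v v k - conv w w k)) UNIV"
    using has_sum_add[OF conv_has_sum[OF assms(1,1), of k] has_sum_uminusI[OF conv_has_sum[OF assms(2,2), of k]]]
    by simp
  have h2: "((\<lambda>m. ?d m * v (k - m) + w m * ?d (k - m)) has_sum (conv ?d v k + conv w ?d k)) UNIV"
    by (intro has_sum_add conv_has_sum assms d)
  have eq: "(\<lambda>m. v m * v (k - m) - w m * w (k - m)) = (\<lambda>m. ?d m * v (k - m) + w m * ?d (k - m))"
    by (auto simp: algebra_simps)
  have "conv v v k - conv w w k = conv ?d v k + conv w ?d k"
    by (rule has_sum_unique[OF h1[unfolded eq] h2])
  then show ?thesis
    using norm_triangle_ineq[of "conv ?d v k" "conv w ?d k"] conv_le[OF d assms(1), of k] conv_le[OF assms(2) d, of k]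
    by (simp add: algebra_simps)
qed

text \<open>For positive \<open>\<rho>\<close> the factor is 1 inside the ball of radius
  \<open>\<rho>\<close> and \<open>\<rho> / n2 v\<close> outside. Written with \<open>max\<close>,
  both cases are one expression, visibly continuous in \<open>\<rho>\<close> and
  \<open>n2 v\<close>.\<close>

definition radial :: "real \<Rightarrow> (int \<Rightarrow> complex) \<Rightarrow> int \<Rightarrow> complex" where
  "radial \<rho> v k = complex_of_real (\<rho> / max \<rho> (n2 v)) * v k"

lemma radial_l2: "l2 v \<Longrightarrow> l2 (radial \<rho> v)"
  unfolding radial_def by (rule l2_scale)

lemma n2_radial_le:
  assumes "l2 v" "0 < \<rho>"
  shows "n2 (radial \<rho> v) \<le> \<rho>"
proof -
  have "n2 (radial \<rho> v) = \<rho> / max \<rho> (n2 v) * n2 v"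
    unfolding radial_def using assms by (subst l2_scale) (auto simp: norm_divide)
  also have "\<dots> \<le> \<rho> / max \<rho> (n2 v) * max \<rho> (n2 v)"
    using assms by (intro mult_left_mono) auto
  also have "\<dots> = \<rho>" using assms by (simp add: max_def)
  finally show ?thesis .
qed

text \<open>The difference splits into a changed vector and a changed scalar. The scalar part is
  \<open>(\<rho> / p) * \<bar>q - p\<bar> * (n2 w / q)\<close>, in which both quotients are at most
  1. Each part contributes one copy of the distance, whence the factor 2.\<close>

lemma radial_lipschitz:
  assumes "l2 v" "l2 w" "0 < \<rho>"
  shows "n2 (\<lambda>k. radial \<rho> v k - radial \<rho> w k) \<le> 2 * n2 (\<lambda>k. v k - w k)"
proof -
  define p q where "p = max \<rho> (n2 v)" and "q = max \<rho> (n2 w)"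
  have pq: "0 < p" "0 < q" "\<rho> \<le> p" "\<rho> \<le> q" "n2 w \<le> q" "\<bar>p - q\<bar> \<le> \<bar>n2 v - n2 w\<bar>"
    using assms by (auto simp: p_def q_def)
  have eq: "radial \<rho> v k - radial \<rho> w k = of_real (\<rho> / p) * (v k - w k) + of_real (\<rho> / p - \<rho> / q) * w k" for k
    unfolding radial_def p_def[symmetric] q_def[symmetric] of_real_diff by (simp only: algebra_simps)
  have "n2 (\<lambda>k. radial \<rho> v k - radial \<rho> w k) \<le> \<bar>\<rho> / p\<bar> * n2 (\<lambda>k. v k - w k) + \<bar>\<rho> / p - \<rho> / q\<bar> * n2 w"
  proof -
    note d = l2_diff(1)[OF assms(1,2)]
    have "n2 (\<lambda>k. radial \<rho> v k - radial \<rho> w k) \<le> n2 (\<lambda>k. of_real (\<rho> / p) * (v k - w k)) + n2 (\<lambda>k. of_real (\<rho> / p - \<rho> / q) * w k)"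
      unfolding eq by (rule l2_add(2)[OF l2_scale(1)[OF d] l2_scale(1)[OF assms(2)]])
    then show ?thesis
      unfolding l2_scale(2)[OF d] l2_scale(2)[OF assms(2)] norm_of_real .
  qed
  also have "\<bar>\<rho> / p\<bar> * n2 (\<lambda>k. v k - w k) \<le> 1 * n2 (\<lambda>k. v k - w k)"
    using pq assms by (intro mult_right_mono) auto
  also have "\<bar>\<rho> / p - \<rho> / q\<bar> * n2 w \<le> 1 * n2 (\<lambda>k. v k - w k)"
  proof -
    have "\<rho> / p - \<rho> / q = (\<rho> / p) * ((q - p) / q)"
      using pq by (simp add: field_simps)
    then have "\<bar>\<rho> / p - \<rho> / q\<bar> * n2 w = \<bar>\<rho> / p\<bar> * (\<bar>q - p\<bar> * (n2 w / q))"
      using pq by (simp add: abs_mult)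
    also have "\<dots> \<le> 1 * (\<bar>q - p\<bar> * 1)"
      using pq assms by (intro mult_mono) auto
    also have "\<dots> \<le> n2 (\<lambda>k. v k - w k)"
      using pq n2_abs_diff[OF assms(1,2)] by simp
    finally show ?thesis by simp
  qed
  finally show ?thesis by simp
qed

section \<open>Series depending on time, and decay of convolutions\<close>

lemma continuous_on_infsum:
  fixes f :: "'i \<Rightarrow> 'a::topological_space \<Rightarrow> 'b::banach"
  assumes "\<And>k. continuous_on A (f k)" "\<And>k t. t \<in> A \<Longrightarrow> norm (f k t) \<le> M k" "M summable_on UNIV"
  shows "continuous_on A (\<lambda>t. \<Sum>\<^sub>\<infinity>k. f k t)"
proof (rule uniform_limit_theorem)
  show "uniform_limit A (\<lambda>X t. \<Sum>k\<in>X. f k t) (\<lambda>t. \<Sum>\<^sub>\<infinity>k. f k t) (finite_subsets_at_top UNIV)"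
    using assms by (intro Weierstrass_m_test_general[where M = M]) auto
  show "\<forall>\<^sub>F X in finite_subsets_at_top UNIV. continuous_on A (\<lambda>t. \<Sum>k\<in>X. f k t)"
    by (intro always_eventually allI continuous_intros assms)
qed simp

text \<open>Coordinatewise continuity does not control the tails; the majorant \<open>g\<close>,
  uniform in \<open>t\<close>, makes the series of squares converge uniformly. For this reason
  \<open>adm\<close> below asks for such a majorant.\<close>

lemma continuous_on_n2:
  assumes "\<And>k. continuous_on A (\<lambda>t. v t k)" "\<And>t k. t \<in> A \<Longrightarrow> cmod (v t k) \<le> g k"
    and g: "l2 (\<lambda>k. complex_of_real (g k))"
  shows "continuous_on A (\<lambda>t. n2 (v t))"
  unfolding n2_def
proof (intro continuous_intros continuous_on_infsum[where M = "\<lambda>k. (g k)\<^sup>2"])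
  show "(\<lambda>k. (g k)\<^sup>2) summable_on UNIV" using g by (simp add: l2_of_real)
  show "norm ((cmod (v t k))\<^sup>2) \<le> (g k)\<^sup>2" if "t \<in> A" for t k
    using assms(2)[OF that] by (simp add: power_mono)
qed (rule assms)

lemma continuous_on_conv:
  assumes "\<And>k. continuous_on A (\<lambda>t. v t k)" "\<And>t k. t \<in> A \<Longrightarrow> cmod (v t k) \<le> g k"
    and g: "l2 (\<lambda>k. complex_of_real (g k))"
  shows "continuous_on A (\<lambda>t. conv (v t) (v t) k)"
  unfolding conv_def
proof (intro continuous_intros continuous_on_infsum[where M = "\<lambda>m. \<bar>g m * g (k - m)\<bar>"])
  show "(\<lambda>m. \<bar>g m * g (k - m)\<bar>) summable_on UNIV"
    using conv_abs_summable(1)[OF g g, of k] by (simp add: norm_mult abs_mult)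
  show "norm (v t m * v t (k - m)) \<le> \<bar>g m * g (k - m)\<bar>" if "t \<in> A" for t m
    unfolding norm_mult abs_mult
    by (intro mult_mono order_trans[OF assms(2)[OF that]]) auto
qed (rule assms(1))+

lemma summable_inverse_square_int: "(\<lambda>k::int. 1 / (1 + \<bar>real_of_int k\<bar>)\<^sup>2) summable_on UNIV"
proof -
  have "summable (\<lambda>n::nat. 1 / (1 + real n)\<^sup>2)"
    using sums_summable[OF inverse_squares_sums] by (simp add: add.commute)
  then have nat: "(\<lambda>n::nat. 1 / (1 + real n)\<^sup>2) summable_on UNIV"
    by (subst summable_on_UNIV_nonneg_real_iff) auto
  have 1: "(\<lambda>k::int. 1 / (1 + \<bar>real_of_int k\<bar>)\<^sup>2) summable_on range int"
    using nat by (subst summable_on_reindex) (simp_all add: o_def)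
  have 2: "(\<lambda>k::int. 1 / (1 + \<bar>real_of_int k\<bar>)\<^sup>2) summable_on range (\<lambda>n. - int n)"
    using nat by (subst summable_on_reindex) (simp_all add: o_def inj_on_def)
  have 3: "range int \<union> range (\<lambda>n. - int n) = UNIV"
  proof -
    have "k \<in> range int \<union> range (\<lambda>n. - int n)" for k
      by (cases "0 \<le> k") (auto intro: image_eqI[of _ _ "nat k"] image_eqI[of _ _ "nat (- k)"])
    then show ?thesis by blast
  qed
  show ?thesis using summable_on_union[OF 1 2] unfolding 3 .
qed

lemma l2_inverse: "l2 (\<lambda>k. complex_of_real (c / (1 + \<bar>real_of_int k\<bar>)))"
  unfolding l2_of_real power_divide
  using summable_on_cmult_right[OF summable_inverse_square_int, of "c\<^sup>2"]
  by (simp only: times_divide_eq_right mult_1_right)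

text \<open>Since \<open>1 + \<bar>k\<bar>\<close> is at most twice the larger of
  \<open>1 + \<bar>m\<bar>\<close> and \<open>1 + \<bar>k - m\<bar>\<close>, one factor supplies the
  full decay, and the other a summable weight because \<open>p\<close> is at least 2. The two cases
  contribute equal sums, hence \<open>2 ^ Suc p\<close>.\<close>

lemma conv_decay:
  assumes p: "2 \<le> p" and v: "\<And>m. cmod (v m) \<le> M / (1 + \<bar>real_of_int m\<bar>) ^ p"
  shows "cmod (conv v v k) \<le> M\<^sup>2 * 2 ^ Suc p * (\<Sum>\<^sub>\<infinity>m::int. 1 / (1 + \<bar>real_of_int m\<bar>)\<^sup>2) / (1 + \<bar>real_of_int k\<bar>) ^ p"
proof -
  let ?b = "\<lambda>m::int. 1 + \<bar>real_of_int m\<bar>"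
  let ?Z = "\<Sum>\<^sub>\<infinity>m::int. 1 / (?b m)\<^sup>2"
  have "0 \<le> M" using order_trans[OF norm_ge_zero v[of 0]] by simp
  have s1: "(\<lambda>m. 1 / (?b m)\<^sup>2) summable_on UNIV" by (rule summable_inverse_square_int)
  have bij: "bij_betw (\<lambda>m. k - m) UNIV (UNIV :: int set)"
    by (rule bij_betwI[of _ _ _ "\<lambda>m. k - m"]) auto
  have s2: "((\<lambda>m. 1 / (?b (k - m))\<^sup>2) has_sum ?Z) UNIV"
    using has_sum_reindex_bij_betw[OF bij, of "\<lambda>m. 1 / (?b m)\<^sup>2"] has_sum_infsum[OF s1] by blast
  have s: "((\<lambda>m. M\<^sup>2 * 2 ^ p / ?b k ^ p * (1 / (?b m)\<^sup>2 + 1 / (?b (k - m))\<^sup>2)) has_sum (M\<^sup>2 * 2 ^ p / ?b k ^ p * (?Z + ?Z))) UNIV"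
    by (intro has_sum_cmult_right has_sum_add s2) (rule has_sum_infsum[OF s1])
  have le: "cmod (v m * v (k - m)) \<le> M\<^sup>2 * 2 ^ p / ?b k ^ p * (1 / (?b m)\<^sup>2 + 1 / (?b (k - m))\<^sup>2)" for m
  proof -
    define x y where "x = ?b m" and "y = ?b (k - m)"
    have xy: "1 \<le> x" "1 \<le> y" by (auto simp: x_def y_def)
    have "?b k \<le> x + y" by (simp add: x_def y_def)
    then have "?b k \<le> 2 * max x y" by (auto simp: max_def)
    then have "?b k ^ p \<le> (2 * max x y) ^ p" by (intro power_mono) auto
    also have "\<dots> \<le> 2 ^ p * (x ^ p + y ^ p)"
      using xy by (auto simp: power_mult_distrib max_def)
    finally have *: "?b k ^ p \<le> 2 ^ p * (x ^ p + y ^ p)" .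
    have "cmod (v m * v (k - m)) \<le> (M / x ^ p) * (M / y ^ p)"
      unfolding norm_mult x_def y_def using \<open>0 \<le> M\<close> by (intro mult_mono v) auto
    also have "\<dots> = M\<^sup>2 / (x ^ p * y ^ p)" by (simp add: power2_eq_square)
    also have "\<dots> = M\<^sup>2 / ?b k ^ p * (?b k ^ p / (x ^ p * y ^ p))" by simp
    also have "\<dots> \<le> M\<^sup>2 / ?b k ^ p * (2 ^ p * (x ^ p + y ^ p) / (x ^ p * y ^ p))"
      using * xy by (intro mult_left_mono divide_right_mono) auto
    also have "2 ^ p * (x ^ p + y ^ p) / (x ^ p * y ^ p) = 2 ^ p * (1 / x ^ p + 1 / y ^ p)"
      using xy by (simp add: field_simps)
    also have "M\<^sup>2 / ?b k ^ p * \<dots> \<le> M\<^sup>2 / ?b k ^ p * (2 ^ p * (1 / x\<^sup>2 + 1 / y\<^sup>2))"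
      using xy p by (intro mult_left_mono add_mono divide_left_mono power_increasing) auto
    finally show ?thesis by (simp add: x_def y_def)
  qed
  have sm: "(\<lambda>m. cmod (v m * v (k - m))) summable_on UNIV"
    by (rule summable_on_comparison_test[OF has_sum_imp_summable[OF s]]) (rule le, simp)
  have "cmod (conv v v k) \<le> (\<Sum>\<^sub>\<infinity>m. cmod (v m * v (k - m)))"
    unfolding conv_def by (rule norm_infsum_bound[OF sm])
  also have "\<dots> \<le> M\<^sup>2 * 2 ^ p / ?b k ^ p * (?Z + ?Z)"
    by (rule has_sum_mono[OF has_sum_infsum[OF sm] s le])
  also have "x * y / z * (w + w) = x * (2 * y) * w / z" for x y z w :: real
    by (simp add: algebra_simps)
  from this[of "M\<^sup>2" "2 ^ p" "?b k ^ p" ?Z]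
  have "M\<^sup>2 * 2 ^ p / ?b k ^ p * (?Z + ?Z) = M\<^sup>2 * 2 ^ Suc p * ?Z / ?b k ^ p"
    by (simp only: power_Suc)
  finally show ?thesis .
qed


section \<open>Energy estimates for classical solutions\<close>

abbreviation cint :: "(real \<Rightarrow> real) \<Rightarrow> real" where
  "cint f \<equiv> integral {-pi..pi} f"

section \<open>Integration over one period\<close>

lemma cint_total_derivative:
  assumes "\<And>x. (F has_real_derivative f x) (at x)" "F pi = F (-pi)"
  shows "(f has_integral 0) {-pi..pi}"
proof -
  have "(f has_integral (F pi - F (-pi))) {-pi..pi}"
    by (rule fundamental_theorem_of_calculus)
      (auto intro!: has_field_derivative_at_within assms simp flip: has_real_derivative_iff_has_vector_derivative)
  then show ?thesis using assms(2) by simp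
qed

text \<open>All integrations by parts of one identity are collected in a single potential
  \<open>F\<close>, so that an energy identity reduces to differentiating \<open>F\<close> and
  comparing its end values.\<close>

lemma cint_mod_total_derivative:
  assumes F: "\<And>x. (F has_real_derivative f x) (at x)" "F pi = F (-pi)"
    and eq: "\<And>x. g x = f x + h x" and g: "continuous_on UNIV g" and h: "continuous_on UNIV h"
  shows "cint g = cint h"
proof -
  have hi: "h integrable_on {-pi..pi}"
    using h by (intro integrable_continuous_interval continuous_on_subset[OF h]) auto
  have "((\<lambda>x. f x + h x) has_integral (0 + cint h)) {-pi..pi}"
    by (intro has_integral_add cint_total_derivative[OF F] integrable_integral hi)
  moreover have "g = (\<lambda>x. f x + h x)" using eq by (rule ext)
  ultimately show ?thesis by (simp add: integral_unique)
qed

lemma cint_mono: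
  assumes "continuous_on UNIV f" "continuous_on UNIV g" "\<And>x. f x \<le> g x"
  shows "cint f \<le> cint g"
  by (rule integral_le) (auto intro!: integrable_continuous_interval continuous_on_subset[OF assms(1)]
      continuous_on_subset[OF assms(2)] assms(3))

lemma cint_add:
  assumes "continuous_on UNIV f" "continuous_on UNIV g"
  shows "cint (\<lambda>x. f x + g x) = cint f + cint g"
  by (rule integral_add) (auto intro!: integrable_continuous_interval continuous_on_subset[OF assms(1)]
      continuous_on_subset[OF assms(2)])

lemma cint_nonneg: "continuous_on UNIV f \<Longrightarrow> (\<And>x. 0 \<le> f x) \<Longrightarrow> 0 \<le> cint f"
  using cint_mono[of "\<lambda>_. 0" f] by simp

lemma continuous_on_joint_slice:
  assumes "continuous_on (J \<times> UNIV) (\<lambda>(t, x). f t x)" "t \<in> J"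
  shows "continuous_on A (f t)"
proof -
  have "continuous_on A (\<lambda>x. (\<lambda>(t, x). f t x) (t, x))"
    by (rule continuous_on_compose2[OF assms(1)]) (auto intro!: continuous_intros assms(2))
  then show ?thesis by simp
qed

lemma cint_has_derivative:
  fixes f f' :: "real \<Rightarrow> real \<Rightarrow> real"
  assumes J: "open J" "convex J" "t \<in> J"
    and d: "\<And>t x. t \<in> J \<Longrightarrow> ((\<lambda>s. f s x) has_real_derivative f' t x) (at t)"
    and c: "\<And>t. t \<in> J \<Longrightarrow> continuous_on UNIV (f t)"
    and c': "continuous_on (J \<times> UNIV) (\<lambda>(t, x). f' t x)"
  shows "((\<lambda>s. cint (f s)) has_real_derivative cint (f' t)) (at t)"
proof -
  have "((\<lambda>s. integral (cbox (-pi) pi) (f s)) has_real_derivative integral (cbox (-pi) pi) (f' t)) (at t within J)"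
  proof (rule leibniz_rule_field_derivative)
    show "((\<lambda>s. f s x) has_real_derivative f' t x) (at t within J)" if "t \<in> J" for t x
      using d[OF that] by (rule has_field_derivative_at_within)
    show "f t integrable_on cbox (-pi) pi" if "t \<in> J" for t
      by (rule integrable_continuous) (rule continuous_on_subset[OF c[OF that]], simp)
    show "continuous_on (J \<times> cbox (-pi) pi) (\<lambda>(t, x). f' t x)"
      by (rule continuous_on_subset[OF c']) auto
  qed (use J in auto)
  then show ?thesis
    using J at_within_open[of t J] by (simp add: box_real)
qed

text \<open>The rate may have either sign: growth estimates use a nonnegative one,
  \<open>bounded_solution_le\<close> a negative one.\<close>

lemma gronwall:
  fixes y y' :: "real \<Rightarrow> real"
  assumes "s \<le> t" and d: "\<And>r. s \<le> r \<Longrightarrow> r \<le> t \<Longrightarrow> (y has_real_derivative y' r) (at r)"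
    and le: "\<And>r. s \<le> r \<Longrightarrow> r \<le> t \<Longrightarrow> y' r \<le> c * y r"
  shows "y t \<le> exp (c * (t - s)) * y s"
proof -
  have "exp (- c * t) * y t \<le> exp (- c * s) * y s"
  proof (rule DERIV_nonpos_imp_nonincreasing[OF \<open>s \<le> t\<close>])
    fix r assume r: "s \<le> r" "r \<le> t"
    have "((\<lambda>r. exp (- c * r) * y r) has_real_derivative exp (- c * r) * (y' r - c * y r)) (at r)"
      by (rule derivative_eq_intros d r refl | simp add: algebra_simps)+
    moreover have "exp (- c * r) * (y' r - c * y r) \<le> 0"
      using le[OF r] by (simp add: mult_nonneg_nonpos)
    ultimately show "\<exists>z. ((\<lambda>r. exp (- c * r) * y r) has_real_derivative z) (at r) \<and> z \<le> 0" by blast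
  qed
  then have "exp (c * t) * (exp (- c * t) * y t) \<le> exp (c * t) * (exp (- c * s) * y s)"
    by (intro mult_left_mono) auto
  then show ?thesis
    by (simp add: mult.assoc[symmetric] exp_add[symmetric] right_diff_distrib)
qed

text \<open>For zero mean, \<open>w x\<close> is the average of \<open>w x - w y\<close> over
  \<open>y\<close>, and each such difference is at most the total variation
  \<open>P\<close>.\<close>

lemma zero_mean_sup:
  assumes d: "\<And>x. (w has_real_derivative w' x) (at x)" and c: "continuous_on UNIV w'"
    and mean: "cint w = 0" and x: "x \<in> {-pi..pi}"
  shows "(w x)\<^sup>2 \<le> 2 * pi * cint (\<lambda>x. (w' x)\<^sup>2)"
proof -
  define P where "P = cint (\<lambda>x. \<bar>w' x\<bar>)"
  have wc: "continuous_on UNIV w"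
    using d by (meson DERIV_isCont continuous_at_imp_continuous_on)
  have ci: "continuous_on UNIV (\<lambda>x. \<bar>w' x\<bar>)" by (intro continuous_intros c)
  have P0: "0 \<le> P" unfolding P_def by (rule cint_nonneg[OF ci]) auto
  have ordered: "\<bar>w q - w p\<bar> \<le> P" if "p \<le> q" "p \<in> {-pi..pi}" "q \<in> {-pi..pi}" for p q
  proof -
    have "(w' has_integral (w q - w p)) {p..q}"
      by (rule fundamental_theorem_of_calculus)
        (auto intro!: has_field_derivative_at_within d that simp flip: has_real_derivative_iff_has_vector_derivative)
    then have "\<bar>w q - w p\<bar> = \<bar>integral {p..q} w'\<bar>" by (simp add: integral_unique)
    also have "\<dots> \<le> integral {p..q} (\<lambda>x. \<bar>w' x\<bar>)"
      unfolding real_norm_def[symmetric] by (rule integral_norm_bound_integral)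
       (auto intro!: integrable_continuous_interval continuous_on_subset[OF c] continuous_on_subset[OF ci])
    also have "\<dots> \<le> P"
      unfolding P_def using that
      by (intro integral_subset_le integrable_continuous_interval continuous_on_subset[OF ci]) auto
    finally show ?thesis .
  qed
  have diff: "\<bar>w x - w y\<bar> \<le> P" if "y \<in> {-pi..pi}" for y
    using ordered[of x y] ordered[of y x] x that by (cases "x \<le> y") (auto simp: abs_minus_commute)
  have wi: "w integrable_on {-pi..pi}"
    by (intro integrable_continuous_interval continuous_on_subset[OF wc]) auto
  have "cint (\<lambda>y. w x - w y) = 2 * pi * w x"
    using mean wi by (subst integral_diff) auto
  moreover have "\<bar>cint (\<lambda>y. w x - w y)\<bar> \<le> cint (\<lambda>y. P)"
    unfolding real_norm_def[symmetric] using diff by (intro integral_norm_bound_integral integrable_continuous_interval continuous_intros continuous_on_subset[OF wc]) auto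
  ultimately have "\<bar>2 * pi * w x\<bar> \<le> 2 * pi * P" by simp
  then have wP: "\<bar>w x\<bar> \<le> P" by (simp add: abs_mult)
  \<comment> \<open>\<open>q\<close> is the mean of \<open>\<bar>w'\<bar>\<close>; nonnegativity of
    the integral of \<open>(\<bar>w'\<bar> - q)^2\<close> is the Cauchy-Schwarz inequality against
    the constant 1.\<close>
  define q where "q = P / (2 * pi)"
  have "0 \<le> cint (\<lambda>x. (w' x)\<^sup>2 - 2 * q * \<bar>w' x\<bar> + q\<^sup>2)"
  proof (rule cint_nonneg)
    show "0 \<le> (w' x)\<^sup>2 - 2 * q * \<bar>w' x\<bar> + q\<^sup>2" for x
      using zero_le_power2[of "\<bar>w' x\<bar> - q"] by (simp add: power2_diff mult.commute mult.left_commute)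
  qed (intro continuous_intros c)
  also have "\<dots> = cint (\<lambda>x. (w' x)\<^sup>2) - 2 * q * P + 2 * pi * q\<^sup>2"
  proof -
    have i: "(\<lambda>x. (w' x)\<^sup>2) integrable_on {-pi..pi}" "(\<lambda>x. \<bar>w' x\<bar>) integrable_on {-pi..pi}"
      by (intro integrable_continuous_interval continuous_intros continuous_on_subset[OF c]; simp)+
    have "((\<lambda>x. (w' x)\<^sup>2 - 2 * q * \<bar>w' x\<bar> + q\<^sup>2) has_integral
        (cint (\<lambda>x. (w' x)\<^sup>2) - 2 * q * P + (pi - (-pi)) *\<^sub>R q\<^sup>2)) {-pi..pi}"
      unfolding P_def
      by (intro has_integral_add has_integral_diff has_integral_mult_right integrable_integral i
          )
        (use has_integral_const_real[of "q\<^sup>2" "-pi" pi] in \<open>simp add: content_real\<close>)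
    then show ?thesis by (simp add: integral_unique)
  qed
  also have "\<dots> = cint (\<lambda>x. (w' x)\<^sup>2) - P\<^sup>2 / (2 * pi)"
    by (simp add: q_def power2_eq_square field_simps)
  finally have "P\<^sup>2 \<le> 2 * pi * cint (\<lambda>x. (w' x)\<^sup>2)"
    by (simp add: field_simps)
  moreover have "(w x)\<^sup>2 \<le> P\<^sup>2"
    using wP P0 by (simp add: abs_le_square_iff[symmetric])
  ultimately show ?thesis by linarith
qed

text \<open>One notion for three situations: positive times with factor 1 (the classical equation),
  positive times with the factor produced by the truncation, and all real times for a complete
  trajectory.\<close>

definition ks_reg :: "real set \<Rightarrow> (real \<Rightarrow> real) \<Rightarrow> real \<Rightarrow> real \<Rightarrow> (real \<Rightarrow> real \<Rightarrow> real) \<Rightarrow> bool" where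
  "ks_reg J \<theta> a L u \<longleftrightarrow>
     (\<forall>t\<in>J. \<forall>x. u t (x + 2 * pi) = u t x) \<and>
     (\<forall>t\<in>J. \<forall>x. \<forall>k<4. ((\<lambda>y. dx k u t y) has_real_derivative dx (Suc k) u t x) (at x)) \<and>
     (\<forall>t\<in>J. \<forall>x. ((\<lambda>s. u s x) has_real_derivative dt u t x) (at t)) \<and>
     (\<forall>k\<le>4. continuous_on (J \<times> UNIV) (\<lambda>(t, x). dx k u t x)) \<and>
     continuous_on (J \<times> UNIV) (\<lambda>(t, x). dt u t x) \<and>
     (\<forall>t\<in>J. \<forall>x. dt u t x =
         - dx 4 u t x - a * dx 2 u t x + \<theta> t * (u t x * dx 1 u t x) + L * dx 3 u t x)"

lemma ks_classical_iff_reg: "ks_classical a L u \<longleftrightarrow> ks_reg {0<..} (\<lambda>_. 1) a L u"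
  by (simp add: ks_classical_def ks_reg_def Ball_def)

lemma periodic_derivative:
  assumes "\<And>x. f (x + p) = f x" "\<And>x. (f has_real_derivative f' x) (at x)"
  shows "f' (x + p) = f' x"
proof -
  have "((\<lambda>y. f (y + p)) has_real_derivative f' (x + p)) (at x)"
    using assms(2)[of "x + p"] by (simp add: DERIV_shift)
  then show ?thesis
    using assms by (simp add: DERIV_unique)
qed

lemma periodic_eq_zero:
  fixes f :: "real \<Rightarrow> real"
  assumes per: "\<And>x. f (x + 2 * pi) = f x" and z: "\<And>x. x \<in> {-pi..pi} \<Longrightarrow> f x = 0"
  shows "f x = 0"
proof -
  have shift: "f (y + 2 * pi * of_int k) = f y" for k y
  proof (induction k rule: int_induct[where k = 0])
    case (step1 i)
    then show ?case using per[of "y + 2 * pi * of_int i"] by (simp add: algebra_simps)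
  next
    case (step2 i)
    then show ?case using per[of "y + 2 * pi * of_int (i - 1)"] by (simp add: algebra_simps)
  qed simp
  define k where "k = \<lfloor>(x + pi) / (2 * pi)\<rfloor>"
  have "of_int k \<le> (x + pi) / (2 * pi)" "(x + pi) / (2 * pi) < of_int k + 1"
    unfolding k_def by linarith+
  then have "x - 2 * pi * of_int k \<in> {-pi..pi}"
    by (auto simp: field_simps)
  then show ?thesis
    using z shift[of "x - 2 * pi * of_int k" k] by simp
qed

section \<open>Conservation of the mean and the energy balance\<close>

locale ks_smooth =
  fixes J :: "real set" and \<theta> :: "real \<Rightarrow> real" and a L :: real and u :: "real \<Rightarrow> real \<Rightarrow> real"
  assumes reg: "ks_reg J \<theta> a L u" and J: "open J" "convex J"
begin

lemma dx0 [simp]: "dx 0 u = u"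
  by (intro ext) (simp add: dx_def)

lemma D: "t \<in> J \<Longrightarrow> k < 4 \<Longrightarrow> (dx k u t has_real_derivative dx (Suc k) u t x) (at x)"
  using reg by (auto simp: ks_reg_def)

lemma D0: "t \<in> J \<Longrightarrow> (u t has_real_derivative dx 1 u t x) (at x)"
  using D[of t 0] by simp
lemma D1: "t \<in> J \<Longrightarrow> (dx 1 u t has_real_derivative dx 2 u t x) (at x)"
  using D[of t 1] by (simp add: numeral_2_eq_2)
lemma D2: "t \<in> J \<Longrightarrow> (dx 2 u t has_real_derivative dx 3 u t x) (at x)"
  using D[of t 2] by (simp add: numeral_3_eq_3 numeral_2_eq_2)
lemma D3: "t \<in> J \<Longrightarrow> (dx 3 u t has_real_derivative dx 4 u t x) (at x)"
  using D[of t 3] by (simp add: eval_nat_numeral)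

lemma Dt: "t \<in> J \<Longrightarrow> ((\<lambda>s. u s x) has_real_derivative dt u t x) (at t)"
  using reg by (auto simp: ks_reg_def)

lemma per: "t \<in> J \<Longrightarrow> k \<le> 4 \<Longrightarrow> dx k u t (x + 2 * pi) = dx k u t x"
proof (induction k arbitrary: x)
  case 0
  then show ?case using reg by (simp add: ks_reg_def)
next
  case (Suc k)
  have "dx k u t (y + 2 * pi) = dx k u t y" for y
    using Suc by simp
  moreover have "(dx k u t has_real_derivative dx (Suc k) u t y) (at y)" for y
    using Suc.prems by (intro D) auto
  ultimately show ?case
    by (rule periodic_derivative)
qed

lemma per_ends: "t \<in> J \<Longrightarrow> k \<le> 4 \<Longrightarrow> dx k u t pi = dx k u t (-pi)"
  using per[of t k "-pi"] by simp
lemma per_ends0: "t \<in> J \<Longrightarrow> u t pi = u t (-pi)"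
  using per_ends[of t 0] by simp

lemma cjoint: "k \<le> 4 \<Longrightarrow> continuous_on (J \<times> UNIV) (\<lambda>(t, x). dx k u t x)"
  using reg by (auto simp: ks_reg_def)
lemma cjoint0: "continuous_on (J \<times> UNIV) (\<lambda>(t, x). u t x)"
  using cjoint[of 0] by simp
lemma cjointt: "continuous_on (J \<times> UNIV) (\<lambda>(t, x). dt u t x)"
  using reg by (auto simp: ks_reg_def)

lemma cslice: "t \<in> J \<Longrightarrow> k \<le> 4 \<Longrightarrow> continuous_on A (dx k u t)"
  using continuous_on_joint_slice[OF cjoint] by blast
lemma cslice0: "t \<in> J \<Longrightarrow> continuous_on A (u t)"
  using cslice[of t 0] by simp
lemma cslicet: "t \<in> J \<Longrightarrow> continuous_on A (dt u t)"
  using continuous_on_joint_slice[OF cjointt] by blast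

lemma eqn: "t \<in> J \<Longrightarrow> dt u t x = - dx 4 u t x - a * dx 2 u t x + \<theta> t * (u t x * dx 1 u t x) + L * dx 3 u t x"
  using reg by (auto simp: ks_reg_def)

lemma in_H_u: "t \<in> J \<Longrightarrow> in_H (u t)"
proof -
  assume t: "t \<in> J"
  have "set_integrable lborel {-pi..pi} (\<lambda>x. (u t x)\<^sup>2)"
    by (intro borel_integrable_atLeastAtMost' continuous_intros cslice0 t)
  then show "in_H (u t)"
    using per[OF t, of 0] borel_measurable_continuous_onI[OF cslice0[OF t]] by (simp add: in_H_def)
qed

lemma hnorm_u: "t \<in> J \<Longrightarrow> cint (\<lambda>x. (u t x)\<^sup>2) = 2 * pi * (hnorm (u t))\<^sup>2"
  unfolding hnorm_sq by (subst integral_circ_continuous) (auto intro!: continuous_intros cslice0)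

text \<open>The right-hand side of the equation is the \<open>x\<close>-derivative of a periodic
  flux, whatever the value of \<open>\<theta> t\<close>.\<close>

lemma mean_constant:
  assumes "s \<in> J" "t \<in> J"
  shows "cint (u s) = cint (u t)"
proof -
  have z: "((\<lambda>s. cint (u s)) has_real_derivative 0) (at r)" if r: "r \<in> J" for r
  proof -
    have "(dt u r has_integral 0) {-pi..pi}"
    proof (rule cint_total_derivative)
      show "((\<lambda>x. - dx 3 u r x - a * dx 1 u r x + \<theta> r * (u r x)\<^sup>2 / 2 + L * dx 2 u r x) has_real_derivative dt u r x) (at x)" for x
        unfolding eqn[OF r]
        by (rule derivative_eq_intros D0 D1 D2 D3 r refl | simp)+
    qed (simp add: per_ends per_ends0 r)
    then have "cint (dt u r) = 0" by (rule integral_unique)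
    moreover have "((\<lambda>s. cint (u s)) has_real_derivative cint (dt u r)) (at r)"
      by (rule cint_has_derivative[OF J r Dt cslice0 cjointt])
    ultimately show ?thesis by simp
  qed
  have "((\<lambda>s. cint (u s)) has_real_derivative 0) (at r within J)" if "r \<in> J" for r
    by (rule has_field_derivative_at_within[OF z[OF that]])
  from has_field_derivative_zero_constant[OF J(2) this]
  obtain c where "\<forall>x\<in>J. cint (u x) = c" by blast
  then show ?thesis using assms by simp
qed

text \<open>The products of \<open>u\<close> with \<open>u * u_x\<close> and with
  \<open>u_xxx\<close> are the derivatives of \<open>u^3 / 3\<close> and
  \<open>u * u_xx - u_x^2 / 2\<close>, so neither \<open>\<theta>\<close> nor \<open>L\<close>
  enters the balance. The a priori bound thus survives the truncation, and the later constants are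
  free of \<open>L\<close>.\<close>

lemma energy_derivative:
  assumes t: "t \<in> J"
  shows "((\<lambda>s. cint (\<lambda>x. (u s x)\<^sup>2)) has_real_derivative
           cint (\<lambda>x. - 2 * (dx 2 u t x)\<^sup>2 - 2 * a * (u t x * dx 2 u t x))) (at t)"
proof -
  have d: "((\<lambda>s. cint (\<lambda>x. (u s x)\<^sup>2)) has_real_derivative cint (\<lambda>x. 2 * (u t x * dt u t x))) (at t)"
  proof (rule cint_has_derivative[OF J t])
    show "((\<lambda>s. (u s x)\<^sup>2) has_real_derivative 2 * (u r x * dt u r x)) (at r)" if "r \<in> J" for r x
      by (rule derivative_eq_intros Dt that refl | simp)+
    show "continuous_on UNIV (\<lambda>x. (u r x)\<^sup>2)" if "r \<in> J" for r
      by (intro continuous_intros cslice0 that)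
    show "continuous_on (J \<times> UNIV) (\<lambda>(r, x). 2 * (u r x * dt u r x))"
      using cjoint0 cjointt unfolding split_beta by (intro continuous_intros)
  qed
  have e: "cint (\<lambda>x. 2 * (u t x * dt u t x)) = cint (\<lambda>x. - 2 * (dx 2 u t x)\<^sup>2 - 2 * a * (u t x * dx 2 u t x))"
  proof (rule cint_mod_total_derivative)
    let ?F = "\<lambda>x. - 2 * (u t x * dx 3 u t x) + 2 * (dx 1 u t x * dx 2 u t x) + 2 * \<theta> t * (u t x ^ 3 / 3) + 2 * L * (u t x * dx 2 u t x - (dx 1 u t x)\<^sup>2 / 2)"
    let ?f = "\<lambda>x. 2 * (u t x * dt u t x) + 2 * (dx 2 u t x)\<^sup>2 + 2 * a * (u t x * dx 2 u t x)"
    show "(?F has_real_derivative ?f x) (at x)" for x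
      unfolding eqn[OF t]
      by (rule derivative_eq_intros D0 D1 D2 D3 t refl | simp)+
        (simp add: algebra_simps power2_eq_square power3_eq_cube)
    show "?F pi = ?F (-pi)" by (simp add: per_ends per_ends0 t)
    show "continuous_on UNIV (\<lambda>x. 2 * (u t x * dt u t x))"
      by (intro continuous_intros cslice0 cslicet t)
    show "continuous_on UNIV (\<lambda>x. - 2 * (dx 2 u t x)\<^sup>2 - 2 * a * (u t x * dx 2 u t x))"
      by (intro continuous_intros cslice0 cslice t) auto
  qed simp
  show ?thesis by (rule d[unfolded e])
qed

text \<open>Both bounds complete a square. The first spends all the dissipation on the growth rate;
  the second keeps one copy of the integral of \<open>u_xx^2\<close>, which will bound the remainder
  of the normal form.\<close>

lemma energy_rate_le:
  assumes t: "t \<in> J"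
  shows "cint (\<lambda>x. - 2 * (dx 2 u t x)\<^sup>2 - 2 * a * (u t x * dx 2 u t x)) \<le> a\<^sup>2 / 2 * cint (\<lambda>x. (u t x)\<^sup>2)"
    and "cint (\<lambda>x. - 2 * (dx 2 u t x)\<^sup>2 - 2 * a * (u t x * dx 2 u t x)) \<le> a\<^sup>2 * cint (\<lambda>x. (u t x)\<^sup>2) - cint (\<lambda>x. (dx 2 u t x)\<^sup>2)"
proof -
  let ?g = "\<lambda>x. - 2 * (dx 2 u t x)\<^sup>2 - 2 * a * (u t x * dx 2 u t x)"
  have cg: "continuous_on UNIV ?g" by (intro continuous_intros cslice0 cslice t) auto
  have "cint ?g \<le> cint (\<lambda>x. a\<^sup>2 / 2 * (u t x)\<^sup>2)"
  proof (rule cint_mono[OF cg])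
    show "?g x \<le> a\<^sup>2 / 2 * (u t x)\<^sup>2" for x
      using zero_le_power2[of "2 * dx 2 u t x + a * u t x"] by (simp add: power2_eq_square algebra_simps)
  qed (intro continuous_intros cslice0 t)
  then show "cint ?g \<le> a\<^sup>2 / 2 * cint (\<lambda>x. (u t x)\<^sup>2)" by simp
  have "cint ?g \<le> cint (\<lambda>x. a\<^sup>2 * (u t x)\<^sup>2 + - (dx 2 u t x)\<^sup>2)"
  proof (rule cint_mono[OF cg])
    show "?g x \<le> a\<^sup>2 * (u t x)\<^sup>2 + - (dx 2 u t x)\<^sup>2" for x
      using zero_le_power2[of "dx 2 u t x + a * u t x"] by (simp add: power2_eq_square algebra_simps)
  qed (intro continuous_intros cslice0 cslice t; simp)
  also have "\<dots> = a\<^sup>2 * cint (\<lambda>x. (u t x)\<^sup>2) - cint (\<lambda>x. (dx 2 u t x)\<^sup>2)"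
    by (subst cint_add) (auto intro!: continuous_intros cslice0 cslice t)
  finally show "cint ?g \<le> a\<^sup>2 * cint (\<lambda>x. (u t x)\<^sup>2) - cint (\<lambda>x. (dx 2 u t x)\<^sup>2)" .
qed

lemma energy_growth:
  assumes "s \<in> J" "t \<in> J" "s \<le> t"
  shows "cint (\<lambda>x. (u t x)\<^sup>2) \<le> exp (a\<^sup>2 / 2 * (t - s)) * cint (\<lambda>x. (u s x)\<^sup>2)"
proof (rule gronwall[OF assms(3), where y = "\<lambda>r. cint (\<lambda>x. (u r x)\<^sup>2)"
      and y' = "\<lambda>r. cint (\<lambda>x. - 2 * (dx 2 u r x)\<^sup>2 - 2 * a * (u r x * dx 2 u r x))"])
  fix r assume "s \<le> r" "r \<le> t"
  then have r: "r \<in> J"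
    using mem_is_interval_1_I[of J s t r, unfolded is_interval_convex_1, OF J(2) assms(1,2)] by blast
  show "((\<lambda>r. cint (\<lambda>x. (u r x)\<^sup>2)) has_real_derivative
           cint (\<lambda>x. - 2 * (dx 2 u r x)\<^sup>2 - 2 * a * (u r x * dx 2 u r x))) (at r)"
    by (rule energy_derivative[OF r])
  show "cint (\<lambda>x. - 2 * (dx 2 u r x)\<^sup>2 - 2 * a * (u r x * dx 2 u r x)) \<le> a\<^sup>2 / 2 * cint (\<lambda>x. (u r x)\<^sup>2)"
    by (rule energy_rate_le[OF r])
qed

end


subsection \<open>Uniqueness\<close>

lemma in_H_diff:
  assumes f: "in_H f" and g: "in_H g"
  shows "in_H (f - g)" and "(hnorm (f - g))\<^sup>2 \<le> 2 * (hnorm f)\<^sup>2 + 2 * (hnorm g)\<^sup>2"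
proof -
  have m: "f - g \<in> borel_measurable borel"
    using f g unfolding in_H_def fun_diff_def by (intro borel_measurable_diff) auto
  have i: "integrable circ (\<lambda>x. 2 * (f x)\<^sup>2 + 2 * (g x)\<^sup>2)"
    using in_H_integrable_sq[OF f] in_H_integrable_sq[OF g] by simp
  have le: "((f - g) x)\<^sup>2 \<le> 2 * (f x)\<^sup>2 + 2 * (g x)\<^sup>2" for x
    using zero_le_power2[of "f x + g x"] by (simp add: power2_eq_square algebra_simps)
  have i': "integrable circ (\<lambda>x. ((f - g) x)\<^sup>2)"
    using le by (intro Bochner_Integration.integrable_bound[OF i] borel_measurable_power measurable_circ m AE_I2) auto
  show "in_H (f - g)"
    using m i' f g by (simp add: in_H_def set_integrable_circ)
  have "integral\<^sup>L circ (\<lambda>x. ((f - g) x)\<^sup>2) \<le> integral\<^sup>L circ (\<lambda>x. 2 * (f x)\<^sup>2 + 2 * (g x)\<^sup>2)"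
    using i' i le by (rule integral_mono)
  also have "\<dots> = 2 * integral\<^sup>L circ (\<lambda>x. (f x)\<^sup>2) + 2 * integral\<^sup>L circ (\<lambda>x. (g x)\<^sup>2)"
    using in_H_integrable_sq[OF f] in_H_integrable_sq[OF g] by simp
  finally show "(hnorm (f - g))\<^sup>2 \<le> 2 * (hnorm f)\<^sup>2 + 2 * (hnorm g)\<^sup>2"
    unfolding hnorm_sq by (simp add: field_simps)
qed

lemma fourier_coeff_diff:
  assumes "in_H f" "in_H g"
  shows "fourier_coeff (f - g) k = fourier_coeff f k - fourier_coeff g k"
  using in_H_integrable_cis[OF assms(1), of "-k"] in_H_integrable_cis[OF assms(2), of "-k"]
  by (simp add: fourier_coeff_def left_diff_distrib diff_divide_distrib)

lemma fourier_coeff_zero_mean: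
  assumes "in_H0 f"
  shows "fourier_coeff f 0 = 0"
  using assms by (simp add: in_H0_def fourier_coeff_def LINT_circ)

lemma hnorm_eq_zero_continuous:
  assumes c: "continuous_on UNIV f" and z: "cint (\<lambda>x. (f x)\<^sup>2) = 0" and x: "x \<in> {-pi..pi}"
  shows "f x = 0"
proof -
  have "((\<lambda>x. (f x)\<^sup>2) has_integral 0) (cbox (-pi) pi)"
    using integrable_integral[of "\<lambda>x. (f x)\<^sup>2" "{-pi..pi}"] z c
    by (simp add: integrable_continuous_interval continuous_on_power continuous_on_subset)
  then have "(f x)\<^sup>2 = 0"
    by (rule has_integral_0_cbox_imp_0[rotated 2]) (use x c pi_gt_zero in \<open>auto intro!: continuous_intros continuous_on_subset[OF c] simp del: pi_gt_zero\<close>)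
  then show ?thesis by simp
qed

text \<open>A solution is classical for positive times and meets its datum in the norm of H. Mean
  and energy are therefore compared with those of \<open>f\<close> at a small time \<open>s\<close>:
  the mean in the limit, the energy at one \<open>s\<close> with
  \<open>hnorm (u s - f) < 1\<close>.\<close>

lemma solution_from_facts:
  assumes sol: "ks_solution_from a L f u" and f: "in_H0 f"
  shows "ks_smooth {0<..} (\<lambda>_. 1) a L u"
    and "t > 0 \<Longrightarrow> cint (u t) = 0"
    and "t > 0 \<Longrightarrow> cint (\<lambda>x. (u t x)\<^sup>2) \<le> exp (a\<^sup>2 / 2 * t) * (4 * pi * (1 + (hnorm f)\<^sup>2))"
proof -
  show smooth: "ks_smooth {0<..} (\<lambda>_. 1) a L u"
    using sol by unfold_locales (auto simp: ks_solution_from_def ks_classical_iff_reg)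
  interpret ks_smooth "{0<..}" "\<lambda>_. 1" a L u by (rule smooth)
  have fH: "in_H f" using f by (simp add: in_H0_def)
  have lim: "((\<lambda>s. hnorm (u s - f)) \<longlongrightarrow> 0) (at_right 0)"
    using sol by (simp add: ks_solution_from_def)
  have pos: "\<forall>\<^sub>F s in at_right (0::real). 0 < s"
    by (simp add: eventually_at_right_less)
  show "cint (u t) = 0" if t: "t > 0"
  proof -
    have u0: "fourier_coeff (u s) 0 = cint (u t) / (2 * pi)" if s: "0 < s" for s
    proof -
      have "integral\<^sup>L circ (\<lambda>x. complex_of_real (u s x)) = of_real (integral\<^sup>L circ (u s))"
        by (rule integral_complex_of_real)
      also have "integral\<^sup>L circ (u s) = cint (u t)"
        using s t mean_constant[of s t] by (simp add: integral_circ_continuous cslice0)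
      finally show ?thesis by (simp add: fourier_coeff_def)
    qed
    have "\<forall>\<^sub>F s in at_right 0. \<bar>cint (u t) / (2 * pi)\<bar> \<le> hnorm (u s - f)"
      using pos
    proof eventually_elim
      case (elim s)
      then have "cmod (fourier_coeff (u s - f) 0) \<le> hnorm (u s - f)"
        by (intro fourier_coeff_le in_H_diff fH in_H_u) auto
      then show ?case
        using elim by (simp add: fourier_coeff_diff in_H_u fH u0 fourier_coeff_zero_mean f norm_divide)
    qed
    then have "\<bar>cint (u t) / (2 * pi)\<bar> \<le> 0"
      by (intro tendsto_lowerbound[OF lim]) auto
    then have "cint (u t) / (2 * pi) = 0" by linarith
    then show ?thesis by simp
  qed
  show "cint (\<lambda>x. (u t x)\<^sup>2) \<le> exp (a\<^sup>2 / 2 * t) * (4 * pi * (1 + (hnorm f)\<^sup>2))" if t: "t > 0"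
  proof -
    have "\<forall>\<^sub>F s in at_right 0. hnorm (u s - f) < 1"
      using lim by (rule order_tendstoD) simp
    moreover have "\<forall>\<^sub>F s in at_right (0::real). s < t"
      using t by (rule eventually_at_right_real[THEN eventually_mono]) auto
    ultimately have "\<forall>\<^sub>F s in at_right (0::real). hnorm (u s - f) < 1 \<and> 0 < s \<and> s < t"
      using pos by eventually_elim auto
    then obtain s where s: "hnorm (u s - f) < 1" "0 < s" "s < t"
      using eventually_happens[of _ "at_right (0::real)"] by auto
    have us: "in_H (u s)" using s by (intro in_H_u) simp
    have "(hnorm (u s - f))\<^sup>2 \<le> 1"
      using s hnorm_nonneg[of "u s - f"] by (simp add: power_le_one)
    \<comment> \<open>\<open>u s\<close> is written as \<open>(u s - f) - (- f)\<close>, since the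
      inequality at hand concerns differences.\<close>
    moreover have "(hnorm ((u s - f) - (\<lambda>x. - f x)))\<^sup>2 \<le> 2 * (hnorm (u s - f))\<^sup>2 + 2 * (hnorm (\<lambda>x. - f x))\<^sup>2"
    proof (rule in_H_diff)
      show "in_H (u s - f)" by (rule in_H_diff[OF us fH])
      show "in_H (\<lambda>x. - f x)" using fH by (auto simp: in_H_def)
    qed
    moreover have "(u s - f) - (\<lambda>x. - f x) = u s" by auto
    moreover have "hnorm (\<lambda>x. - f x) = hnorm f" by (simp add: hnorm_def)
    ultimately have "(hnorm (u s))\<^sup>2 \<le> 2 * (1 + (hnorm f)\<^sup>2)" by simp
    then have "cint (\<lambda>x. (u s x)\<^sup>2) \<le> 4 * pi * (1 + (hnorm f)\<^sup>2)"
      using s hnorm_u[of s] by simp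
    moreover have "cint (\<lambda>x. (u t x)\<^sup>2) \<le> exp (a\<^sup>2 / 2 * (t - s)) * cint (\<lambda>x. (u s x)\<^sup>2)"
      using s by (intro energy_growth) auto
    moreover have "exp (a\<^sup>2 / 2 * (t - s)) \<le> exp (a\<^sup>2 / 2 * t)"
      using s by (simp add: mult_left_mono)
    moreover have "0 \<le> cint (\<lambda>x. (u s x)\<^sup>2)" using hnorm_u[of s] s by simp
    ultimately show ?thesis
      by (meson exp_ge_zero mult_mono order_trans)
  qed
qed

text \<open>Energy estimate for the difference \<open>w\<close>. The nonlinear contribution
  \<open>- (u + v) * w * w_x\<close> is controlled by the square-integral of \<open>u + v\<close>
  and by the supremum of \<open>w\<close>, which for zero mean is bounded by the norm of
  \<open>w_x\<close>; the dissipation absorbs the result. Gronwall is started at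
  \<open>s > 0\<close>, and \<open>s\<close> then tends to 0.\<close>

theorem ks_solution_unique:
  assumes su: "ks_solution_from a L f u" and sv: "ks_solution_from a L f v" and f: "in_H0 f"
    and t: "0 < t"
  shows "u t = v t"
proof -
  interpret U: ks_smooth "{0<..}" "\<lambda>_. 1" a L u by (rule solution_from_facts[OF su f])
  interpret V: ks_smooth "{0<..}" "\<lambda>_. 1" a L v by (rule solution_from_facts[OF sv f])
  define w where "w = (\<lambda>k r x. dx k u r x - dx k v r x)"
  define wt where "wt = (\<lambda>r x. dt u r x - dt v r x)"
  define B where "B = exp (a\<^sup>2 / 2 * t) * (4 * pi * (1 + (hnorm f)\<^sup>2))"
  have Bpos: "0 \<le> B" by (simp add: B_def)
  \<comment> \<open>\<open>4 * B\<close> bounds the integral of \<open>(u + v)^2\<close> up to time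
    \<open>t\<close>, and \<open>2 * pi\<close> comes from \<open>zero_mean_sup\<close>. The next
    constant \<open>c\<close> results from completing the square in
    \<open>- 2 * w_xx^2 - (2 * a + K) * w * w_xx\<close>.\<close>
  define K where "K = (1 + 2 * pi * (4 * B)) / 2"
  define c where "c = (2 * a + K)\<^sup>2 / 8"
  define W where "W = (\<lambda>r. cint (\<lambda>x. (w 0 r x)\<^sup>2))"
  define W' where "W' = (\<lambda>r. cint (\<lambda>x. 2 * (w 0 r x * wt r x)))"
  note der = U.D0 U.D1 U.D2 U.D3 V.D0 V.D1 V.D2 V.D3
  have wc: "continuous_on A (w k r)" if "0 < r" "k \<le> 4" for A k r
    unfolding w_def using that by (intro continuous_intros U.cslice V.cslice) auto
  have wtc: "continuous_on A (wt r)" if "0 < r" for A r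
    unfolding wt_def using that by (intro continuous_intros U.cslicet V.cslicet) auto
  have wd: "(w k r has_real_derivative w (Suc k) r x) (at x)" if "0 < r" "k < 4" for k r x
    unfolding w_def using that by (intro derivative_intros U.D V.D) auto
  have Wd: "(W has_real_derivative W' r) (at r)" if r: "0 < r" for r
    unfolding W_def W'_def
  proof (rule cint_has_derivative[OF U.J])
    show "r \<in> {0<..}" using r by simp
    show "((\<lambda>s. (w 0 s x)\<^sup>2) has_real_derivative 2 * (w 0 r x * wt r x)) (at r)" if "r \<in> {0<..}" for r x
      unfolding w_def wt_def U.dx0 V.dx0
      by (rule derivative_eq_intros U.Dt V.Dt that refl | simp)+
    show "continuous_on UNIV (\<lambda>x. (w 0 r x)\<^sup>2)" if "r \<in> {0<..}" for r
      using that by (intro continuous_intros wc) auto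
    show "continuous_on ({0<..} \<times> UNIV) (\<lambda>(r, x). 2 * (w 0 r x * wt r x))"
      using U.cjoint0 V.cjoint0 U.cjointt V.cjointt unfolding w_def wt_def U.dx0 V.dx0 split_beta
      by (intro continuous_intros)
  qed
  have rate: "W' r \<le> c * W r" if r: "0 < r" "r \<le> t" for r
  proof -
    let ?s = "\<lambda>x. u r x + v r x"
    have r': "r \<in> {0<..}" using r by simp
    have sc: "continuous_on A ?s" for A using r by (intro continuous_intros U.cslice0 V.cslice0) auto
    have "W' r = cint (\<lambda>x. - 2 * (w 2 r x)\<^sup>2 - 2 * a * (w 0 r x * w 2 r x) + - (?s x * w 0 r x * w 1 r x))"
      unfolding W'_def
    proof (rule cint_mod_total_derivative)
      let ?F = "\<lambda>x. - 2 * (w 0 r x * w 3 r x) + 2 * (w 1 r x * w 2 r x) + ?s x * (w 0 r x)\<^sup>2 + 2 * L * (w 0 r x * w 2 r x - (w 1 r x)\<^sup>2 / 2)"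
      let ?f = "\<lambda>x. 2 * (w 0 r x * wt r x) + 2 * (w 2 r x)\<^sup>2 + 2 * a * (w 0 r x * w 2 r x) + ?s x * w 0 r x * w 1 r x"
      show "(?F has_real_derivative ?f x) (at x)" for x
        unfolding w_def wt_def U.eqn[OF r'] V.eqn[OF r'] U.dx0 V.dx0
        by (rule derivative_eq_intros der r' refl | simp)+
          (simp add: algebra_simps power2_eq_square power3_eq_cube)
      show "?F pi = ?F (-pi)"
        by (simp add: w_def U.per_ends V.per_ends U.per_ends0 V.per_ends0 r)
      show "continuous_on UNIV (\<lambda>x. 2 * (w 0 r x * wt r x))"
        using r by (intro continuous_intros wc wtc) auto
      show "continuous_on UNIV (\<lambda>x. - 2 * (w 2 r x)\<^sup>2 - 2 * a * (w 0 r x * w 2 r x) + - (?s x * w 0 r x * w 1 r x))"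
        using r by (intro continuous_intros wc sc) auto
    qed simp
    also have "\<dots> = cint (\<lambda>x. - 2 * (w 2 r x)\<^sup>2 - 2 * a * (w 0 r x * w 2 r x)) + cint (\<lambda>x. - (?s x * w 0 r x * w 1 r x))"
      using r by (intro cint_add continuous_intros wc sc) auto
    also have "cint (\<lambda>x. - (?s x * w 0 r x * w 1 r x)) \<le> K * cint (\<lambda>x. (w 1 r x)\<^sup>2)"
    proof -
      define P where "P = 2 * pi * cint (\<lambda>x. (w 1 r x)\<^sup>2)"
      have P0: "0 \<le> P" unfolding P_def using r
        by (intro mult_nonneg_nonneg cint_nonneg continuous_intros wc) auto
      have w_sup: "(w 0 r x)\<^sup>2 \<le> P" if "x \<in> {-pi..pi}" for x
        unfolding P_def
      proof (rule zero_mean_sup[OF _ _ _ that])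
        show "(w 0 r has_real_derivative w 1 r x) (at x)" for x using wd[of r 0 x] r by simp
        show "continuous_on UNIV (w 1 r)" using r by (intro wc) auto
        have "cint (w 0 r) = cint (u r) - cint (v r)"
          unfolding w_def U.dx0 V.dx0 using r
          by (intro Henstock_Kurzweil_Integration.integral_diff integrable_continuous_interval U.cslice0 V.cslice0) auto
        then show "cint (w 0 r) = 0"
          using solution_from_facts(2)[OF su f r(1)] solution_from_facts(2)[OF sv f r(1)] by simp
      qed
      have s_le: "cint (\<lambda>x. (?s x)\<^sup>2) \<le> 4 * B"
      proof -
        have "exp (a\<^sup>2 / 2 * r) * (4 * pi * (1 + (hnorm f)\<^sup>2)) \<le> B"
          unfolding B_def using r by (intro mult_right_mono) (auto simp: mult_left_mono)
        then have "cint (\<lambda>x. (u r x)\<^sup>2) \<le> B" "cint (\<lambda>x. (v r x)\<^sup>2) \<le> B"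
          using solution_from_facts(3)[OF su f r(1)] solution_from_facts(3)[OF sv f r(1)] by linarith+
        moreover have "cint (\<lambda>x. (?s x)\<^sup>2) \<le> cint (\<lambda>x. 2 * (u r x)\<^sup>2 + 2 * (v r x)\<^sup>2)"
        proof (rule cint_mono)
          show "(?s x)\<^sup>2 \<le> 2 * (u r x)\<^sup>2 + 2 * (v r x)\<^sup>2" for x
            using zero_le_power2[of "u r x - v r x"] by (simp add: power2_eq_square algebra_simps)
        qed (use r in \<open>auto intro!: continuous_intros U.cslice0 V.cslice0\<close>)
        moreover have "\<dots> = 2 * cint (\<lambda>x. (u r x)\<^sup>2) + 2 * cint (\<lambda>x. (v r x)\<^sup>2)"
          using r by (subst cint_add) (auto intro!: continuous_intros U.cslice0 V.cslice0)
        ultimately show ?thesis by linarith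
      qed
      have "cint (\<lambda>x. - (?s x * w 0 r x * w 1 r x)) \<le> cint (\<lambda>x. P / 2 * (?s x)\<^sup>2 + 1 / 2 * (w 1 r x)\<^sup>2)"
      proof (rule integral_le)
        fix x assume x: "x \<in> {-pi..pi}"
        have "- (?s x * w 0 r x * w 1 r x) \<le> (?s x)\<^sup>2 * (w 0 r x)\<^sup>2 / 2 + (w 1 r x)\<^sup>2 / 2"
          using zero_le_power2[of "?s x * w 0 r x + w 1 r x"] by (simp add: power2_sum power_mult_distrib)
        also have "(?s x)\<^sup>2 * (w 0 r x)\<^sup>2 \<le> (?s x)\<^sup>2 * P"
          using w_sup[OF x] by (intro mult_left_mono) auto
        finally show "- (?s x * w 0 r x * w 1 r x) \<le> P / 2 * (?s x)\<^sup>2 + 1 / 2 * (w 1 r x)\<^sup>2"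
          by (simp add: mult.commute)
      qed (use r in \<open>auto intro!: integrable_continuous_interval continuous_intros wc sc\<close>)
      also have "\<dots> = P / 2 * cint (\<lambda>x. (?s x)\<^sup>2) + 1 / 2 * cint (\<lambda>x. (w 1 r x)\<^sup>2)"
        using r by (subst cint_add) (auto intro!: continuous_intros wc sc)
      also have "\<dots> \<le> P / 2 * (4 * B) + 1 / 2 * cint (\<lambda>x. (w 1 r x)\<^sup>2)"
        using s_le P0 by (intro add_right_mono mult_left_mono) auto
      also have "\<dots> = K * cint (\<lambda>x. (w 1 r x)\<^sup>2)"
        by (simp add: P_def K_def field_simps)
      finally show ?thesis .
    qed
    \<comment> \<open>Another integration by parts turns \<open>w_x^2\<close> into
      \<open>- w * w_xx\<close>, which has the form of the linear term with coefficient
      \<open>a\<close> and is absorbed together with it.\<close>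
    also have "K * cint (\<lambda>x. (w 1 r x)\<^sup>2) = cint (\<lambda>x. - K * (w 0 r x * w 2 r x))"
    proof -
      have "cint (\<lambda>x. (w 1 r x)\<^sup>2) = cint (\<lambda>x. - (w 0 r x * w 2 r x))"
      proof (rule cint_mod_total_derivative)
        show "((\<lambda>x. w 0 r x * w 1 r x) has_real_derivative ((w 1 r x)\<^sup>2 + w 0 r x * w 2 r x)) (at x)" for x
          unfolding w_def U.dx0 V.dx0
          by (rule derivative_eq_intros der r' refl | simp)+ (simp add: algebra_simps power2_eq_square)
        show "w 0 r pi * w 1 r pi = w 0 r (- pi) * w 1 r (- pi)"
          by (simp add: w_def U.per_ends V.per_ends U.per_ends0 V.per_ends0 r)
      qed (use r in \<open>auto intro!: continuous_intros wc\<close>)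
      then show ?thesis by simp
    qed
    also have "cint (\<lambda>x. - 2 * (w 2 r x)\<^sup>2 - 2 * a * (w 0 r x * w 2 r x)) + \<dots>
        = cint (\<lambda>x. - 2 * (w 2 r x)\<^sup>2 - 2 * a * (w 0 r x * w 2 r x) + - K * (w 0 r x * w 2 r x))"
      using r by (intro cint_add[symmetric] continuous_intros wc) auto
    also have "\<dots> \<le> cint (\<lambda>x. c * (w 0 r x)\<^sup>2)"
    proof (rule cint_mono)
      show "- 2 * (w 2 r x)\<^sup>2 - 2 * a * (w 0 r x * w 2 r x) + - K * (w 0 r x * w 2 r x) \<le> c * (w 0 r x)\<^sup>2" for x
        using zero_le_power2[of "4 * w 2 r x + (2 * a + K) * w 0 r x"]
        by (simp add: c_def power2_eq_square algebra_simps)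
    qed (use r in \<open>auto intro!: continuous_intros wc\<close>)
    finally show ?thesis by (simp add: W_def)
  qed
  have grow: "W t \<le> exp (c * t) * (4 * pi * ((hnorm (u s - f))\<^sup>2 + (hnorm (v s - f))\<^sup>2))" if s: "0 < s" "s \<le> t" for s
  proof -
    have "W t \<le> exp (c * (t - s)) * W s"
      using s by (intro gronwall[where y' = W'] Wd rate) auto
    moreover have "exp (c * (t - s)) \<le> exp (c * t)"
      using s by (simp add: c_def mult_left_mono)
    moreover have "0 \<le> W s"
      unfolding W_def using s by (intro cint_nonneg continuous_intros wc) auto
    moreover have "W s \<le> 4 * pi * ((hnorm (u s - f))\<^sup>2 + (hnorm (v s - f))\<^sup>2)"
    proof -
      have H: "in_H f" "in_H (u s)" "in_H (v s)"
        using s f by (auto simp: in_H0_def intro!: U.in_H_u V.in_H_u)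
      have "(u s - f) - (v s - f) = u s - v s" by auto
      then have "(hnorm (u s - v s))\<^sup>2 \<le> 2 * (hnorm (u s - f))\<^sup>2 + 2 * (hnorm (v s - f))\<^sup>2"
        using in_H_diff(2)[OF in_H_diff(1)[OF H(2,1)] in_H_diff(1)[OF H(3,1)]] by simp
      moreover have "(hnorm (u s - v s))\<^sup>2 = W s / (2 * pi)"
        unfolding hnorm_sq W_def using s wc[of s 0]
        by (subst integral_circ_continuous) (auto intro!: continuous_intros U.cslice0 V.cslice0 simp: w_def)
      ultimately show ?thesis by (simp add: field_simps)
    qed
    ultimately show ?thesis
      by (meson exp_ge_zero mult_mono order_trans)
  qed
  have "W t \<le> 0"
  proof (rule tendsto_lowerbound)
    have "((\<lambda>s. hnorm (u s - f)) \<longlongrightarrow> 0) (at_right 0)" "((\<lambda>s. hnorm (v s - f)) \<longlongrightarrow> 0) (at_right 0)"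
      using su sv by (auto simp: ks_solution_from_def)
    then have "((\<lambda>s. exp (c * t) * (4 * pi * ((hnorm (u s - f))\<^sup>2 + (hnorm (v s - f))\<^sup>2))) \<longlongrightarrow> exp (c * t) * (4 * pi * (0\<^sup>2 + 0\<^sup>2))) (at_right 0)"
      by (intro tendsto_intros)
    then show "((\<lambda>s. exp (c * t) * (4 * pi * ((hnorm (u s - f))\<^sup>2 + (hnorm (v s - f))\<^sup>2))) \<longlongrightarrow> 0) (at_right 0)"
      by simp
    have "\<forall>\<^sub>F s in at_right 0. s \<in> {0<..<t}"
      using t by (rule eventually_at_right_real)
    then show "\<forall>\<^sub>F s in at_right 0. W t \<le> exp (c * t) * (4 * pi * ((hnorm (u s - f))\<^sup>2 + (hnorm (v s - f))\<^sup>2))"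
      by eventually_elim (auto intro: grow)
  qed simp
  moreover have "0 \<le> W t"
    unfolding W_def using t by (intro cint_nonneg continuous_intros wc) auto
  ultimately have W0: "cint (\<lambda>x. (w 0 t x)\<^sup>2) = 0" by (simp add: W_def)
  have z: "w 0 t x = 0" if "x \<in> {-pi..pi}" for x
    using t by (intro hnorm_eq_zero_continuous[OF wc W0 that]) auto
  have "w 0 t x = 0" for x
    by (rule periodic_eq_zero[OF _ z]) (use t U.per[of t 0] V.per[of t 0] in \<open>auto simp: w_def\<close>)
  then show ?thesis by (auto simp: w_def)
qed


section \<open>The truncated equation in Fourier variables\<close>

abbreviation br :: "int \<Rightarrow> real" where "br k \<equiv> 1 + \<bar>real_of_int k\<bar>"

section \<open>Bounds for the dissipative kernel\<close>

lemma br_pow4_le: "br k ^ 4 \<le> 16 * (1 + real_of_int k ^ 4 / 2)"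
proof -
  have "(1 + x) ^ 4 \<le> 16 * (1 + x ^ 4 / 2)" if "0 \<le> x" for x :: real
  proof -
    have "(1 + x)\<^sup>2 \<le> 2 * (1 + x\<^sup>2)"
      using zero_le_power2[of "1 - x"] by (simp add: power2_eq_square algebra_simps)
    then have "((1 + x)\<^sup>2)\<^sup>2 \<le> (2 * (1 + x\<^sup>2))\<^sup>2" by (intro power_mono) auto
    also have "\<dots> \<le> 8 * (1 + (x\<^sup>2)\<^sup>2)"
      using zero_le_power2[of "1 - x\<^sup>2"] by (simp add: power2_eq_square algebra_simps)
    finally have "(1 + x) ^ 4 \<le> 8 * (1 + x ^ 4)" by simp
    moreover have "0 \<le> x ^ 4" by simp
    ultimately show ?thesis by (simp add: algebra_simps)
  qed
  from this[of "\<bar>real_of_int k\<bar>"] show ?thesis by (simp add: power_abs)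
qed

text \<open>The derivative in the nonlinearity costs one power of \<open>k\<close> and integration
  in time against the damping gains four, so each Duhamel integral gains three.\<close>

lemma kernel_decay: "\<bar>real_of_int k\<bar> / (1 + real_of_int k ^ 4 / 2) \<le> 16 / br k ^ 3"
proof -
  have pos: "0 < 1 + real_of_int k ^ 4 / 2" by (simp add: add_pos_nonneg)
  have "\<bar>real_of_int k\<bar> * br k ^ 3 \<le> br k * br k ^ 3" by (intro mult_right_mono) auto
  also have "\<dots> = br k ^ 4" by (simp add: power_Suc[symmetric] del: power_Suc)
  finally have "\<bar>real_of_int k\<bar> * br k ^ 3 \<le> 16 * (1 + real_of_int k ^ 4 / 2)" using br_pow4_le[of k] by linarith
  moreover have "0 < br k ^ 3" by (intro zero_less_power) simp
  ultimately show ?thesis using pos by (simp only: pos_divide_le_eq times_divide_eq_left pos_le_divide_eq)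
qed

text \<open>By \<open>2 * m * k^2 \<le> m^2 + k^4\<close>, part of the gain is traded for the small
  factor \<open>2 / m\<close>; what remains, \<open>1 / br k\<close>, is still square summable. This
  is why the exponential weight below has the rate \<open>\<omega> + m^2\<close>.\<close>

lemma kernel_contract:
  assumes "0 < m"
  shows "\<bar>real_of_int k\<bar> / (m\<^sup>2 + real_of_int k ^ 4 / 2) \<le> 2 / m / br k"
proof (cases "k = 0")
  case False
  define x where "x = \<bar>real_of_int k\<bar>"
  have x1: "1 \<le> x" using False by (simp add: x_def)
  have x4: "real_of_int k ^ 4 = x ^ 4" by (simp add: x_def power_abs)
  have "m * (x * (1 + x)) \<le> m * (2 * x\<^sup>2)"
    using assms x1 by (intro mult_left_mono) (auto simp: power2_eq_square algebra_simps)
  also have "\<dots> \<le> 2 * m\<^sup>2 + x ^ 4"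
  proof -
    have "(x\<^sup>2)\<^sup>2 = x ^ 4" by simp
    then have "m * (2 * x\<^sup>2) \<le> m\<^sup>2 + x ^ 4"
      using zero_le_power2[of "m - x\<^sup>2"] unfolding power2_diff by (simp add: mult_ac)
    then show ?thesis using zero_le_power2[of m] by linarith
  qed
  finally have "m * (x * (1 + x)) \<le> 2 * (m\<^sup>2 + x ^ 4 / 2)" by simp
  moreover have "0 < m\<^sup>2 + x ^ 4 / 2" using assms by (simp add: add_pos_nonneg)
  ultimately show ?thesis
    using assms x1 unfolding x4 x_def[symmetric] by (simp add: divide_simps mult_ac)
qed (use assms in simp)

text \<open>An exponential bound of rate \<open>\<gamma>\<close> above \<open>Re z\<close> is
  reproduced by the Duhamel integral with the factor \<open>1 / (\<gamma> - Re z)\<close>. The free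
  choice of \<open>\<gamma>\<close> makes contraction possible on arbitrary time intervals.\<close>

lemma exp_kernel_integral_le:
  fixes h :: "real \<Rightarrow> complex"
  assumes t: "\<tau> \<le> t" and h: "continuous_on {\<tau>..t} h" and B: "\<And>s. s \<in> {\<tau>..t} \<Longrightarrow> cmod (h s) \<le> B * exp (\<gamma> * s)"
    and B0: "0 \<le> B" and \<gamma>: "Re z < \<gamma>"
  shows "cmod (exp (z * of_real t) * integral {\<tau>..t} (\<lambda>s. exp (- z * of_real s) * h s)) \<le> B * exp (\<gamma> * t) / (\<gamma> - Re z)"
proof -
  have "cmod (integral {\<tau>..t} (\<lambda>s. exp (- z * of_real s) * h s)) \<le> integral {\<tau>..t} (\<lambda>s. B * exp ((\<gamma> - Re z) * s))"
  proof (rule integral_norm_bound_integral)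
    show "(\<lambda>s. exp (- z * of_real s) * h s) integrable_on {\<tau>..t}"
      by (intro integrable_continuous_interval continuous_intros h)
    show "(\<lambda>s. B * exp ((\<gamma> - Re z) * s)) integrable_on {\<tau>..t}"
      by (intro integrable_continuous_interval continuous_intros)
    fix s assume s: "s \<in> {\<tau>..t}"
    have "cmod (exp (- z * of_real s) * h s) = exp (- Re z * s) * cmod (h s)"
      by (simp add: norm_mult norm_exp_eq_Re)
    also have "\<dots> \<le> exp (- Re z * s) * (B * exp (\<gamma> * s))"
      using B[OF s] by (intro mult_left_mono) auto
    also have "\<dots> = B * exp ((\<gamma> - Re z) * s)"
      by (simp add: left_diff_distrib exp_diff exp_minus field_simps)
    finally show "cmod (exp (- z * of_real s) * h s) \<le> B * exp ((\<gamma> - Re z) * s)" .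
  qed
  also have "((\<lambda>s. B * exp ((\<gamma> - Re z) * s)) has_integral
      (B * exp ((\<gamma> - Re z) * t) / (\<gamma> - Re z) - B * exp ((\<gamma> - Re z) * \<tau>) / (\<gamma> - Re z))) {\<tau>..t}"
  proof (rule fundamental_theorem_of_calculus[OF t])
    fix s
    have "((\<lambda>s. B * exp ((\<gamma> - Re z) * s) / (\<gamma> - Re z)) has_real_derivative B * exp ((\<gamma> - Re z) * s)) (at s within {\<tau>..t})"
      using \<gamma> by (auto intro!: derivative_eq_intros)
    then show "((\<lambda>s. B * exp ((\<gamma> - Re z) * s) / (\<gamma> - Re z)) has_vector_derivative B * exp ((\<gamma> - Re z) * s)) (at s within {\<tau>..t})"
      by (simp add: has_real_derivative_iff_has_vector_derivative)
  qed
  then have "integral {\<tau>..t} (\<lambda>s. B * exp ((\<gamma> - Re z) * s)) \<le> B * exp ((\<gamma> - Re z) * t) / (\<gamma> - Re z)"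
    using B0 \<gamma> by (simp only: integral_unique) simp
  finally have "cmod (integral {\<tau>..t} (\<lambda>s. exp (- z * of_real s) * h s)) \<le> B * exp ((\<gamma> - Re z) * t) / (\<gamma> - Re z)" .
  then have "exp (Re z * t) * cmod (integral {\<tau>..t} (\<lambda>s. exp (- z * of_real s) * h s)) \<le> exp (Re z * t) * (B * exp ((\<gamma> - Re z) * t) / (\<gamma> - Re z))"
    by (intro mult_left_mono) auto
  also have "\<dots> = B * exp (\<gamma> * t) / (\<gamma> - Re z)"
    by (simp add: left_diff_distrib exp_diff)
  finally show ?thesis by (simp add: norm_mult norm_exp_eq_Re)
qed

section \<open>Duhamel's formula with truncated convolution\<close>

locale ks_data =
  fixes a L :: real and f0 :: "int \<Rightarrow> complex"
  assumes f0_l2: "l2 f0" and f0_zero: "f0 0 = 0" and f0_sym: "\<And>k. f0 (- k) = cnj (f0 k)"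
begin

definition \<mu> :: "int \<Rightarrow> complex" where
  "\<mu> k = Complex (- (real_of_int k ^ 4) + a * (real_of_int k)\<^sup>2) (- L * real_of_int k ^ 3)"

text \<open>Price of absorbing the unstable term by \<open>a * k^2 \<le> a^2 / 2 + k^4 / 2\<close>,
  which leaves half of the fourth-order damping.\<close>

definition \<omega> :: real where "\<omega> = a\<^sup>2 / 2"

lemma \<omega>0: "0 \<le> \<omega>" by (simp add: \<omega>_def)

lemma Re_\<mu>: "Re (\<mu> k) \<le> \<omega> - real_of_int k ^ 4 / 2"
  using zero_le_power2[of "(real_of_int k)\<^sup>2 - a"]
  by (simp add: \<mu>_def \<omega>_def power2_eq_square power4_eq_xxxx algebra_simps)

text \<open>The energy balance lets the squared norm grow at most at rate \<open>a^2 / 2\<close>,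
  hence the norm at rate \<open>a^2 / 4\<close>. The threshold follows this a priori bound and so
  will not be exceeded; the summand 1 keeps it positive for zero data.\<close>

definition \<rho> :: "real \<Rightarrow> real" where "\<rho> t = exp (a\<^sup>2 / 4 * t) * (n2 f0 + 1)"

lemma \<rho>_pos: "0 < \<rho> t"
  using n2_nonneg[of f0] by (simp add: \<rho>_def add_nonneg_pos)

lemma \<rho>_mono: "s \<le> t \<Longrightarrow> \<rho> s \<le> \<rho> t"
  unfolding \<rho>_def by (intro mult_right_mono) (auto simp: mult_left_mono)

definition cut :: "(real \<Rightarrow> int \<Rightarrow> complex) \<Rightarrow> real \<Rightarrow> int \<Rightarrow> complex" where
  "cut v t = conv (radial (\<rho> t) (v t)) (radial (\<rho> t) (v t))"

definition nl :: "(real \<Rightarrow> int \<Rightarrow> complex) \<Rightarrow> int \<Rightarrow> real \<Rightarrow> complex" where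
  "nl v k t = \<i> * of_int k / 2 * cut v t k"

definition duhamel :: "(real \<Rightarrow> int \<Rightarrow> complex) \<Rightarrow> real \<Rightarrow> int \<Rightarrow> complex" where
  "duhamel v t k = exp (\<mu> k * of_real t) * (f0 k + integral {0..t} (\<lambda>s. exp (- \<mu> k * of_real s) * nl v k s))"

text \<open>A class preserved by \<open>duhamel\<close> in which norm and convolution depend
  continuously on time; the integrals in Duhamel's formula are then integrals of continuous
  functions.\<close>

definition adm :: "(real \<Rightarrow> int \<Rightarrow> complex) \<Rightarrow> bool" where
  "adm v \<longleftrightarrow> (\<forall>T k. continuous_on {0..T} (\<lambda>t. v t k)) \<and>
     (\<forall>T. \<exists>g. l2 (\<lambda>k. complex_of_real (g k)) \<and> (\<forall>t\<in>{0..T}. \<forall>k. cmod (v t k) \<le> g k))"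

lemma adm_l2: "adm v \<Longrightarrow> 0 \<le> t \<Longrightarrow> l2 (v t)"
  unfolding adm_def by (metis l2_dominated atLeastAtMost_iff order_refl)

lemma cut_le:
  assumes "adm v" "0 \<le> t"
  shows "cmod (cut v t k) \<le> (\<rho> t)\<^sup>2"
proof -
  note l = adm_l2[OF assms]
  have "cmod (cut v t k) \<le> n2 (radial (\<rho> t) (v t)) * n2 (radial (\<rho> t) (v t))"
    unfolding cut_def by (intro conv_le radial_l2 l)
  also have "\<dots> \<le> \<rho> t * \<rho> t"
    using n2_radial_le[OF l \<rho>_pos] less_imp_le[OF \<rho>_pos] by (intro mult_mono) auto
  finally show ?thesis by (simp add: power2_eq_square)
qed

lemma cut_diff_le:
  assumes "adm v" "adm w" "0 \<le> t"
  shows "cmod (cut v t k - cut w t k) \<le> 4 * \<rho> t * n2 (\<lambda>k. v t k - w t k)"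
proof -
  note l = adm_l2[OF assms(1,3)] adm_l2[OF assms(2,3)]
  have "cmod (cut v t k - cut w t k) \<le> (n2 (radial (\<rho> t) (v t)) + n2 (radial (\<rho> t) (w t)))
      * n2 (\<lambda>k. radial (\<rho> t) (v t) k - radial (\<rho> t) (w t) k)"
    unfolding cut_def by (intro conv_diff_le radial_l2 l)
  also have "\<dots> \<le> (\<rho> t + \<rho> t) * (2 * n2 (\<lambda>k. v t k - w t k))"
    using less_imp_le[OF \<rho>_pos] by (intro mult_mono add_mono n2_radial_le l \<rho>_pos radial_lipschitz) auto
  finally show ?thesis by simp
qed

lemma continuous_on_\<rho>: "continuous_on A \<rho>"
  unfolding \<rho>_def by (intro continuous_intros)

lemma radial_cmod_le: "cmod (radial r (v t) k) \<le> cmod (v t k)" if "0 < r"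
proof -
  have "\<bar>r / max r (n2 (v t))\<bar> * cmod (v t k) \<le> 1 * cmod (v t k)"
    using that by (intro mult_right_mono) (auto simp: divide_le_eq_1)
  then show ?thesis by (simp add: radial_def norm_mult norm_divide)
qed

lemma continuous_on_cut:
  assumes "adm v"
  shows "continuous_on {0..T} (\<lambda>t. cut v t k)"
proof -
  obtain g where g: "l2 (\<lambda>k. complex_of_real (g k))" "\<And>t k. t \<in> {0..T} \<Longrightarrow> cmod (v t k) \<le> g k"
    using assms unfolding adm_def by blast
  have vc: "continuous_on {0..T} (\<lambda>t. v t k)" for k
    using assms by (simp add: adm_def)
  have nc: "continuous_on {0..T} (\<lambda>t. n2 (v t))"
    by (rule continuous_on_n2[OF vc g(2,1)])
  show ?thesis
    unfolding cut_def
  proof (rule continuous_on_conv[OF _ _ g(1)])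
    show "continuous_on {0..T} (\<lambda>t. radial (\<rho> t) (v t) k)" for k
      unfolding radial_def using \<rho>_pos
      by (intro continuous_intros continuous_on_\<rho> nc vc) (metis less_max_iff_disj less_irrefl of_real_eq_0_iff)
    show "cmod (radial (\<rho> t) (v t) k) \<le> g k" if "t \<in> {0..T}" for t k
      using radial_cmod_le[OF \<rho>_pos, of t v t k] g(2)[OF that, of k] by linarith
  qed
qed

lemma continuous_on_nl: "adm v \<Longrightarrow> continuous_on {0..T} (nl v k)"
  unfolding nl_def by (intro continuous_intros continuous_on_cut)

lemma nl_integrand_continuous:
  "adm v \<Longrightarrow> continuous_on {0..T} (\<lambda>s. exp (- \<mu> k * of_real s) * nl v k s)"
  by (intro continuous_intros continuous_on_nl)

lemma continuous_on_duhamel: "adm v \<Longrightarrow> continuous_on {0..T} (\<lambda>t. duhamel v t k)"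
  unfolding duhamel_def
  by (intro continuous_intros indefinite_integral_continuous_1 integrable_continuous_interval nl_integrand_continuous)

lemma Re_\<mu>_gap: "\<omega> + m\<^sup>2 - Re (\<mu> k) \<ge> m\<^sup>2 + real_of_int k ^ 4 / 2"
  using Re_\<mu>[of k] by simp

lemma nl_le_exp:
  assumes "adm v" "0 \<le> s" "s \<le> T" "cmod (cut v s k) \<le> B"
  shows "cmod (nl v k s) \<le> \<bar>real_of_int k\<bar> / 2 * B * exp ((\<omega> + 1) * s)"
proof -
  have "cmod (nl v k s) = \<bar>real_of_int k\<bar> / 2 * cmod (cut v s k)"
    by (simp add: nl_def norm_mult)
  also have "\<dots> \<le> \<bar>real_of_int k\<bar> / 2 * B" using assms by (intro mult_left_mono) auto
  also have "\<dots> \<le> \<bar>real_of_int k\<bar> / 2 * B * exp ((\<omega> + 1) * s)"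
  proof -
    have "1 \<le> exp ((\<omega> + 1) * s)" using \<omega>0 assms by simp
    moreover have "0 \<le> \<bar>real_of_int k\<bar> / 2 * B"
      using order_trans[OF norm_ge_zero assms(4)] by simp
    ultimately show ?thesis by (metis mult.right_neutral mult_left_mono)
  qed
  finally show ?thesis .
qed

text \<open>The rate \<open>\<omega> + 1\<close> leaves the gap \<open>1 + k^4 / 2\<close>, so
  \<open>kernel_decay\<close> applies; the factor 1/2 of the nonlinearity turns its 16 into 8. The
  lower limit is free because smoothing restarts at later times, and \<open>B\<close> may depend on
  \<open>k\<close>, which lets decay accumulate.\<close>

lemma duhamel_tail_le:
  assumes v: "adm v" and "0 \<le> \<tau>" "\<tau> \<le> t" "t \<le> T" and B: "\<And>s. s \<in> {\<tau>..T} \<Longrightarrow> cmod (cut v s k) \<le> B"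
  shows "cmod (exp (\<mu> k * of_real t) * integral {\<tau>..t} (\<lambda>s. exp (- \<mu> k * of_real s) * nl v k s))
     \<le> 8 * B * exp ((\<omega> + 1) * T) / br k ^ 3"
proof -
  have B0: "0 \<le> B" using order_trans[OF norm_ge_zero B[of \<tau>]] assms by auto
  have gap: "1 + real_of_int k ^ 4 / 2 \<le> \<omega> + 1 - Re (\<mu> k)" using Re_\<mu>_gap[of 1 k] by simp
  have pos: "0 < 1 + real_of_int k ^ 4 / 2" by (simp add: add_pos_nonneg)
  have "cmod (exp (\<mu> k * of_real t) * integral {\<tau>..t} (\<lambda>s. exp (- \<mu> k * of_real s) * nl v k s))
     \<le> (\<bar>real_of_int k\<bar> / 2 * B) * exp ((\<omega> + 1) * t) / (\<omega> + 1 - Re (\<mu> k))"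
  proof (rule exp_kernel_integral_le[OF assms(3)])
    show "continuous_on {\<tau>..t} (nl v k)"
      by (rule continuous_on_subset[OF continuous_on_nl[OF v, of t]]) (use assms in auto)
    show "cmod (nl v k s) \<le> \<bar>real_of_int k\<bar> / 2 * B * exp ((\<omega> + 1) * s)" if "s \<in> {\<tau>..t}" for s
      using that assms by (intro nl_le_exp[OF v, of s T] B) auto
    show "0 \<le> \<bar>real_of_int k\<bar> / 2 * B" using B0 by simp
    show "Re (\<mu> k) < \<omega> + 1" using gap pos by linarith
  qed
  also have "\<dots> \<le> (\<bar>real_of_int k\<bar> / 2 * B) * exp ((\<omega> + 1) * T) / (1 + real_of_int k ^ 4 / 2)"
    using gap pos B0 assms \<omega>0 by (intro frac_le mult_left_mono) (auto intro!: mult_nonneg_nonneg simp: mult_left_mono)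
  also have "\<dots> = (B / 2 * exp ((\<omega> + 1) * T)) * (\<bar>real_of_int k\<bar> / (1 + real_of_int k ^ 4 / 2))"
    by simp
  also have "\<dots> \<le> (B / 2 * exp ((\<omega> + 1) * T)) * (16 / br k ^ 3)"
    using B0 by (intro mult_left_mono kernel_decay) auto
  finally show ?thesis by simp
qed

text \<open>Independent of the sequence to which \<open>duhamel\<close> is applied, because
  truncation bounds every convolution coefficient by \<open>(\<rho> T)^2\<close>. One majorant thus
  serves all iterates and their limit.\<close>

definition majorant :: "real \<Rightarrow> int \<Rightarrow> real" where
  "majorant T k = exp (\<omega> * T) * cmod (f0 k) + 8 * (\<rho> T)\<^sup>2 * exp ((\<omega> + 1) * T) / br k"

lemma majorant_l2: "l2 (\<lambda>k. complex_of_real (majorant T k))"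
proof -
  have "l2 (\<lambda>k. of_real (exp (\<omega> * T)) * complex_of_real (cmod (f0 k)))"
    by (rule l2_scale) (use f0_l2 in \<open>simp add: l2_def\<close>)
  then have "l2 (\<lambda>k. of_real (exp (\<omega> * T)) * complex_of_real (cmod (f0 k)) + complex_of_real (8 * (\<rho> T)\<^sup>2 * exp ((\<omega> + 1) * T) / br k))"
    by (rule l2_add(1)[OF _ l2_inverse])
  then show ?thesis by (simp only: majorant_def of_real_add of_real_mult)
qed

lemma linear_le: "0 \<le> t \<Longrightarrow> t \<le> T \<Longrightarrow> cmod (exp (\<mu> k * of_real t) * z) \<le> exp (\<omega> * T) * cmod z"
proof -
  assume t: "0 \<le> t" "t \<le> T"
  have "0 \<le> real_of_int k ^ 4" by simp
  then have "Re (\<mu> k) \<le> \<omega>" using Re_\<mu>[of k] by linarith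
  then have "Re (\<mu> k) * t \<le> \<omega> * T"
    using t \<omega>0 by (meson mult_left_mono mult_right_mono order_trans)
  then have "exp (Re (\<mu> k) * t) * cmod z \<le> exp (\<omega> * T) * cmod z" by (intro mult_right_mono) auto
  then show ?thesis by (simp add: norm_mult norm_exp_eq_Re)
qed

lemma duhamel_dom:
  assumes v: "adm v" and t: "t \<in> {0..T}"
  shows "cmod (duhamel v t k) \<le> majorant T k"
proof -
  have "cmod (exp (\<mu> k * of_real t) * f0 k) \<le> exp (\<omega> * T) * cmod (f0 k)"
    using t by (intro linear_le) auto
  moreover have "cmod (exp (\<mu> k * of_real t) * integral {0..t} (\<lambda>s. exp (- \<mu> k * of_real s) * nl v k s))
     \<le> 8 * (\<rho> T)\<^sup>2 * exp ((\<omega> + 1) * T) / br k ^ 3"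
  proof (rule duhamel_tail_le[OF v])
    show "cmod (cut v s k) \<le> (\<rho> T)\<^sup>2" if "s \<in> {0..T}" for s
      using cut_le[OF v, of s k] power_mono[OF \<rho>_mono[of s T] less_imp_le[OF \<rho>_pos], of 2] that by auto
  qed (use t in auto)
  moreover have "8 * (\<rho> T)\<^sup>2 * exp ((\<omega> + 1) * T) / br k ^ 3 \<le> 8 * (\<rho> T)\<^sup>2 * exp ((\<omega> + 1) * T) / br k"
    using power_increasing[of 1 3 "br k"] by (intro divide_left_mono) auto
  ultimately show ?thesis
    unfolding duhamel_def majorant_def distrib_left by (intro norm_triangle_le) linarith
qed

lemma adm_duhamel: "adm v \<Longrightarrow> adm (duhamel v)"
  unfolding adm_def[of "duhamel v"] using continuous_on_duhamel majorant_l2 duhamel_dom by blast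

definition brn :: real where "brn = n2 (\<lambda>k. complex_of_real (1 / br k))"

text \<open>In the norm weighted by \<open>exp (- (\<omega> + m^2) * t)\<close> the Lipschitz
  constant is \<open>4 * \<rho> T / m * brn\<close>, which a large \<open>m\<close> makes small
  whatever \<open>T\<close> is.\<close>

lemma duhamel_contract:
  assumes v: "adm v" and w: "adm w" and m: "0 < m" and D: "0 \<le> D"
    and vw: "\<And>s. s \<in> {0..T} \<Longrightarrow> n2 (\<lambda>k. v s k - w s k) \<le> D * exp ((\<omega> + m\<^sup>2) * s)" and t: "t \<in> {0..T}"
  shows "n2 (\<lambda>k. duhamel v t k - duhamel w t k) \<le> 4 * \<rho> T / m * brn * D * exp ((\<omega> + m\<^sup>2) * t)"
proof -
  let ?e = "exp ((\<omega> + m\<^sup>2) * t)"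
  have "cmod (duhamel v t k - duhamel w t k) \<le> cmod (of_real (4 * \<rho> T / m * D * ?e) * complex_of_real (1 / br k))" for k
  proof -
    have "duhamel v t k - duhamel w t k
      = exp (\<mu> k * of_real t) * integral {0..t} (\<lambda>s. exp (- \<mu> k * of_real s) * (nl v k s - nl w k s))"
    proof -
      have "integral {0..t} (\<lambda>s. exp (- \<mu> k * of_real s) * nl v k s - exp (- \<mu> k * of_real s) * nl w k s)
        = integral {0..t} (\<lambda>s. exp (- \<mu> k * of_real s) * nl v k s) - integral {0..t} (\<lambda>s. exp (- \<mu> k * of_real s) * nl w k s)"
        by (intro Henstock_Kurzweil_Integration.integral_diff integrable_continuous_interval nl_integrand_continuous v w)
      then show ?thesis
        by (simp only: duhamel_def right_diff_distrib distrib_left) simp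
    qed
    also have "cmod \<dots> \<le> (\<bar>real_of_int k\<bar> * 2 * \<rho> T * D) * ?e / (\<omega> + m\<^sup>2 - Re (\<mu> k))"
    proof (rule exp_kernel_integral_le)
      show "0 \<le> t" using t by simp
      show "continuous_on {0..t} (\<lambda>s. nl v k s - nl w k s)"
        by (intro continuous_intros continuous_on_nl v w)
      show "cmod (nl v k s - nl w k s) \<le> \<bar>real_of_int k\<bar> * 2 * \<rho> T * D * exp ((\<omega> + m\<^sup>2) * s)" if s: "s \<in> {0..t}" for s
      proof -
        have "nl v k s - nl w k s = \<i> * of_int k / 2 * (cut v s k - cut w s k)"
          by (simp add: nl_def right_diff_distrib)
        then have "cmod (nl v k s - nl w k s) = \<bar>real_of_int k\<bar> / 2 * cmod (cut v s k - cut w s k)"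
          by (simp only: norm_mult norm_divide) simp
        also have "\<dots> \<le> \<bar>real_of_int k\<bar> / 2 * (4 * \<rho> T * (D * exp ((\<omega> + m\<^sup>2) * s)))"
        proof (rule mult_left_mono)
          have "cmod (cut v s k - cut w s k) \<le> 4 * \<rho> s * n2 (\<lambda>k. v s k - w s k)"
            using s by (intro cut_diff_le v w) auto
          also have "\<dots> \<le> 4 * \<rho> T * (D * exp ((\<omega> + m\<^sup>2) * s))"
            using s t less_imp_le[OF \<rho>_pos] by (intro mult_mono vw) (auto intro: \<rho>_mono)
          finally show "cmod (cut v s k - cut w s k) \<le> 4 * \<rho> T * (D * exp ((\<omega> + m\<^sup>2) * s))" .
        qed simp
        finally show ?thesis by (simp add: mult_ac)
      qed
      show "0 \<le> \<bar>real_of_int k\<bar> * 2 * \<rho> T * D" using D less_imp_le[OF \<rho>_pos] by simp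
      have "0 < m\<^sup>2 + real_of_int k ^ 4 / 2" using m by (simp add: add_pos_nonneg)
      then show "Re (\<mu> k) < \<omega> + m\<^sup>2" using Re_\<mu>_gap[of m k] by linarith
    qed
    also have "\<dots> \<le> (\<bar>real_of_int k\<bar> * 2 * \<rho> T * D) * ?e / (m\<^sup>2 + real_of_int k ^ 4 / 2)"
      using D less_imp_le[OF \<rho>_pos] m by (intro frac_le order_refl Re_\<mu>_gap) (auto simp: add_pos_nonneg)
    also have "\<dots> = (2 * \<rho> T * D * ?e) * (\<bar>real_of_int k\<bar> / (m\<^sup>2 + real_of_int k ^ 4 / 2))"
      by simp
    also have "\<dots> \<le> (2 * \<rho> T * D * ?e) * (2 / m / br k)"
      using D less_imp_le[OF \<rho>_pos] m by (intro mult_left_mono kernel_contract) auto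
    also have "\<dots> = \<bar>4 * \<rho> T / m * D * ?e\<bar> * \<bar>1 / br k\<bar>"
      using D less_imp_le[OF \<rho>_pos] m by (simp add: abs_mult)
    finally show ?thesis unfolding norm_mult norm_of_real .
  qed
  then have "n2 (\<lambda>k. duhamel v t k - duhamel w t k) \<le> n2 (\<lambda>k. of_real (4 * \<rho> T / m * D * ?e) * complex_of_real (1 / br k))"
    by (intro l2_mono(2) l2_scale(1) l2_inverse)
  also have "\<dots> = cmod (of_real (4 * \<rho> T / m * D * ?e)) * brn"
    unfolding brn_def by (rule l2_scale(2)[OF l2_inverse])
  also have "\<dots> = 4 * \<rho> T / m * brn * D * ?e"
    using D less_imp_le[OF \<rho>_pos] m unfolding norm_of_real by simp
  finally show ?thesis .
qed

section \<open>Picard iteration\<close>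

fun picard :: "nat \<Rightarrow> real \<Rightarrow> int \<Rightarrow> complex" where
  "picard 0 = (\<lambda>t k. 0)"
| "picard (Suc n) = duhamel (picard n)"

lemma adm_picard: "adm (picard n)"
proof (induction n)
  case 0
  have "l2 (\<lambda>k. complex_of_real 0)" by (simp add: l2_def)
  then show ?case unfolding adm_def by (auto intro!: exI[of _ "\<lambda>_. 0"])
qed (simp add: adm_duhamel)

lemma majorant_nonneg: "0 \<le> majorant T k"
  by (simp add: majorant_def)

lemma picard_dom: "t \<in> {0..T} \<Longrightarrow> cmod (picard n t k) \<le> majorant T k"
  by (cases n) (simp_all add: majorant_nonneg duhamel_dom adm_picard)

text \<open>A value of \<open>m\<close> for which the contraction factor
  \<open>4 * \<rho> T / m * brn\<close> is at most 1/2; the summand 1 keeps it positive.\<close>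

definition rate :: "real \<Rightarrow> real" where "rate T = 1 + 8 * \<rho> T * brn"

lemma rate_pos: "0 < rate T"
  using \<rho>_pos[of T] by (simp add: rate_def brn_def add_pos_nonneg)

lemma duhamel_half:
  assumes "adm v" "adm w" "0 \<le> D"
    and "\<And>s. s \<in> {0..T} \<Longrightarrow> n2 (\<lambda>k. v s k - w s k) \<le> D * exp ((\<omega> + (rate T)\<^sup>2) * s)" and "t \<in> {0..T}"
  shows "n2 (\<lambda>k. duhamel v t k - duhamel w t k) \<le> D / 2 * exp ((\<omega> + (rate T)\<^sup>2) * t)"
proof -
  have "4 * \<rho> T / rate T * brn * D * exp ((\<omega> + (rate T)\<^sup>2) * t) \<le> 1 / 2 * D * exp ((\<omega> + (rate T)\<^sup>2) * t)"
    using assms(3) rate_pos[of T] by (intro mult_right_mono) (auto simp: field_simps rate_def)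
  then show ?thesis
    using duhamel_contract[OF assms(1,2) rate_pos assms(3-5)] by simp
qed

definition C0 :: "real \<Rightarrow> real" where
  "C0 T = n2 (\<lambda>k. complex_of_real (majorant T k)) * exp ((\<omega> + (rate T)\<^sup>2) * T)"

lemma picard_step:
  assumes "t \<in> {0..T}"
  shows "n2 (\<lambda>k. picard (Suc n) t k - picard n t k) \<le> n2 (\<lambda>k. complex_of_real (majorant T k)) / 2 ^ n * exp ((\<omega> + (rate T)\<^sup>2) * t)"
  using assms
proof (induction n arbitrary: t)
  case 0
  have "n2 (picard 1 t) \<le> n2 (\<lambda>k. complex_of_real (majorant T k))"
    using picard_dom[OF 0, of 1] majorant_nonneg by (intro l2_mono(2) majorant_l2) simp
  also have "\<dots> \<le> n2 (\<lambda>k. complex_of_real (majorant T k)) * exp ((\<omega> + (rate T)\<^sup>2) * t)"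
  proof -
    have "1 \<le> exp ((\<omega> + (rate T)\<^sup>2) * t)" using 0 \<omega>0 by simp
    then show ?thesis using mult_left_mono[of 1 _ "n2 (\<lambda>k. complex_of_real (majorant T k))"] by simp
  qed
  finally show ?case by simp
next
  case (Suc n)
  have "n2 (\<lambda>k. duhamel (picard (Suc n)) t k - duhamel (picard n) t k)
     \<le> n2 (\<lambda>k. complex_of_real (majorant T k)) / 2 ^ n / 2 * exp ((\<omega> + (rate T)\<^sup>2) * t)"
    by (intro duhamel_half adm_picard Suc) (use Suc.prems in auto)
  then show ?case by (simp add: mult.commute)
qed

lemma picard_step':
  assumes "t \<in> {0..T}"
  shows "n2 (\<lambda>k. picard (Suc n) t k - picard n t k) \<le> C0 T / 2 ^ n"
proof -
  have "exp ((\<omega> + (rate T)\<^sup>2) * t) \<le> exp ((\<omega> + (rate T)\<^sup>2) * T)"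
    using assms \<omega>0 by (auto intro!: mult_left_mono add_nonneg_nonneg)
  then have "n2 (\<lambda>k. complex_of_real (majorant T k)) / 2 ^ n * exp ((\<omega> + (rate T)\<^sup>2) * t) \<le> n2 (\<lambda>k. complex_of_real (majorant T k)) / 2 ^ n * exp ((\<omega> + (rate T)\<^sup>2) * T)"
    by (intro mult_left_mono) auto
  then show ?thesis using picard_step[OF assms, of n] by (simp add: C0_def)
qed

text \<open>The factor \<open>1 - 1 / 2 ^ j\<close> is the exact partial sum of the geometric
  series, kept so that the induction closes.\<close>

lemma picard_cauchy:
  assumes t: "t \<in> {0..T}"
  shows "n2 (\<lambda>k. picard (n + j) t k - picard n t k) \<le> 2 * C0 T / 2 ^ n * (1 - 1 / 2 ^ j)"
proof (induction j)
  case 0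
  show ?case by (simp add: n2_def)
next
  case (Suc j)
  have l: "l2 (picard i t)" for i using t by (intro adm_l2[OF adm_picard]) simp
  have "n2 (\<lambda>k. picard (n + Suc j) t k - picard n t k)
     \<le> n2 (\<lambda>k. picard (Suc (n + j)) t k - picard (n + j) t k) + n2 (\<lambda>k. picard (n + j) t k - picard n t k)"
    using l2_add(2)[OF l2_diff(1)[OF l[of "Suc (n + j)"] l[of "n + j"]] l2_diff(1)[OF l[of "n + j"] l[of n]]] by simp
  also have "\<dots> \<le> C0 T / 2 ^ (n + j) + 2 * C0 T / 2 ^ n * (1 - 1 / 2 ^ j)"
    by (intro add_mono picard_step' Suc t)
  also have "\<dots> = 2 * C0 T / 2 ^ n * (1 - 1 / 2 ^ Suc j)"
    by (simp add: power_add field_simps)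
  finally show ?case .
qed

lemma picard_cauchy':
  assumes t: "t \<in> {0..T}" and "n \<le> i"
  shows "n2 (\<lambda>k. picard i t k - picard n t k) \<le> 2 * C0 T / 2 ^ n"
proof -
  have "2 * C0 T / 2 ^ n * (1 - 1 / 2 ^ (i - n)) \<le> 2 * C0 T / 2 ^ n * 1"
    by (intro mult_left_mono) (auto simp: C0_def)
  then show ?thesis using picard_cauchy[OF t, of n "i - n"] assms(2) by simp
qed

definition sol :: "real \<Rightarrow> int \<Rightarrow> complex" where "sol t k = lim (\<lambda>n. picard n t k)"

lemma two_pow_lim: "(\<lambda>n. 2 * C / 2 ^ n) \<longlonglongrightarrow> (0::real)"
  using LIMSEQ_power_zero[of "1 / 2 :: real", THEN tendsto_mult_left, of "2 * C"] by (simp add: power_divide)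

lemma picard_tendsto:
  assumes "0 \<le> t"
  shows "(\<lambda>n. picard n t k) \<longlonglongrightarrow> sol t k"
proof -
  have t: "t \<in> {0..t}" using assms by simp
  have l: "l2 (picard i t)" for i using t by (intro adm_l2[OF adm_picard]) simp
  have "Cauchy (\<lambda>n. picard n t k)"
  proof (rule metric_CauchyI)
    fix e :: real assume "0 < e"
    then obtain N where N: "2 * C0 t / 2 ^ N < e / 2"
      using order_tendstoD(2)[OF two_pow_lim[of "C0 t"], of "e / 2"] by (auto simp: eventually_sequentially)
    have "cmod (picard i t k - picard N t k) < e / 2" if "N \<le> i" for i
      using cmod_le_n2[OF l2_diff(1)[OF l[of i] l[of N]], of k] picard_cauchy'[OF t that] N by linarith
    then have "dist (picard i t k) (picard j t k) < e" if "N \<le> i" "N \<le> j" for i j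
      using that by (metis dist_norm dist_triangle_half_l)
    then show "\<exists>M. \<forall>i\<ge>M. \<forall>j\<ge>M. dist (picard i t k) (picard j t k) < e" by blast
  qed
  then show ?thesis unfolding sol_def by (simp add: Cauchy_convergent_iff convergent_LIMSEQ_iff)
qed

lemma picard_sol:
  assumes t: "t \<in> {0..T}"
  shows "l2 (\<lambda>k. picard n t k - sol t k)" "n2 (\<lambda>k. picard n t k - sol t k) \<le> 2 * C0 T / 2 ^ n"
proof -
  have l: "l2 (picard i t)" for i using t by (intro adm_l2[OF adm_picard]) simp
  have "L2_set (\<lambda>k. cmod (picard n t k - sol t k)) S \<le> 2 * C0 T / 2 ^ n" if S: "finite S" for S
  proof (rule tendsto_upperbound)
    show "(\<lambda>i. L2_set (\<lambda>k. cmod (picard n t k - picard i t k)) S) \<longlonglongrightarrow> L2_set (\<lambda>k. cmod (picard n t k - sol t k)) S"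
      unfolding L2_set_def using t by (intro tendsto_intros picard_tendsto) auto
    show "\<forall>\<^sub>F i in sequentially. L2_set (\<lambda>k. cmod (picard n t k - picard i t k)) S \<le> 2 * C0 T / 2 ^ n"
      using eventually_ge_at_top[of n]
    proof eventually_elim
      case (elim i)
      then show ?case
        using L2_set_le_n2[OF l2_diff(1)[OF l[of n] l[of i]] S] picard_cauchy'[OF t elim] n2_diff_commute[of "picard n t" "picard i t"]
        by linarith
    qed
  qed simp
  then show "l2 (\<lambda>k. picard n t k - sol t k)" "n2 (\<lambda>k. picard n t k - sol t k) \<le> 2 * C0 T / 2 ^ n"
    by (blast intro: l2I)+
qed

lemma sol_dom: "t \<in> {0..T} \<Longrightarrow> cmod (sol t k) \<le> majorant T k"
  by (rule tendsto_upperbound[OF tendsto_norm[OF picard_tendsto]]) (auto simp: picard_dom)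

lemma adm_sol: "adm sol"
proof -
  have "continuous_on {0..T} (\<lambda>t. sol t k)" for T k
  proof (rule uniform_limit_theorem)
    show "uniform_limit {0..T} (\<lambda>n t. picard n t k) (\<lambda>t. sol t k) sequentially"
    proof (rule uniform_limitI)
      fix e :: real assume "0 < e"
      then have "\<forall>\<^sub>F n in sequentially. 2 * C0 T / 2 ^ n < e"
        by (rule order_tendstoD(2)[OF two_pow_lim])
      then show "\<forall>\<^sub>F n in sequentially. \<forall>t\<in>{0..T}. dist (picard n t k) (sol t k) < e"
      proof eventually_elim
        case (elim n)
        show ?case
        proof
          fix t assume t: "t \<in> {0..T}"
          show "dist (picard n t k) (sol t k) < e"
            using cmod_le_n2[OF picard_sol(1)[OF t, of n], of k] picard_sol(2)[OF t, of n] elim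
            by (simp add: dist_norm)
        qed
      qed
    qed
    show "\<forall>\<^sub>F n in sequentially. continuous_on {0..T} (\<lambda>t. picard n t k)"
      using adm_picard by (simp add: adm_def)
  qed simp
  then show ?thesis unfolding adm_def using majorant_l2 sol_dom by blast
qed

text \<open>Both sides are limits of \<open>picard (Suc n)\<close>: as a shifted sequence it tends
  to \<open>sol\<close>, and the contraction estimate carries the convergence of
  \<open>picard n\<close> over to its image under \<open>duhamel\<close>.\<close>

lemma sol_fixpoint:
  assumes "0 \<le> t"
  shows "duhamel sol t k = sol t k"
proof (rule LIMSEQ_unique)
  show "(\<lambda>n. picard (Suc n) t k) \<longlonglongrightarrow> sol t k"
    by (rule LIMSEQ_Suc[OF picard_tendsto[OF assms]])
  have t: "t \<in> {0..t}" using assms by simp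
  let ?E = "exp ((\<omega> + (rate t)\<^sup>2) * t)"
  have le: "cmod (picard (Suc n) t k - duhamel sol t k) \<le> 2 * (C0 t / 2 * ?E) / 2 ^ n" for n
  proof -
    have "n2 (\<lambda>k. duhamel (picard n) t k - duhamel sol t k) \<le> (2 * C0 t / 2 ^ n) / 2 * ?E"
    proof (rule duhamel_half[OF adm_picard adm_sol _ _ t])
      show "n2 (\<lambda>k. picard n s k - sol s k) \<le> 2 * C0 t / 2 ^ n * exp ((\<omega> + (rate t)\<^sup>2) * s)" if s: "s \<in> {0..t}" for s
      proof -
        have "1 \<le> exp ((\<omega> + (rate t)\<^sup>2) * s)" using s \<omega>0 by simp
        moreover have "0 \<le> 2 * C0 t / 2 ^ n" by (simp add: C0_def)
        ultimately have "2 * C0 t / 2 ^ n * 1 \<le> 2 * C0 t / 2 ^ n * exp ((\<omega> + (rate t)\<^sup>2) * s)" by (rule mult_left_mono)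
        then show ?thesis using picard_sol(2)[OF s, of n] by linarith
      qed
    qed (simp add: C0_def)
    moreover have "cmod (duhamel (picard n) t k - duhamel sol t k) \<le> n2 (\<lambda>k. duhamel (picard n) t k - duhamel sol t k)"
      using assms by (intro cmod_le_n2 l2_diff adm_l2[OF adm_duhamel] adm_picard adm_sol)
    ultimately show ?thesis by simp
  qed
  have "(\<lambda>n. picard (Suc n) t k - duhamel sol t k) \<longlonglongrightarrow> 0"
    by (rule Lim_null_comparison[OF _ two_pow_lim[of "C0 t / 2 * ?E"]]) (use le in simp)
  then show "(\<lambda>n. picard (Suc n) t k) \<longlonglongrightarrow> duhamel sol t k"
    by (simp add: LIM_zero_iff)
qed

section \<open>Restarting, time derivative and symmetry of the solution\<close>

lemma sol_restart:
  assumes "0 \<le> \<tau>" "\<tau> \<le> t"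
  shows "sol t k = exp (\<mu> k * of_real (t - \<tau>)) * sol \<tau> k
     + exp (\<mu> k * of_real t) * integral {\<tau>..t} (\<lambda>s. exp (- \<mu> k * of_real s) * nl sol k s)"
proof -
  let ?g = "\<lambda>s. exp (- \<mu> k * of_real s) * nl sol k s"
  have "integral {0..t} ?g = integral {0..\<tau>} ?g + integral {\<tau>..t} ?g"
    using assms by (intro Henstock_Kurzweil_Integration.integral_combine[symmetric] integrable_continuous_interval nl_integrand_continuous adm_sol) auto
  moreover have "exp (\<mu> k * of_real t) = exp (\<mu> k * of_real (t - \<tau>)) * exp (\<mu> k * of_real \<tau>)"
    by (simp add: exp_add[symmetric] algebra_simps)
  ultimately show ?thesis
    using assms sol_fixpoint[of t k, symmetric] sol_fixpoint[of \<tau> k, symmetric]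
    by (simp add: duhamel_def algebra_simps)
qed

lemma sol_initial: "sol 0 k = f0 k"
  using sol_fixpoint[of 0 k] by (simp add: duhamel_def)

lemma sol_has_derivative:
  assumes t: "0 < t"
  shows "((\<lambda>s. sol s k) has_vector_derivative \<mu> k * sol t k + nl sol k t) (at t)"
proof -
  let ?g = "\<lambda>s. exp (- \<mu> k * of_real s) * nl sol k s"
  have t': "t \<in> {0..t+1}" using t by simp
  have I: "((\<lambda>s. integral {0..s} ?g) has_vector_derivative ?g t) (at t within {0..t+1})"
    by (rule integral_has_vector_derivative[OF nl_integrand_continuous[OF adm_sol] t'])
  have E: "((\<lambda>s. exp (\<mu> k * of_real s)) has_vector_derivative \<mu> k * exp (\<mu> k * of_real t)) (at t within {0..t+1})"
    by (rule has_vector_derivative_real_field) (auto intro!: derivative_eq_intros)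
  have "((\<lambda>s. exp (\<mu> k * of_real s) * (f0 k + integral {0..s} ?g)) has_vector_derivative
      exp (\<mu> k * of_real t) * (0 + ?g t) + \<mu> k * exp (\<mu> k * of_real t) * (f0 k + integral {0..t} ?g)) (at t within {0..t+1})"
    by (intro has_vector_derivative_mult has_vector_derivative_add has_vector_derivative_const E I)
  moreover have "exp (\<mu> k * of_real t) * (0 + ?g t) + \<mu> k * exp (\<mu> k * of_real t) * (f0 k + integral {0..t} ?g) = \<mu> k * sol t k + nl sol k t"
    using t sol_fixpoint[of t k] by (simp add: duhamel_def exp_minus field_simps)
  ultimately have "((\<lambda>s. duhamel sol s k) has_vector_derivative \<mu> k * sol t k + nl sol k t) (at t within {0..t+1})"
    by (simp add: duhamel_def)
  then have d: "((\<lambda>s. duhamel sol s k) has_vector_derivative \<mu> k * sol t k + nl sol k t) (at t)"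
    using t at_within_interior[of t "{0..t+1}"] by simp
  have "\<forall>\<^sub>F s in nhds t. duhamel sol s k = sol s k"
    using t eventually_nhds_in_open[of "{0<..}" t] by (auto elim!: eventually_mono intro: sol_fixpoint)
  then show ?thesis
    using d by (subst (asm) has_vector_derivative_cong_ev) (auto elim: eventually_mono intro: sol_fixpoint less_imp_le t)
qed

lemma conv_sym:
  assumes "\<And>k. v (- k) = cnj (v k)"
  shows "conv v v (- k) = cnj (conv v v k)"
proof -
  have "conv v v (- k) = (\<Sum>\<^sub>\<infinity>m. v (- m) * v (- k - - m))"
    unfolding conv_def by (rule infsum_reindex_bij_witness[of _ uminus uminus]) auto
  also have "\<dots> = (\<Sum>\<^sub>\<infinity>m. cnj (v m * v (k - m)))"
    by (intro infsum_cong) (simp add: assms[symmetric])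
  finally show ?thesis by (simp only: conv_def infsum_cnj)
qed

text \<open>Conjugate symmetry passes from \<open>f0\<close> through each application of
  \<open>duhamel\<close> and then to the limit; it makes the Fourier series of \<open>sol\<close>
  real.\<close>

lemma sol_sym: "0 \<le> t \<Longrightarrow> sol t (- k) = cnj (sol t k)"
proof -
  assume t: "0 \<le> t"
  have "\<forall>t\<ge>0. \<forall>k. picard n t (- k) = cnj (picard n t k)" for n
  proof (induction n)
    case (Suc n)
    show ?case
    proof (intro allI impI)
      fix t :: real and k assume t: "0 \<le> t"
      have "cut (picard n) s (- k) = cnj (cut (picard n) s k)" if "0 \<le> s" for s
        unfolding cut_def using that Suc by (intro conv_sym) (simp add: radial_def)
      then have nl: "nl (picard n) (- k) s = cnj (nl (picard n) k s)" if "0 \<le> s" for s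
        using that by (simp add: nl_def)
      have \<mu>: "\<mu> (- k) = cnj (\<mu> k)" by (simp add: \<mu>_def complex_eq_iff)
      have "integral {0..t} (\<lambda>s. exp (- \<mu> (- k) * of_real s) * nl (picard n) (- k) s)
        = integral {0..t} (\<lambda>s. cnj (exp (- \<mu> k * of_real s) * nl (picard n) k s))"
        by (intro integral_cong) (simp add: nl \<mu> exp_cnj)
      also have "\<dots> = cnj (integral {0..t} (\<lambda>s. exp (- \<mu> k * of_real s) * nl (picard n) k s))"
        by (simp add: integral_cnj)
      finally show "picard (Suc n) t (- k) = cnj (picard (Suc n) t k)"
        by (simp add: duhamel_def \<mu> exp_cnj f0_sym)
    qed
  qed simp
  then have "(\<lambda>n. cnj (picard n t k)) \<longlonglongrightarrow> sol t (- k)"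
    using picard_tendsto[OF t, of "- k"] t by simp
  moreover have "(\<lambda>n. cnj (picard n t k)) \<longlonglongrightarrow> cnj (sol t k)"
    by (intro tendsto_intros picard_tendsto t)
  ultimately show ?thesis by (rule LIMSEQ_unique)
qed

lemma sol_zero: "0 \<le> t \<Longrightarrow> sol t 0 = 0"
  using sol_fixpoint[of t 0] by (simp add: duhamel_def nl_def f0_zero)

end


section \<open>Existence\<close>

subsection \<open>Real trigonometric series with time-dependent coefficients\<close>

text \<open>Index \<open>n\<close> stands for frequency \<open>n + 1\<close>, and
  \<open>2 * Re\<close> accounts for the opposite frequency; mode 0 is left out because solutions
  have zero mean.\<close>

definition ser :: "(nat \<Rightarrow> real \<Rightarrow> complex) \<Rightarrow> real \<Rightarrow> real \<Rightarrow> real" where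
  "ser c t x = (\<Sum>n. 2 * Re (c n t * cis (real (Suc n) * x)))"

text \<open>The bound is uniform on \<open>[\<tau>, T]\<close> for positive \<open>\<tau>\<close>
  only: the datum is merely square summable and decay appears through smoothing. Inverse squares are
  enough for the Weierstrass test.\<close>

definition sdom :: "(nat \<Rightarrow> real \<Rightarrow> complex) \<Rightarrow> bool" where
  "sdom c \<longleftrightarrow> (\<forall>\<tau>>0. \<forall>T. \<exists>M. \<forall>n. \<forall>t\<in>{\<tau>..T}. cmod (c n t) \<le> M / (real (Suc n))\<^sup>2)"

lemma Re_cis_bound:
  assumes "cmod z \<le> B"
  shows "\<bar>2 * Re (z * cis y)\<bar> \<le> 2 * B"
  using abs_Re_le_cmod[of "z * cis y"] assms by (simp add: norm_mult)

lemma summable_inverse_squares: "summable (\<lambda>n. 2 * (M / (real (Suc n))\<^sup>2))"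
  using summable_mult[OF sums_summable[OF inverse_squares_sums], of "2 * M"] by (simp add: algebra_simps)

lemma ser_uniform_limit:
  assumes "sdom c" "0 < \<tau>"
  shows "uniform_limit ({\<tau>..T} \<times> UNIV) (\<lambda>N p. \<Sum>n<N. 2 * Re (c n (fst p) * cis (real (Suc n) * snd p)))
           (\<lambda>p. ser c (fst p) (snd p)) sequentially"
proof -
  obtain M where M: "\<And>n t. t \<in> {\<tau>..T} \<Longrightarrow> cmod (c n t) \<le> M / (real (Suc n))\<^sup>2"
    using assms unfolding sdom_def by blast
  show ?thesis
    unfolding ser_def
    by (rule Weierstrass_m_test[where M = "\<lambda>n. 2 * (M / (real (Suc n))\<^sup>2)"])
      (use M in \<open>auto simp only: real_norm_def mem_Times_iff intro!: Re_cis_bound summable_inverse_squares\<close>)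
qed

lemma ser_sums:
  assumes "sdom c" "0 < t"
  shows "(\<lambda>n. 2 * Re (c n t * cis (real (Suc n) * x))) sums ser c t x"
  unfolding sums_def
  using tendsto_uniform_limitI[OF ser_uniform_limit[OF assms, of t], of "(t, x)"] by simp

lemma ser_continuous:
  assumes dc: "sdom c" and c: "\<And>n. continuous_on {0<..} (c n)"
  shows "continuous_on ({0<..} \<times> UNIV) (\<lambda>(t, x). ser c t x)"
proof (rule continuous_at_imp_continuous_on, rule ballI)
  fix p :: "real \<times> real" assume p: "p \<in> {0<..} \<times> UNIV"
  define A :: "(real \<times> real) set" where "A = {fst p / 2<..<fst p + 1} \<times> UNIV"
  have "continuous_on ({fst p / 2..fst p + 1} \<times> UNIV) (\<lambda>p. ser c (fst p) (snd p))"
  proof (rule uniform_limit_theorem[OF _ ser_uniform_limit[OF dc]])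
    have "continuous_on ({fst p / 2..fst p + 1} \<times> UNIV) (\<lambda>q. c n (fst q))" for n
      by (rule continuous_on_compose2[OF c continuous_on_fst[OF continuous_on_id]]) (use p in auto)
    then show "\<forall>\<^sub>F N in sequentially. continuous_on ({fst p / 2..fst p + 1} \<times> UNIV)
        (\<lambda>q. \<Sum>n<N. 2 * Re (c n (fst q) * cis (real (Suc n) * snd q)))"
      by (intro always_eventually allI continuous_intros) auto
  qed (use p in auto)
  then have "continuous_on A (\<lambda>p. ser c (fst p) (snd p))"
    by (rule continuous_on_subset) (auto simp: A_def)
  moreover have "open A" "p \<in> A"
    using p by (auto simp: A_def intro!: open_Times)
  ultimately show "isCont (\<lambda>(t, x). ser c t x) p"
    unfolding split_beta by (simp add: continuous_on_eq_continuous_at)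
qed

lemma ser_dx:
  assumes "sdom c" "sdom (\<lambda>n t. \<i> * of_nat (Suc n) * c n t)" "0 < t"
  shows "(ser c t has_real_derivative ser (\<lambda>n t. \<i> * of_nat (Suc n) * c n t) t x) (at x)"
proof -
  let ?c' = "\<lambda>n t. \<i> * of_nat (Suc n) * c n t"
  have d: "((\<lambda>x. 2 * Re (c n t * cis (real (Suc n) * x))) has_real_derivative 2 * Re (?c' n t * cis (real (Suc n) * x))) (at x)" for n x
    by (auto intro!: derivative_eq_intros simp: algebra_simps simp del: of_nat_Suc)
  have "uniform_limit UNIV (\<lambda>N x. \<Sum>n<N. 2 * Re (?c' n t * cis (real (Suc n) * x))) (\<lambda>x. ser ?c' t x) sequentially"
    using uniform_limit_compose'[OF ser_uniform_limit[OF assms(2,3), of t], of "\<lambda>x. (t, x)" UNIV] by simp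
  then have uc: "uniformly_convergent_on UNIV (\<lambda>N x. \<Sum>n<N. 2 * Re (?c' n t * cis (real (Suc n) * x)))"
    by (auto simp: uniformly_convergent_on_def)
  have "((\<lambda>x. \<Sum>n. 2 * Re (c n t * cis (real (Suc n) * x))) has_real_derivative
     (\<Sum>n. 2 * Re (?c' n t * cis (real (Suc n) * x)))) (at x)"
    by (rule has_field_derivative_series'(2)[OF convex_UNIV d uc UNIV_I sums_summable[OF ser_sums[OF assms(1,3)]]]) simp_all
  then show ?thesis by (simp add: ser_def[abs_def])
qed

lemma ser_dt:
  assumes "sdom c" "sdom c'" "0 < t"
    and d: "\<And>n t. 0 < t \<Longrightarrow> (c n has_vector_derivative c' n t) (at t)"
  shows "((\<lambda>s. ser c s x) has_real_derivative ser c' t x) (at t)"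
proof -
  let ?S = "{t / 2..t + 1}"
  have "uniform_limit ?S (\<lambda>N s. \<Sum>n<N. 2 * Re (c' n s * cis (real (Suc n) * x))) (\<lambda>s. ser c' s x) sequentially"
    using uniform_limit_compose'[OF ser_uniform_limit[OF assms(2), of "t / 2" "t + 1"], of "\<lambda>s. (s, x)" ?S] assms(3) by simp
  then have uc: "uniformly_convergent_on ?S (\<lambda>N s. \<Sum>n<N. 2 * Re (c' n s * cis (real (Suc n) * x)))"
    by (auto simp: uniformly_convergent_on_def)
  have dn: "((\<lambda>s. 2 * Re (c n s * cis (real (Suc n) * x))) has_real_derivative 2 * Re (c' n s * cis (real (Suc n) * x))) (at s within ?S)"
    if "s \<in> ?S" for n s
  proof -
    have "0 < s" using that assms(3) by simp
    then have vd: "(c n has_vector_derivative c' n s) (at s within ?S)"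
      by (rule has_vector_derivative_at_within[OF d])
    have bl: "bounded_linear (\<lambda>z. 2 * Re (z * cis (real (Suc n) * x)))"
      by (intro bounded_linear_const_mult bounded_linear_compose[OF bounded_linear_Re] bounded_linear_mult_left)
    show ?thesis
      unfolding has_real_derivative_iff_has_vector_derivative
      by (rule bounded_linear.has_vector_derivative[OF bl vd])
  qed
  have "((\<lambda>s. \<Sum>n. 2 * Re (c n s * cis (real (Suc n) * x))) has_real_derivative
     (\<Sum>n. 2 * Re (c' n t * cis (real (Suc n) * x)))) (at t)"
    by (rule has_field_derivative_series'(2)[OF _ dn uc _ sums_summable[OF ser_sums[OF assms(1,3)]]]) (use assms(3) in auto)
  then show ?thesis by (simp add: ser_def)
qed

subsection \<open>Fourier series with conjugate-symmetric coefficients\<close>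

lemma infsum_symmetric:
  fixes z :: "int \<Rightarrow> complex"
  assumes sym: "\<And>k. z (- k) = cnj (z k)" and sm: "(\<lambda>k. cmod (z k)) summable_on UNIV"
  shows "(\<Sum>\<^sub>\<infinity>k. z k) = z 0 + of_real (\<Sum>n. 2 * Re (z (int (Suc n))))"
proof -
  define P N where "P = range (\<lambda>n. int (Suc n))" and "N = range (\<lambda>n. - int (Suc n))"
  have zs: "z summable_on A" for A
    using summable_on_subset_banach[OF abs_summable_summable[OF sm]] by blast
  have U: "UNIV = {0} \<union> (P \<union> N)"
  proof -
    have "k \<in> {0} \<union> (P \<union> N)" for k :: int
    proof (cases k "0 :: int" rule: linorder_cases)
      case less
      then have "k = - int (Suc (nat (- k - 1)))" by simp
      then show ?thesis unfolding N_def by blast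
    next
      case greater
      then have "k = int (Suc (nat (k - 1)))" by simp
      then show ?thesis unfolding P_def by blast
    qed simp
    then show ?thesis by blast
  qed
  have zn: "(\<lambda>n. z (int (Suc n))) summable_on UNIV"
    using zs[of P] unfolding P_def by (subst (asm) summable_on_reindex) (auto simp: inj_on_def o_def)
  have zn': "(\<lambda>n. cnj (z (int (Suc n)))) summable_on UNIV"
    using zn by (simp only: summable_on_cnj_iff)
  have "(\<Sum>\<^sub>\<infinity>k. z k) = infsum z {0} + infsum z (P \<union> N)"
    unfolding U by (rule infsum_Un_disjoint[OF zs zs]) (auto simp: P_def N_def)
  also have "infsum z (P \<union> N) = infsum z P + infsum z N"
    by (rule infsum_Un_disjoint[OF zs zs]) (auto simp: P_def N_def)
  also have "infsum z P = (\<Sum>\<^sub>\<infinity>n. z (int (Suc n)))"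
    unfolding P_def by (subst infsum_reindex) (auto simp: inj_on_def o_def)
  also have "infsum z N = (\<Sum>\<^sub>\<infinity>n. cnj (z (int (Suc n))))"
    unfolding N_def by (subst infsum_reindex) (simp_all add: inj_on_def o_def sym[symmetric])
  also have "(\<Sum>\<^sub>\<infinity>n. z (int (Suc n))) + (\<Sum>\<^sub>\<infinity>n. cnj (z (int (Suc n)))) = (\<Sum>\<^sub>\<infinity>n. z (int (Suc n)) + cnj (z (int (Suc n))))"
    by (rule infsum_add[symmetric, OF zn zn'])
  also have "\<dots> = (\<Sum>\<^sub>\<infinity>n. complex_of_real (2 * Re (z (int (Suc n)))))"
    by (simp only: complex_add_cnj)
  also have "\<dots> = (\<Sum>n. complex_of_real (2 * Re (z (int (Suc n)))))"
  proof -
    have "(\<lambda>n. complex_of_real (2 * Re (z (int (Suc n))))) summable_on UNIV"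
      using summable_on_add[OF zn zn'] by (simp only: complex_add_cnj)
    then show ?thesis by (intro sums_unique has_sum_imp_sums has_sum_infsum)
  qed
  also have "\<dots> = of_real (\<Sum>n. 2 * Re (z (int (Suc n))))"
  proof -
    have "(\<lambda>n. 2 * Re (z (int (Suc n)))) summable_on UNIV"
      using summable_on_Re[OF zn] by (rule summable_on_cmult_right)
    then have "summable (\<lambda>n. 2 * Re (z (int (Suc n))))"
      by (rule summable_on_imp_summable)
    then show ?thesis by (rule suminf_of_real[symmetric])
  qed
  finally show ?thesis by simp
qed

text \<open>Absolute summability of \<open>v\<close> passes to the double family of products by
  shifting the inner sum, so the two summations may be interchanged.\<close>

lemma infsum_square_conv:
  fixes v :: "int \<Rightarrow> complex" and x :: real
  assumes sm: "(\<lambda>k. cmod (v k)) summable_on UNIV"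
  shows "(\<Sum>\<^sub>\<infinity>k. v k * cis (of_int k * x))\<^sup>2 = (\<Sum>\<^sub>\<infinity>k. conv v v k * cis (of_int k * x))"
proof -
  define z where "z = (\<lambda>k. v k * cis (of_int k * x))"
  have zm: "(\<lambda>k. cmod (z k)) summable_on UNIV" using sm by (simp add: z_def norm_mult)
  have bij: "bij_betw (\<lambda>k. k - m) UNIV (UNIV :: int set)" for m
    by (rule bij_betwI[of _ _ _ "\<lambda>k. k + m"]) auto
  have shift: "(\<Sum>\<^sub>\<infinity>k. h (k - m)) = (\<Sum>\<^sub>\<infinity>k. h k)" for h :: "int \<Rightarrow> 'b::{comm_monoid_add,t2_space}" and m
    by (rule infsum_reindex_bij_betw[OF bij])
  have shift_sm: "(\<lambda>k. h (k - m)) summable_on UNIV \<longleftrightarrow> h summable_on UNIV" for h :: "int \<Rightarrow> real" and m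
    by (rule summable_on_reindex_bij_betw[OF bij])
  have "(\<lambda>p. norm ((\<lambda>(m, k). z m * z (k - m)) p)) summable_on (UNIV \<times> UNIV)"
    unfolding Infinite_Sum.abs_summable_on_Sigma_iff
  proof (intro conjI ballI)
    fix m :: int
    show "(\<lambda>k. norm ((\<lambda>(m, k). z m * z (k - m)) (m, k))) summable_on UNIV"
      unfolding prod.case norm_mult using shift_sm[of "\<lambda>k. cmod (z k)" m] zm by (intro summable_on_cmult_right) simp
  next
    have "(\<lambda>m. cmod (z m) * (\<Sum>\<^sub>\<infinity>k. cmod (z k))) summable_on UNIV"
      by (intro summable_on_cmult_left zm)
    moreover have "(\<Sum>\<^sub>\<infinity>k. cmod (z m * z (k - m))) = cmod (z m) * (\<Sum>\<^sub>\<infinity>k. cmod (z k))" for m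
      unfolding norm_mult by (subst infsum_cmult_right') (simp add: shift[of "\<lambda>k. cmod (z k)"])
    ultimately show "(\<lambda>m. norm (\<Sum>\<^sub>\<infinity>k. norm ((\<lambda>(m, k). z m * z (k - m)) (m, k)))) summable_on UNIV"
      by (simp add: infsum_nonneg)
  qed
  then have sw: "(\<lambda>(m, k). z m * z (k - m)) summable_on (UNIV \<times> UNIV)"
    by (rule abs_summable_summable)
  have "(\<Sum>\<^sub>\<infinity>k. z k)\<^sup>2 = (\<Sum>\<^sub>\<infinity>m. z m * (\<Sum>\<^sub>\<infinity>k. z k))"
    unfolding power2_eq_square by (rule infsum_cmult_left'[symmetric])
  also have "\<dots> = (\<Sum>\<^sub>\<infinity>m. \<Sum>\<^sub>\<infinity>k. z m * z (k - m))"
    by (intro infsum_cong) (simp add: infsum_cmult_right' shift[of z])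
  also have "\<dots> = (\<Sum>\<^sub>\<infinity>k. \<Sum>\<^sub>\<infinity>m. z m * z (k - m))"
    by (rule infsum_swap_banach[OF sw])
  also have "\<dots> = (\<Sum>\<^sub>\<infinity>k. conv v v k * cis (of_int k * x))"
  proof (rule infsum_cong)
    fix k
    have "z m * z (k - m) = v m * v (k - m) * cis (of_int k * x)" for m
    proof -
      have "cis (of_int m * x) * cis (of_int (k - m) * x) = cis (of_int k * x)"
        by (simp add: cis_mult algebra_simps)
      then show ?thesis by (simp add: z_def mult_ac)
    qed
    then show "(\<Sum>\<^sub>\<infinity>m. z m * z (k - m)) = conv v v k * cis (of_int k * x)"
      by (simp add: conv_def infsum_cmult_left')
  qed
  finally show ?thesis by (simp add: z_def)
qed

lemma ks_reg_cong:
  assumes "\<And>t. t \<in> J \<Longrightarrow> \<theta> t = \<theta>' t"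
  shows "ks_reg J \<theta> a L u = ks_reg J \<theta>' a L u"
  unfolding ks_reg_def using assms by (intro conj_cong refl ball_cong) simp_all

context ks_data
begin

subsection \<open>Smoothing\<close>

text \<open>From \<open>exp y \<ge> (y / 2)^2\<close> with
  \<open>y = \<delta> * (1 + k^4 / 2)\<close>: eight powers of \<open>br k\<close> are available,
  and six are kept for the smoothing argument. The 1 in \<open>y\<close> makes the bound cover
  \<open>k = 0\<close> and costs the factor \<open>exp \<delta>\<close>.\<close>

lemma exp_decay:
  assumes \<delta>: "0 < \<delta>"
  shows "exp (- (real_of_int k ^ 4 / 2) * \<delta>) \<le> exp \<delta> * 1024 / \<delta>\<^sup>2 / br k ^ 6"
proof -
  define y where "y = \<delta> * (1 + real_of_int k ^ 4 / 2)"
  have b4: "\<delta> * br k ^ 4 / 16 \<le> y"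
    using mult_left_mono[OF br_pow4_le[of k], of \<delta>] \<delta> by (simp add: y_def)
  have bpos: "0 < \<delta> * br k ^ 4 / 16" using \<delta> by simp
  then have ypos: "0 < y" using b4 by linarith
  have "y / 2 \<le> exp (y / 2)" using exp_ge_add_one_self[of "y / 2"] by linarith
  then have "(y / 2)\<^sup>2 \<le> (exp (y / 2))\<^sup>2" using ypos by (intro power_mono) auto
  then have "(y / 2)\<^sup>2 \<le> exp y" by (simp add: exp_double[symmetric])
  moreover have "(\<delta> * br k ^ 4 / 16)\<^sup>2 \<le> y\<^sup>2"
    using b4 bpos by (intro power_mono) auto
  moreover have "(\<delta> * br k ^ 4 / 16)\<^sup>2 = \<delta>\<^sup>2 * br k ^ 8 / 256"
    by (simp add: power_mult_distrib power_divide flip: power_mult)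
  moreover have "\<delta>\<^sup>2 * br k ^ 6 / 256 \<le> \<delta>\<^sup>2 * br k ^ 8 / 256"
    using power_increasing[of 6 8 "br k"] by (intro divide_right_mono mult_left_mono) auto
  ultimately have "\<delta>\<^sup>2 * br k ^ 6 / 1024 \<le> exp y" by (simp add: power_divide)
  then have "1 / exp y \<le> 1 / (\<delta>\<^sup>2 * br k ^ 6 / 1024)"
    using \<delta> by (intro divide_left_mono) (auto simp: zero_less_mult_iff intro!: zero_less_power)
  then have "exp \<delta> * (1 / exp y) \<le> exp \<delta> * (1 / (\<delta>\<^sup>2 * br k ^ 6 / 1024))"
    by (intro mult_left_mono) auto
  moreover have "exp \<delta> * (1 / exp y) = exp (- (real_of_int k ^ 4 / 2) * \<delta>)"
    by (simp add: y_def exp_diff[symmetric] algebra_simps)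
  ultimately show ?thesis by simp
qed

text \<open>Restarting at \<open>\<tau>0\<close>, the linear part decays with exponent 6 after a
  positive delay, hence with \<open>p + 3\<close> as \<open>p \<le> 3\<close>; the Duhamel part
  inherits \<open>p\<close> from the convolution and gains three.\<close>

lemma smoothing_step:
  assumes \<tau>: "0 \<le> \<tau>0" "\<tau>0 < \<tau>1" and p: "p \<le> 3"
    and B: "\<And>s k. s \<in> {\<tau>0..T} \<Longrightarrow> cmod (cut sol s k) \<le> B / br k ^ p"
  shows "\<exists>M. \<forall>t\<in>{\<tau>1..T}. \<forall>k. cmod (sol t k) \<le> M / br k ^ (p + 3)"
proof -
  define \<delta> where "\<delta> = \<tau>1 - \<tau>0"
  have \<delta>: "0 < \<delta>" using \<tau> by (simp add: \<delta>_def)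
  define b where "b = n2 (sol \<tau>0)"
  have b: "cmod (sol \<tau>0 k) \<le> b" for k unfolding b_def by (intro cmod_le_n2 adm_l2 adm_sol \<tau>)
  have b0: "0 \<le> b" by (simp add: b_def)
  define M where "M = exp (\<omega> * T) * (exp \<delta> * 1024 / \<delta>\<^sup>2) * b + 8 * B * exp ((\<omega> + 1) * T)"
  have "cmod (sol t k) \<le> M / br k ^ (p + 3)" if t: "t \<in> {\<tau>1..T}" for t k
  proof -
    have t': "\<tau>0 \<le> t" "t \<le> T" "\<delta> \<le> t - \<tau>0" "t - \<tau>0 \<le> T" using t \<tau> by (auto simp: \<delta>_def)
    have "cmod (exp (\<mu> k * of_real (t - \<tau>0)) * sol \<tau>0 k) = exp (Re (\<mu> k) * (t - \<tau>0)) * cmod (sol \<tau>0 k)"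
      by (simp add: norm_mult norm_exp_eq_Re)
    also have "\<dots> \<le> (exp (\<omega> * T) * (exp \<delta> * 1024 / \<delta>\<^sup>2 / br k ^ 6)) * b"
    proof (intro mult_mono b)
      have "Re (\<mu> k) * (t - \<tau>0) \<le> (\<omega> - real_of_int k ^ 4 / 2) * (t - \<tau>0)"
        using t' \<tau> \<delta> by (intro mult_right_mono Re_\<mu>) auto
      also have "\<dots> = \<omega> * (t - \<tau>0) - real_of_int k ^ 4 / 2 * (t - \<tau>0)" by (simp add: left_diff_distrib)
      also have "\<dots> \<le> \<omega> * T - real_of_int k ^ 4 / 2 * \<delta>"
        using t' \<omega>0 by (intro diff_mono mult_left_mono) auto
      finally have "exp (Re (\<mu> k) * (t - \<tau>0)) \<le> exp (\<omega> * T) * exp (- (real_of_int k ^ 4 / 2) * \<delta>)"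
        by (simp add: exp_add[symmetric])
      also have "\<dots> \<le> exp (\<omega> * T) * (exp \<delta> * 1024 / \<delta>\<^sup>2 / br k ^ 6)"
        by (intro mult_left_mono exp_decay \<delta>) auto
      finally show "exp (Re (\<mu> k) * (t - \<tau>0)) \<le> exp (\<omega> * T) * (exp \<delta> * 1024 / \<delta>\<^sup>2 / br k ^ 6)" .
    qed auto
    also have "\<dots> = exp (\<omega> * T) * (exp \<delta> * 1024 / \<delta>\<^sup>2) * b / br k ^ 6" by simp
    also have "\<dots> \<le> exp (\<omega> * T) * (exp \<delta> * 1024 / \<delta>\<^sup>2) * b / br k ^ (p + 3)"
      using p b0 by (intro divide_left_mono power_increasing) auto
    finally have 1: "cmod (exp (\<mu> k * of_real (t - \<tau>0)) * sol \<tau>0 k) \<le> exp (\<omega> * T) * (exp \<delta> * 1024 / \<delta>\<^sup>2) * b / br k ^ (p + 3)" .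
    have 2: "cmod (exp (\<mu> k * of_real t) * integral {\<tau>0..t} (\<lambda>s. exp (- \<mu> k * of_real s) * nl sol k s))
        \<le> 8 * (B / br k ^ p) * exp ((\<omega> + 1) * T) / br k ^ 3"
      by (rule duhamel_tail_le[OF adm_sol \<tau>(1) t'(1,2) B])
    have "8 * (B / br k ^ p) * exp ((\<omega> + 1) * T) / br k ^ 3 = 8 * B * exp ((\<omega> + 1) * T) / br k ^ (p + 3)"
      by (simp add: power_add)
    then show ?thesis
      unfolding sol_restart[OF \<tau>(1) t'(1)] M_def add_divide_distrib using 1 2 by (intro norm_triangle_le) linarith
  qed
  then show ?thesis by blast
qed

text \<open>Two smoothing steps, on \<open>[\<tau>/2, T]\<close> and then on
  \<open>[\<tau>, T]\<close>. The truncated convolution is bounded outright, which gives exponent 3;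
  \<open>conv_decay\<close> hands this to the convolution and the second step reaches 6. Four powers
  pay for the derivatives in the equation, two for summation.\<close>

lemma sol_decay:
  assumes \<tau>: "0 < \<tau>"
  shows "\<exists>M. \<forall>t\<in>{\<tau>..T}. \<forall>k. cmod (sol t k) \<le> M / br k ^ 6"
proof -
  have "\<exists>M. \<forall>t\<in>{\<tau>/2..T}. \<forall>k. cmod (sol t k) \<le> M / br k ^ (0 + 3)"
  proof (rule smoothing_step)
    show "cmod (cut sol s k) \<le> (\<rho> T)\<^sup>2 / br k ^ 0" if "s \<in> {0..T}" for s k
      using cut_le[OF adm_sol, of s k] power_mono[OF \<rho>_mono[of s T] less_imp_le[OF \<rho>_pos], of 2] that by auto
  qed (use \<tau> in auto)
  then obtain M where M: "\<And>t k. t \<in> {\<tau>/2..T} \<Longrightarrow> cmod (sol t k) \<le> M / br k ^ 3" unfolding add_0 by blast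
  have "\<exists>M. \<forall>t\<in>{\<tau>..T}. \<forall>k. cmod (sol t k) \<le> M / br k ^ (3 + 3)"
  proof (rule smoothing_step)
    show "cmod (cut sol s k) \<le> (M\<^sup>2 * 2 ^ Suc 3 * (\<Sum>\<^sub>\<infinity>m::int. 1 / (br m)\<^sup>2)) / br k ^ 3" if s: "s \<in> {\<tau>/2..T}" for s k
      unfolding cut_def
    proof (rule conv_decay)
      show "cmod (radial (\<rho> s) (sol s) m) \<le> M / br m ^ 3" for m
        using radial_cmod_le[OF \<rho>_pos, of s sol s m] M[OF s, of m] by linarith
    qed simp
  qed (use \<tau> in auto)
  then show ?thesis by simp
qed

subsection \<open>The classical solution\<close>

definition U :: "real \<Rightarrow> real \<Rightarrow> real" where
  "U = ser (\<lambda>n t. sol t (int (Suc n)))"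

abbreviation uc :: "nat \<Rightarrow> nat \<Rightarrow> real \<Rightarrow> complex" where
  "uc j n t \<equiv> (\<i> * of_nat (Suc n)) ^ j * sol t (int (Suc n))"

abbreviation cc :: "nat \<Rightarrow> real \<Rightarrow> complex" where
  "cc n t \<equiv> conv (sol t) (sol t) (int (Suc n))"

lemma sdomI:
  assumes "\<And>\<tau> T. 0 < \<tau> \<Longrightarrow> \<exists>M. \<forall>t\<in>{\<tau>..T}. \<forall>k. 0 < k \<longrightarrow> cmod (c (nat (k - 1)) t) \<le> M / br k ^ 2"
  shows "sdom c"
  unfolding sdom_def
proof (intro allI impI)
  fix \<tau> T :: real assume "0 < \<tau>"
  from assms[OF this, of T] obtain M where
    M: "\<And>t k. t \<in> {\<tau>..T} \<Longrightarrow> 0 < k \<Longrightarrow> cmod (c (nat (k - 1)) t) \<le> M / br k ^ 2" by blast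
  show "\<exists>M. \<forall>n. \<forall>t\<in>{\<tau>..T}. cmod (c n t) \<le> M / (real (Suc n))\<^sup>2"
  proof (intro exI allI ballI)
    fix n t assume t: "t \<in> {\<tau>..T}"
    have le: "cmod (c n t) \<le> M / (2 + real n)\<^sup>2" using M[OF t, of "int n + 1"] by (simp add: add.commute)
    have "0 \<le> M" using order_trans[OF norm_ge_zero le] by (simp add: zero_le_divide_iff)
    then have "M / (2 + real n)\<^sup>2 \<le> M / (real (Suc n))\<^sup>2"
      by (intro divide_left_mono power_mono) auto
    then show "cmod (c n t) \<le> M / (real (Suc n))\<^sup>2" using le by linarith
  qed
qed

lemma br_mult_le:
  assumes z: "cmod z \<le> M / br k ^ q" and y: "cmod y \<le> K * br k ^ j" and "j + 2 \<le> q"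
  shows "cmod (y * z) \<le> (K * M) / br k ^ 2"
proof -
  have pos: "0 < br k ^ i" for i by (intro zero_less_power) simp
  have M0: "0 \<le> M" using order_trans[OF norm_ge_zero z] pos[of q] by (simp only: zero_le_divide_iff) linarith
  have K0: "0 \<le> K" using order_trans[OF norm_ge_zero y] pos[of j] by (simp only: zero_le_mult_iff) linarith
  have "cmod (y * z) \<le> (K * br k ^ j) * (M / br k ^ q)"
    unfolding norm_mult using y z by (intro mult_mono) (auto intro: order_trans[OF norm_ge_zero])
  also have "\<dots> = (K * M) * (br k ^ (j + 2) / br k ^ q) / br k ^ 2"
  proof -
    have "K * p * (M / w) = (K * M) * (p * c / w) / c" if "c \<noteq> 0" for p w c :: real
      using that by simp
    from this[of "br k ^ 2" "br k ^ j" "br k ^ q"] pos[of 2] show ?thesis unfolding power_add by linarith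
  qed
  also have "\<dots> \<le> (K * M) * 1 / br k ^ 2"
  proof (intro divide_right_mono mult_left_mono)
    have "br k ^ (j + 2) \<le> br k ^ q" using assms(3) by (intro power_increasing) auto
    then show "br k ^ (j + 2) / br k ^ q \<le> 1" by (simp add: divide_le_eq_1)
  qed (use K0 M0 in auto)
  finally show ?thesis by simp
qed

lemma sdom_uc:
  assumes "j \<le> 4"
  shows "sdom (uc j)"
proof (rule sdomI)
  fix \<tau> T :: real assume "0 < \<tau>"
  from sol_decay[OF this, of T] obtain M where M: "\<And>t k. t \<in> {\<tau>..T} \<Longrightarrow> cmod (sol t k) \<le> M / br k ^ 6" by blast
  show "\<exists>M. \<forall>t\<in>{\<tau>..T}. \<forall>k. 0 < k \<longrightarrow> cmod (uc j (nat (k - 1)) t) \<le> M / br k ^ 2"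
  proof (intro exI ballI allI impI)
    fix t k assume t: "t \<in> {\<tau>..T}" and k: "(0::int) < k"
    have i: "int (Suc (nat (k - 1))) = k" "of_nat (Suc (nat (k - 1))) = complex_of_int k"
      using k by (auto simp: of_nat_nat)
    have "cmod ((\<i> * complex_of_int k) ^ j) \<le> 1 * br k ^ j"
      using k by (simp add: norm_power norm_mult power_mono)
    from br_mult_le[OF M[OF t, of k] this] show "cmod (uc j (nat (k - 1)) t) \<le> (1 * M) / br k ^ 2"
      using assms unfolding i by simp
  qed
qed

lemma conv_decay_sol:
  assumes "0 < \<tau>"
  shows "\<exists>M. \<forall>t\<in>{\<tau>..T}. \<forall>k. cmod (conv (sol t) (sol t) k) \<le> M / br k ^ 6"
proof -
  from sol_decay[OF assms, of T] obtain M where M: "\<And>t k. t \<in> {\<tau>..T} \<Longrightarrow> cmod (sol t k) \<le> M / br k ^ 6" by blast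
  have "cmod (conv (sol t) (sol t) k) \<le> (M\<^sup>2 * 2 ^ Suc 6 * (\<Sum>\<^sub>\<infinity>m::int. 1 / (br m)\<^sup>2)) / br k ^ 6" if "t \<in> {\<tau>..T}" for t k
    by (rule conv_decay[OF _ M[OF that]]) simp
  then show ?thesis by blast
qed

lemma sdom_cc: "sdom cc" "sdom (\<lambda>n t. \<i> * of_nat (Suc n) * cc n t)"
proof -
  have "sdom (\<lambda>n t. (\<i> * of_nat (Suc n)) ^ j * cc n t)" if "j \<le> 4" for j
  proof (rule sdomI)
    fix \<tau> T :: real assume "0 < \<tau>"
    from conv_decay_sol[OF this, of T] obtain M where M: "\<And>t k. t \<in> {\<tau>..T} \<Longrightarrow> cmod (conv (sol t) (sol t) k) \<le> M / br k ^ 6" by blast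
    show "\<exists>M. \<forall>t\<in>{\<tau>..T}. \<forall>k. 0 < k \<longrightarrow> cmod ((\<i> * of_nat (Suc (nat (k - 1)))) ^ j * cc (nat (k - 1)) t) \<le> M / br k ^ 2"
    proof (intro exI ballI allI impI)
      fix t k assume t: "t \<in> {\<tau>..T}" and k: "(0::int) < k"
      have i: "int (Suc (nat (k - 1))) = k" "of_nat (Suc (nat (k - 1))) = complex_of_int k"
        using k by (auto simp: of_nat_nat)
      have "cmod ((\<i> * complex_of_int k) ^ j) \<le> 1 * br k ^ j"
        using k by (simp add: norm_power norm_mult power_mono)
      from br_mult_le[OF M[OF t, of k] this] show "cmod ((\<i> * of_nat (Suc (nat (k - 1)))) ^ j * cc (nat (k - 1)) t) \<le> (1 * M) / br k ^ 2"
        using that unfolding i by simp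
    qed
  qed
  from this[of 0] this[of 1] show "sdom cc" "sdom (\<lambda>n t. \<i> * of_nat (Suc n) * cc n t)" by simp_all
qed

text \<open>Convolution is quadratic, so the scalar of the radial projection comes out squared. As
  it depends on time alone, the truncated problem is an instance of \<open>ks_reg\<close>.\<close>

definition \<theta> :: "real \<Rightarrow> real" where "\<theta> t = (\<rho> t / max (\<rho> t) (n2 (sol t)))\<^sup>2"

lemma nl_sol: "0 \<le> t \<Longrightarrow> nl sol k t = of_real (\<theta> t) * (\<i> * of_int k / 2 * conv (sol t) (sol t) k)"
  unfolding nl_def cut_def radial_def[abs_def]
  by (subst conv_scale) (auto simp: \<theta>_def adm_l2 adm_sol)

lemma \<theta>_bounds: "0 \<le> \<theta> t" "\<theta> t \<le> 1"
  using \<rho>_pos[of t] by (auto simp: \<theta>_def intro!: power_le_one divide_nonneg_pos simp: divide_le_eq_1)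

lemma \<mu>_eq: "\<mu> k = - ((\<i> * of_int k) ^ 4) - of_real a * (\<i> * of_int k) ^ 2 + of_real L * (\<i> * of_int k) ^ 3"
  by (simp add: \<mu>_def complex_eq_iff power_mult_distrib power3_eq_cube power4_eq_xxxx power2_eq_square)

definition vc :: "nat \<Rightarrow> real \<Rightarrow> complex" where
  "vc n t = \<mu> (int (Suc n)) * sol t (int (Suc n)) + nl sol (int (Suc n)) t"

lemma vc_eq:
  assumes "0 \<le> t"
  shows "vc n t = - uc 4 n t - of_real a * uc 2 n t + of_real L * uc 3 n t
    + of_real (\<theta> t / 2) * (\<i> * of_nat (Suc n) * cc n t)"
  unfolding vc_def \<mu>_eq nl_sol[OF assms] by (simp add: algebra_simps)

lemma sdom_vc: "sdom vc"
  unfolding sdom_def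
proof (intro allI impI)
  fix \<tau> T :: real assume \<tau>: "0 < \<tau>"
  obtain A where A: "\<And>n t. t \<in> {\<tau>..T} \<Longrightarrow> cmod (uc 4 n t) \<le> A / (real (Suc n))\<^sup>2" using sdom_uc[of 4] \<tau> unfolding sdom_def by blast
  obtain B where B: "\<And>n t. t \<in> {\<tau>..T} \<Longrightarrow> cmod (uc 2 n t) \<le> B / (real (Suc n))\<^sup>2" using sdom_uc[of 2] \<tau> unfolding sdom_def by fastforce
  obtain C where C: "\<And>n t. t \<in> {\<tau>..T} \<Longrightarrow> cmod (uc 3 n t) \<le> C / (real (Suc n))\<^sup>2" using sdom_uc[of 3] \<tau> unfolding sdom_def by fastforce
  obtain D where D: "\<And>n t. t \<in> {\<tau>..T} \<Longrightarrow> cmod (\<i> * of_nat (Suc n) * cc n t) \<le> D / (real (Suc n))\<^sup>2" using sdom_cc(2) \<tau> unfolding sdom_def by blast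
  show "\<exists>M. \<forall>n. \<forall>t\<in>{\<tau>..T}. cmod (vc n t) \<le> M / (real (Suc n))\<^sup>2"
  proof (intro exI allI ballI)
    fix n t assume t: "t \<in> {\<tau>..T}"
    let ?q = "(real (Suc n))\<^sup>2"
    have "cmod (vc n t) \<le> cmod (uc 4 n t) + cmod (of_real a * uc 2 n t) + cmod (of_real L * uc 3 n t) + cmod (of_real (\<theta> t / 2) * (\<i> * of_nat (Suc n) * cc n t))"
      using t \<tau> by (subst vc_eq) (auto intro!: norm_triangle_le norm_triangle_le_diff)
    also have "\<dots> \<le> A / ?q + \<bar>a\<bar> * (B / ?q) + \<bar>L\<bar> * (C / ?q) + 1 * (D / ?q)"
      unfolding norm_mult[of "of_real _"] norm_of_real
      using \<theta>_bounds[of t] by (intro add_mono mult_mono A B C D t) auto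
    finally show "cmod (vc n t) \<le> (A + \<bar>a\<bar> * B + \<bar>L\<bar> * C + D) / ?q"
      by (simp add: add_divide_distrib)
  qed
qed

lemma sol_continuous: "continuous_on {0<..} (\<lambda>t. sol t k)"
  using sol_has_derivative by (intro continuous_at_imp_continuous_on ballI) (auto dest!: has_vector_derivative_continuous)

lemma n2_sol_continuous: "continuous_on {0..T} (\<lambda>t. n2 (sol t))"
  by (rule continuous_on_n2[OF _ _ majorant_l2[of T]]) (use adm_sol sol_dom in \<open>auto simp: adm_def\<close>)

lemma vc_continuous: "continuous_on {0<..} (vc n)"
proof (rule continuous_at_imp_continuous_on, rule ballI)
  fix t :: real assume t: "t \<in> {0<..}"
  have "continuous_on {0..t+1} (vc n)"
    unfolding vc_def using adm_sol by (intro continuous_intros continuous_on_nl) (auto simp: adm_def)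
  then have "continuous_on {0<..<t+1} (vc n)" by (rule continuous_on_subset) auto
  then show "isCont (vc n) t" using t by (auto simp: continuous_on_eq_continuous_at)
qed

lemma dx_U: "0 < t \<Longrightarrow> j \<le> 4 \<Longrightarrow> dx j U t = ser (uc j) t"
  and dx_U_deriv: "0 < t \<Longrightarrow> j < 4 \<Longrightarrow> (ser (uc j) t has_real_derivative ser (uc (Suc j)) t x) (at x)"
proof -
  have d: "(ser (uc j) t has_real_derivative ser (uc (Suc j)) t x) (at x)" if "0 < t" "j < 4" for j t x
    using ser_dx[OF sdom_uc[of j] _ that(1), of x] sdom_uc[of "Suc j"] that by (simp add: mult.assoc)
  show "0 < t \<Longrightarrow> j < 4 \<Longrightarrow> (ser (uc j) t has_real_derivative ser (uc (Suc j)) t x) (at x)" by (rule d)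
  show "0 < t \<Longrightarrow> j \<le> 4 \<Longrightarrow> dx j U t = ser (uc j) t"
  proof (induction j)
    case 0
    then show ?case by (simp add: dx_def U_def fun_eq_iff)
  next
    case (Suc j)
    then have eq: "dx j U t = ser (uc j) t" by simp
    have "dx (Suc j) U t x = ser (uc (Suc j)) t x" for x
    proof -
      have "dx (Suc j) U t x = deriv (dx j U t) x" by (simp add: dx_def[abs_def])
      also have "\<dots> = ser (uc (Suc j)) t x"
        unfolding eq using Suc.prems by (intro DERIV_imp_deriv d) auto
      finally show ?thesis .
    qed
    then show ?case by blast
  qed
qed

lemma dt_U_deriv: "0 < t \<Longrightarrow> ((\<lambda>s. U s x) has_real_derivative ser vc t x) (at t)"
  unfolding U_def using sdom_uc[of 0] sol_has_derivative
  by (intro ser_dt sdom_vc) (auto simp: vc_def)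

lemma dt_U: "0 < t \<Longrightarrow> dt U t x = ser vc t x"
  unfolding dt_def by (rule DERIV_imp_deriv[OF dt_U_deriv])

lemma sol_abs_summable:
  assumes "0 < t"
  shows "(\<lambda>k. cmod (sol t k)) summable_on UNIV" "(\<lambda>k. cmod (conv (sol t) (sol t) k)) summable_on UNIV"
proof -
  have *: "(\<lambda>k. cmod (w k)) summable_on UNIV" if w: "\<And>k. cmod (w k) \<le> M / br k ^ 6" for w :: "int \<Rightarrow> complex" and M
  proof (rule summable_on_comparison_test)
    show "(\<lambda>k. M * (1 / (br k)\<^sup>2)) summable_on UNIV"
      by (intro summable_on_cmult_right summable_inverse_square_int)
    fix k :: int
    have "0 \<le> M" using order_trans[OF norm_ge_zero w[of 0]] by simp
    then have "M / br k ^ 6 \<le> M / (br k)\<^sup>2" by (intro divide_left_mono power_increasing) auto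
    then show "cmod (w k) \<le> M * (1 / (br k)\<^sup>2)" using w[of k] by simp
  qed simp
  show "(\<lambda>k. cmod (sol t k)) summable_on UNIV"
    using sol_decay[OF assms, of t] * by auto
  show "(\<lambda>k. cmod (conv (sol t) (sol t) k)) summable_on UNIV"
    using conv_decay_sol[OF assms, of t] * by auto
qed

lemma U_fourier:
  assumes "0 < t"
  shows "(\<Sum>\<^sub>\<infinity>k. sol t k * cis (of_int k * x)) = of_real (U t x)"
proof -
  have "(\<Sum>\<^sub>\<infinity>k. sol t k * cis (of_int k * x))
      = sol t 0 * cis (of_int 0 * x) + of_real (\<Sum>n. 2 * Re (sol t (int (Suc n)) * cis (of_int (int (Suc n)) * x)))"
    by (rule infsum_symmetric) (use assms sol_abs_summable(1) in \<open>auto simp: sol_sym cis_cnj norm_mult\<close>)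
  then show ?thesis using assms by (simp add: sol_zero U_def ser_def)
qed

lemma U_square:
  assumes "0 < t"
  shows "(U t x)\<^sup>2 = Re (conv (sol t) (sol t) 0) + ser cc t x"
proof -
  have "complex_of_real ((U t x)\<^sup>2) = (\<Sum>\<^sub>\<infinity>k. conv (sol t) (sol t) k * cis (of_int k * x))"
    using infsum_square_conv[OF sol_abs_summable(1)[OF assms], of x] U_fourier[OF assms, of x] by simp
  also have "\<dots> = conv (sol t) (sol t) 0 * cis (of_int 0 * x) + of_real (\<Sum>n. 2 * Re (cc n t * cis (of_int (int (Suc n)) * x)))"
    by (rule infsum_symmetric) (use assms sol_abs_summable(2) in \<open>auto simp: conv_sym sol_sym cis_cnj norm_mult\<close>)
  finally have "complex_of_real ((U t x)\<^sup>2) = conv (sol t) (sol t) 0 + of_real (ser cc t x)"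
    by (simp add: ser_def)
  then show ?thesis by (metis Re_complex_of_real plus_complex.sel(1))
qed

text \<open>The product is found by differentiating the square: \<open>U^2\<close> is known as a
  series, and its termwise derivative must agree with the chain rule.\<close>

lemma U_nonlinear:
  assumes "0 < t"
  shows "ser (\<lambda>n t. \<i> * of_nat (Suc n) * cc n t) t x = 2 * (U t x * ser (uc 1) t x)"
proof (rule DERIV_unique)
  have "((\<lambda>x. Re (conv (sol t) (sol t) 0) + ser cc t x) has_real_derivative 0 + ser (\<lambda>n t. \<i> * of_nat (Suc n) * cc n t) t x) (at x)"
    by (intro derivative_intros ser_dx sdom_cc assms)
  then show "((\<lambda>x. (U t x)\<^sup>2) has_real_derivative ser (\<lambda>n t. \<i> * of_nat (Suc n) * cc n t) t x) (at x)"
    by (simp add: U_square assms)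
  have "(U t has_real_derivative ser (uc 1) t x) (at x)"
    using dx_U_deriv[OF assms, of 0 x] by (simp add: U_def)
  then show "((\<lambda>x. (U t x)\<^sup>2) has_real_derivative 2 * (U t x * ser (uc 1) t x)) (at x)"
    by (auto intro!: derivative_eq_intros)
qed

lemma U_reg: "ks_reg {0<..} \<theta> a L U"
  unfolding ks_reg_def
proof (intro conjI ballI allI impI)
  fix t x :: real assume "t \<in> {0<..}" then have t: "0 < t" by simp
  show "U t (x + 2 * pi) = U t x"
  proof -
    have "cis (real (Suc n) * (x + 2 * pi)) = cis (real (Suc n) * x)" for n
      using cis_multiple_2pi[of "real (Suc n)"] by (simp add: distrib_left mult.commute cis_mult[symmetric])
    then show ?thesis by (simp add: U_def ser_def)
  qed
  show "(dx k U t has_real_derivative dx (Suc k) U t x) (at x)" if "k < 4" for k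
    using dx_U_deriv[OF t that] dx_U[OF t] that by simp
  show "((\<lambda>s. U s x) has_real_derivative dt U t x) (at t)"
    using dt_U_deriv[OF t] dt_U[OF t] by simp
  show "dt U t x = - dx 4 U t x - a * dx 2 U t x + \<theta> t * (U t x * dx 1 U t x) + L * dx 3 U t x"
  proof -
    let ?e = "\<lambda>n. cis (real (Suc n) * x)"
    have "(\<lambda>n. - (2 * Re (uc 4 n t * ?e n)) - a * (2 * Re (uc 2 n t * ?e n)) + \<theta> t / 2 * (2 * Re (\<i> * of_nat (Suc n) * cc n t * ?e n)) + L * (2 * Re (uc 3 n t * ?e n)))
      sums (- ser (uc 4) t x - a * ser (uc 2) t x + \<theta> t / 2 * ser (\<lambda>n t. \<i> * of_nat (Suc n) * cc n t) t x + L * ser (uc 3) t x)"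
      by (intro sums_add sums_diff sums_minus sums_mult ser_sums sdom_uc sdom_cc t) auto
    moreover have "2 * Re (vc n t * ?e n) = - (2 * Re (uc 4 n t * ?e n)) - a * (2 * Re (uc 2 n t * ?e n)) + \<theta> t / 2 * (2 * Re (\<i> * of_nat (Suc n) * cc n t * ?e n)) + L * (2 * Re (uc 3 n t * ?e n))" for n
    proof -
      have lin: "2 * Re ((- p - of_real a * q + of_real L * r + of_real y * s) * e)
        = - (2 * Re (p * e)) - a * (2 * Re (q * e)) + y * (2 * Re (s * e)) + L * (2 * Re (r * e))" for p q r s e y
        by (simp add: algebra_simps)
      show ?thesis unfolding vc_eq[OF less_imp_le[OF t]] by (rule lin)
    qed
    ultimately have "ser vc t x = - ser (uc 4) t x - a * ser (uc 2) t x + \<theta> t / 2 * ser (\<lambda>n t. \<i> * of_nat (Suc n) * cc n t) t x + L * ser (uc 3) t x"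
      unfolding ser_def[of vc] by (simp add: sums_iff)
    then show ?thesis
      unfolding dt_U[OF t] dx_U[OF t order_refl] U_nonlinear[OF t] by (simp add: dx_U[OF t])
  qed
next
  fix k :: nat assume k: "k \<le> 4"
  have "continuous_on ({0<..} \<times> UNIV) (\<lambda>(t, x). ser (uc k) t x)"
    by (intro ser_continuous sdom_uc k continuous_intros sol_continuous)
  then show "continuous_on ({0<..} \<times> UNIV) (\<lambda>(t, x). dx k U t x)"
    by (rule continuous_on_eq) (use k in \<open>auto simp: dx_U\<close>)
next
  have "continuous_on ({0<..} \<times> UNIV) (\<lambda>(t, x). ser vc t x)"
    by (intro ser_continuous sdom_vc vc_continuous)
  then show "continuous_on ({0<..} \<times> UNIV) (\<lambda>(t, x). dt U t x)"
    by (rule continuous_on_eq) (auto simp: dt_U)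
qed

lemma U_smooth: "ks_smooth {0<..} \<theta> a L U"
  by unfold_locales (use U_reg in auto)

text \<open>The defect identity with coefficients \<open>sol t\<close> bounds the squared
  discrepancy in one mode by the mean-square error of a partial sum, which uniform convergence makes
  arbitrarily small.\<close>

lemma fourier_coeff_U:
  assumes t: "0 < t"
  shows "fourier_coeff (U t) k = sol t k"
proof -
  have H: "in_H (U t)" by (rule ks_smooth.in_H_u[OF U_smooth]) (use t in simp)
  have lim: "uniform_limit UNIV (\<lambda>S x. \<Sum>k\<in>S. sol t k * cis (of_int k * x)) (\<lambda>x. \<Sum>\<^sub>\<infinity>k. sol t k * cis (of_int k * x)) (finite_subsets_at_top UNIV)"
    by (rule Weierstrass_m_test_general[OF _ sol_abs_summable(1)[OF t]]) (simp add: norm_mult)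
  have "(cmod (sol t k - fourier_coeff (U t) k))\<^sup>2 \<le> 0 + e" if e: "0 < e" for e
  proof -
    have "\<forall>\<^sub>F S in finite_subsets_at_top UNIV. \<forall>x\<in>UNIV. dist (\<Sum>k\<in>S. sol t k * cis (of_int k * x)) (\<Sum>\<^sub>\<infinity>k. sol t k * cis (of_int k * x)) < sqrt e"
      using e by (intro uniform_limitD[OF lim]) simp
    moreover have "\<forall>\<^sub>F S in finite_subsets_at_top (UNIV :: int set). {k} \<subseteq> S \<and> finite S"
      unfolding eventually_finite_subsets_at_top by (intro exI[of _ "{k}"]) auto
    ultimately have "\<forall>\<^sub>F S in finite_subsets_at_top UNIV. k \<in> S \<and> finite S \<and> (\<forall>x. cmod (complex_of_real (U t x) - trig_sum S (sol t) x) < sqrt e)"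
      by eventually_elim (auto simp: U_fourier[OF t] trig_sum_def dist_norm norm_minus_commute)
    from eventually_happens'[OF finite_subsets_at_top_neq_bot this]
    obtain S where S: "k \<in> S" "finite S" "\<And>x. cmod (complex_of_real (U t x) - trig_sum S (sol t) x) < sqrt e"
      by blast
    interpret finite_measure circ by (rule finite_measure_circ)
    have "integral\<^sup>L circ (\<lambda>x. (cmod (complex_of_real (U t x) - trig_sum S (sol t) x))\<^sup>2) \<le> integral\<^sup>L circ (\<lambda>x. e)"
    proof (rule integral_mono_AE')
      have "(cmod (complex_of_real (U t x) - trig_sum S (sol t) x))\<^sup>2 \<le> (sqrt e)\<^sup>2" for x
        using S(3)[of x] by (intro power_mono) auto
      then show "AE x in circ. (cmod (complex_of_real (U t x) - trig_sum S (sol t) x))\<^sup>2 \<le> e"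
        unfolding real_sqrt_pow2[OF less_imp_le[OF e]] by (rule AE_I2)
      show "AE x in circ. 0 \<le> e" using e by (intro AE_I2) simp
    qed (rule integrable_const)
    also have "\<dots> = 2 * pi * e" using measure_circ by simp
    finally have "integral\<^sup>L circ (\<lambda>x. (cmod (complex_of_real (U t x) - trig_sum S (sol t) x))\<^sup>2) / (2 * pi) \<le> e"
      by (simp add: divide_le_eq mult.commute)
    then have "(\<Sum>k\<in>S. (cmod (sol t k - fourier_coeff (U t) k))\<^sup>2) \<le> e"
      unfolding trig_sum_defect[OF H S(2)] using bessel[OF H S(2)] by linarith
    moreover have "(cmod (sol t k - fourier_coeff (U t) k))\<^sup>2 \<le> (\<Sum>k\<in>S. (cmod (sol t k - fourier_coeff (U t) k))\<^sup>2)"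
      using S by (intro member_le_sum) auto
    ultimately show ?thesis by linarith
  qed
  then have "(cmod (sol t k - fourier_coeff (U t) k))\<^sup>2 \<le> 0" by (rule field_le_epsilon)
  then show ?thesis by simp
qed

lemma n2_sol_eq_hnorm: "0 < t \<Longrightarrow> n2 (sol t) = hnorm (U t)"
proof -
  assume t: "0 < t"
  have H: "in_H (U t)" by (rule ks_smooth.in_H_u[OF U_smooth]) (use t in simp)
  have "(n2 (sol t))\<^sup>2 = (hnorm (U t))\<^sup>2"
    using has_sum_unique[OF parseval[OF H] l2_has_sum[OF adm_l2[OF adm_sol, of t], folded fourier_coeff_U[OF t]]] t
    by (simp add: fourier_coeff_U[OF t])
  then show ?thesis by (simp add: hnorm_nonneg)
qed

lemma tendsto_at_right_0:
  fixes g :: "real \<Rightarrow> real"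
  assumes "continuous_on {0..T} g" "0 < T"
  shows "(g \<longlongrightarrow> g 0) (at_right 0)"
proof -
  have "(g \<longlongrightarrow> g 0) (at 0 within {0..T})" using assms by (simp add: continuous_on_def)
  then show ?thesis
    using assms(2) by (simp add: at_within_Icc_at_right)
qed

text \<open>The energy balance does not see \<open>\<theta>\<close>, so the growth estimate holds
  from every \<open>s > 0\<close>, and letting \<open>s\<close> tend to 0 compares with the datum.
  The threshold is respected, which is the reason why \<open>\<theta>\<close> equals 1.\<close>

lemma n2_sol_le:
  assumes t: "0 < t"
  shows "n2 (sol t) \<le> \<rho> t"
proof -
  interpret ks_smooth "{0<..}" \<theta> a L U by (rule U_smooth)
  have lim: "((\<lambda>s. exp (a\<^sup>2 / 2 * (t - s)) * (n2 (sol s))\<^sup>2) \<longlongrightarrow> exp (a\<^sup>2 / 2 * (t - 0)) * (n2 (sol 0))\<^sup>2) (at_right 0)"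
    by (rule tendsto_at_right_0[OF _ t]) (intro continuous_intros n2_sol_continuous)
  have ev: "\<forall>\<^sub>F s in at_right 0. (n2 (sol t))\<^sup>2 \<le> exp (a\<^sup>2 / 2 * (t - s)) * (n2 (sol s))\<^sup>2"
    using eventually_at_right_real[OF t]
  proof eventually_elim
    case (elim s)
    then have "cint (\<lambda>x. (U t x)\<^sup>2) \<le> exp (a\<^sup>2 / 2 * (t - s)) * cint (\<lambda>x. (U s x)\<^sup>2)"
      by (intro energy_growth) auto
    then show ?case
      using elim t hnorm_u[of t] hnorm_u[of s] by (simp add: n2_sol_eq_hnorm)
  qed
  have "(n2 (sol t))\<^sup>2 \<le> exp (a\<^sup>2 / 2 * t) * (n2 f0)\<^sup>2"
    using tendsto_lowerbound[OF lim ev] by (simp add: sol_initial[abs_def])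
  also have "\<dots> = (exp (a\<^sup>2 / 4 * t) * n2 f0)\<^sup>2"
    by (simp add: power_mult_distrib exp_double[symmetric])
  finally have "n2 (sol t) \<le> exp (a\<^sup>2 / 4 * t) * n2 f0"
    by (rule power2_le_imp_le) simp
  also have "\<dots> \<le> \<rho> t" unfolding \<rho>_def by (intro mult_left_mono) auto
  finally show ?thesis .
qed

lemma U_classical: "ks_classical a L U"
proof -
  have "\<theta> t = 1" if "t \<in> {0<..}" for t
    using n2_sol_le[of t] \<rho>_pos[of t] that by (simp add: \<theta>_def max_def)
  then have "ks_reg {0<..} \<theta> a L U = ks_reg {0<..} (\<lambda>_. 1) a L U"
    by (rule ks_reg_cong)
  then show ?thesis
    using U_reg by (simp only: ks_classical_iff_reg)
qed

end

theorem ks_solution_exists: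
  assumes f: "in_H0 f"
  shows "\<exists>u. ks_solution_from a L f u"
proof -
  have H: "in_H f" using f by (simp add: in_H0_def)
  interpret ks_data a L "fourier_coeff f"
  proof
    show "l2 (fourier_coeff f)" using parseval[OF H] by (auto simp: l2_def has_sum_iff)
    show "fourier_coeff f 0 = 0" by (rule fourier_coeff_zero_mean[OF f])
    fix k
    have "integral\<^sup>L circ (\<lambda>x. complex_of_real (f x) * cis (- of_int (- k) * x))
      = integral\<^sup>L circ (\<lambda>x. cnj (complex_of_real (f x) * cis (- of_int k * x)))"
      by (simp add: cis_cnj)
    also have "\<dots> = cnj (integral\<^sup>L circ (\<lambda>x. complex_of_real (f x) * cis (- of_int k * x)))"
      by (rule Bochner_Integration.integral_cnj)
    finally show "fourier_coeff f (- k) = cnj (fourier_coeff f k)"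
      by (simp add: fourier_coeff_def)
  qed
  have diff: "hnorm (U s - f) = n2 (\<lambda>k. sol s k - fourier_coeff f k)" if s: "0 < s" for s
  proof -
    have Hs: "in_H (U s)" by (rule ks_smooth.in_H_u[OF U_smooth]) (use s in simp)
    have "((\<lambda>k. (cmod (sol s k - fourier_coeff f k))\<^sup>2) has_sum (hnorm (U s - f))\<^sup>2) UNIV"
      using parseval[OF in_H_diff(1)[OF Hs H]] by (simp add: fourier_coeff_diff[OF Hs H] fourier_coeff_U[OF s])
    then have "(hnorm (U s - f))\<^sup>2 = (n2 (\<lambda>k. sol s k - fourier_coeff f k))\<^sup>2"
      by (simp add: n2_sq infsumI)
    then show ?thesis by (simp add: hnorm_nonneg)
  qed
  \<comment> \<open>By Parseval the distance to the datum is an \<open>n2\<close> norm. Domination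
    by the majorant makes it continuous up to time 0, where it vanishes because \<open>sol 0\<close>
    is the coefficient sequence of \<open>f\<close>.\<close>
  have "continuous_on {0..1} (\<lambda>s. n2 (\<lambda>k. sol s k - fourier_coeff f k))"
  proof (rule continuous_on_n2)
    show "continuous_on {0..1} (\<lambda>s. sol s k - fourier_coeff f k)" for k
      using adm_sol by (intro continuous_intros) (auto simp: adm_def)
    show "cmod (sol s k - fourier_coeff f k) \<le> majorant 1 k + cmod (fourier_coeff f k)" if "s \<in> {0..1}" for s k
      using sol_dom[OF that, of k] by (intro norm_triangle_le_diff) auto
    have "l2 (\<lambda>k. complex_of_real (cmod (fourier_coeff f k)))"
      using f0_l2 by (simp add: l2_def)
    from l2_add(1)[OF majorant_l2[of 1] this]
    show "l2 (\<lambda>k. complex_of_real (majorant 1 k + cmod (fourier_coeff f k)))" by simp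
  qed
  from tendsto_at_right_0[OF this]
  have "((\<lambda>s. n2 (\<lambda>k. sol s k - fourier_coeff f k)) \<longlongrightarrow> 0) (at_right 0)"
    by (simp add: sol_initial n2_def)
  then have "((\<lambda>s. hnorm (U s - f)) \<longlongrightarrow> 0) (at_right 0)"
    by (rule Lim_transform_eventually)
      (auto simp: diff eventually_at_filter)
  then show ?thesis
    unfolding ks_solution_from_def using U_classical by blast
qed


section \<open>Complete bounded trajectories\<close>

lemma ks_S_solution:
  assumes f: "in_H0 f" and sol: "ks_solution_from a L f w" and t: "0 < t"
  shows "ks_S a L t f = w t"
proof -
  have "(THE v. \<exists>u. ks_solution_from a L f u \<and> v = u t) = w t"
  proof (rule the_equality)
    show "\<exists>u. ks_solution_from a L f u \<and> w t = u t" using sol by blast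
    show "v = w t" if "\<exists>u. ks_solution_from a L f u \<and> v = u t" for v
      using that ks_solution_unique[OF _ sol f t] by blast
  qed
  then show ?thesis using t by (simp add: ks_S_def)
qed

lemma continuous_on_all_times:
  fixes g :: "real \<Rightarrow> real \<Rightarrow> real"
  assumes "\<And>s. continuous_on ({s<..} \<times> UNIV) (\<lambda>(t, x). g t x)"
  shows "continuous_on (UNIV \<times> UNIV) (\<lambda>(t, x). g t x)"
proof (rule continuous_at_imp_continuous_on, rule ballI)
  fix p :: "real \<times> real"
  have "open ({fst p - 1<..} \<times> (UNIV :: real set))" "p \<in> {fst p - 1<..} \<times> UNIV"
    by (auto intro!: open_Times simp: mem_Times_iff)
  then show "isCont (\<lambda>(t, x). g t x) p"
    using assms[of "fst p - 1"] continuous_on_eq_continuous_at[of "{fst p - 1<..} \<times> UNIV" "\<lambda>(t, x). g t x"] by blast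
qed

text \<open>For each \<open>s\<close>, existence and uniqueness identify \<open>u (s + t)\<close>,
  \<open>t > 0\<close>, with the classical solution started from \<open>u s\<close>. As
  \<open>s\<close> is arbitrary, every real time is a positive time of such a solution.\<close>

lemma complete_trajectory_smooth:
  assumes tr: "ks_complete_trajectory a L u"
  shows "ks_smooth UNIV (\<lambda>_. 1) a L u"
proof -
  have "\<exists>w. ks_classical a L w \<and> (\<forall>t>0. w t = u (s + t))" for s
  proof -
    have s: "in_H0 (u s)" using tr by (simp add: ks_complete_trajectory_def)
    from ks_solution_exists[OF s] obtain w where w: "ks_solution_from a L (u s) w" by blast
    have "w t = u (s + t)" if "0 < t" for t
      using ks_S_solution[OF s w that] tr that by (simp add: ks_complete_trajectory_def)
    then show ?thesis using w by (auto simp: ks_solution_from_def)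
  qed
  then obtain w where w: "\<And>s. ks_classical a L (w s)" and wu: "\<And>s t. 0 < t \<Longrightarrow> w s t = u (s + t)"
    by metis
  have sm: "ks_smooth {0<..} (\<lambda>_. 1) a L (w s)" for s
    by unfold_locales (use w in \<open>auto simp: ks_classical_iff_reg\<close>)
  have dxw: "dx k (w s) t = dx k u (s + t)" if "0 < t" for k s t
    by (rule ext) (simp only: dx_def wu[OF that])
  have Dt: "((\<lambda>r. u r x) has_real_derivative dt (w s) t x) (at (s + t))" if t: "0 < t" for s t x
  proof -
    have "((\<lambda>r. w s r x) has_real_derivative dt (w s) t x) (at t)"
      using ks_smooth.Dt[OF sm] t by simp
    then have "((\<lambda>r. u (s + r) x) has_real_derivative dt (w s) t x) (at t)"
      by (rule DERIV_cong_ev[THEN iffD1, rotated -1])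
        (use t eventually_nhds_in_open[of "{0<..}" t] in \<open>auto simp: wu elim!: eventually_mono\<close>)
    then have "((\<lambda>r. u (r + s) x) has_real_derivative dt (w s) t x) (at t)"
      by (simp only: add.commute)
    then have "((\<lambda>r. u r x) has_real_derivative dt (w s) t x) (at (t + s))"
      by (simp only: DERIV_shift)
    then show ?thesis by (simp only: add.commute)
  qed
  have dtw: "dt (w s) t x = dt u (s + t) x" if "0 < t" for s t x
    using DERIV_imp_deriv[OF Dt[OF that]] by (simp add: dt_def[of u])
  have move: "continuous_on ({s<..} \<times> UNIV) (\<lambda>(t, x). h t x)"
    if c: "continuous_on ({0<..} \<times> UNIV) (\<lambda>(t, x). h' t x)" and e: "\<And>t x. 0 < t \<Longrightarrow> h' t x = h (s + t) x"
    for s and h h' :: "real \<Rightarrow> real \<Rightarrow> real"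
  proof -
    have "continuous_on ({s<..} \<times> UNIV) (\<lambda>p. (\<lambda>(t, x). h' t x) (fst p - s, snd p))"
      by (rule continuous_on_compose2[OF c]) (auto intro!: continuous_intros)
    then show ?thesis
      by (rule continuous_on_eq) (auto simp: e)
  qed
  have "ks_reg UNIV (\<lambda>_. 1) a L u"
    unfolding ks_reg_def
  proof (intro conjI ballI allI impI)
    fix t x :: real
    \<comment> \<open>Time \<open>t\<close> is read as time 1 of the solution started at
      \<open>t - 1\<close>; any positive offset would do.\<close>
    note facts = ks_smooth.per[OF sm[of "t - 1"], of 1 0] ks_smooth.D[OF sm[of "t - 1"], of 1]
      ks_smooth.eqn[OF sm[of "t - 1"], of 1 x]
    show "u t (x + 2 * pi) = u t x"
      using facts(1)[of x] by (simp add: ks_smooth.dx0[OF sm] wu)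
    show "(dx k u t has_real_derivative dx (Suc k) u t x) (at x)" if "k < 4" for k
      using facts(2)[of k x] that by (simp add: dxw)
    show "((\<lambda>s. u s x) has_real_derivative dt u t x) (at t)"
      using Dt[of 1 x "t - 1"] dtw[of 1 "t - 1" x] by simp
    show "dt u t x = - dx 4 u t x - a * dx 2 u t x + 1 * (u t x * dx 1 u t x) + L * dx 3 u t x"
      using facts(3) dtw[of 1 "t - 1" x] by (simp add: dxw wu)
  next
    fix k :: nat assume k: "k \<le> 4"
    show "continuous_on (UNIV \<times> UNIV) (\<lambda>(t, x). dx k u t x)"
      by (rule continuous_on_all_times, rule move[OF ks_smooth.cjoint[OF sm k]]) (simp add: dxw)
  next
    show "continuous_on (UNIV \<times> UNIV) (\<lambda>(t, x). dt u t x)"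
      by (rule continuous_on_all_times, rule move[OF ks_smooth.cjointt[OF sm]]) (simp add: dtw)
  qed
  then show ?thesis by unfold_locales auto
qed

text \<open>An excess over \<open>b / \<kappa>\<close> at time \<open>t\<close> forces an excess
  larger by the factor \<open>exp (\<kappa> * s)\<close> at time \<open>t - s\<close>, for every
  \<open>s \<ge> 0\<close>; an upper bound on the whole line excludes this.\<close>

lemma bounded_solution_le:
  fixes y y' :: "real \<Rightarrow> real"
  assumes d: "\<And>t. (y has_real_derivative y' t) (at t)" and le: "\<And>t. y' t \<le> - \<kappa> * y t + b"
    and \<kappa>: "0 < \<kappa>" and B: "\<And>t. y t \<le> B"
  shows "y t \<le> b / \<kappa>"
proof (rule ccontr)
  assume neg: "\<not> y t \<le> b / \<kappa>"
  define w where "w = y t - b / \<kappa>"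
  have w: "0 < w" using neg by (simp add: w_def)
  define C where "C = \<bar>B - b / \<kappa>\<bar>"
  have C: "w \<le> exp (- \<kappa> * s) * C" if "0 \<le> s" for s
  proof -
    have "y t - b / \<kappa> \<le> exp (- \<kappa> * (t - (t - s))) * (y (t - s) - b / \<kappa>)"
    proof (rule gronwall[where y = "\<lambda>r. y r - b / \<kappa>"])
      show "((\<lambda>r. y r - b / \<kappa>) has_real_derivative y' r) (at r)" for r
        by (auto intro!: derivative_eq_intros d)
      show "y' r \<le> - \<kappa> * (y r - b / \<kappa>)" for r using le[of r] \<kappa> by (simp add: algebra_simps)
    qed (use that in simp)
    also have "\<dots> \<le> exp (- \<kappa> * (t - (t - s))) * C"
      using B[of "t - s"] by (intro mult_left_mono) (auto simp: C_def)
    finally show ?thesis by (simp add: w_def)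
  qed
  have C0: "0 \<le> C" by (simp add: C_def)
  \<comment> \<open>For this \<open>s\<close>, \<open>w * (1 + \<kappa> * s) = w + C\<close>, so
    already the linear lower bound of the exponential exceeds \<open>C\<close>.\<close>
  define s where "s = C / (\<kappa> * w)"
  have s0: "0 \<le> s" using C0 \<kappa> w by (simp add: s_def)
  have "w * (1 + \<kappa> * s) \<le> w * exp (\<kappa> * s)"
    using w exp_ge_add_one_self[of "\<kappa> * s"] by (intro mult_left_mono) auto
  also have "\<dots> \<le> exp (- \<kappa> * s) * C * exp (\<kappa> * s)" using C[OF s0] by (intro mult_right_mono) auto
  also have "\<dots> = C" by (simp add: exp_minus)
  finally show False using \<kappa> w by (simp add: s_def distrib_left)
qed

text \<open>The version for unstable modes: reversing time turns growth into decay.\<close>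

lemma bounded_solution_le_backward:
  fixes y y' :: "real \<Rightarrow> real"
  assumes d: "\<And>t. (y has_real_derivative y' t) (at t)" and le: "\<And>t. \<kappa> * y t - b \<le> y' t"
    and \<kappa>: "0 < \<kappa>" and B: "\<And>t. y t \<le> B"
  shows "y t \<le> b / \<kappa>"
proof -
  have "y (- (- t)) \<le> b / \<kappa>"
  proof (rule bounded_solution_le[where y = "\<lambda>t. y (- t)" and y' = "\<lambda>t. - y' (- t)", OF _ _ \<kappa>])
    show "((\<lambda>t. y (- t)) has_real_derivative - y' (- t)) (at t)" for t
    proof -
      have "(uminus has_real_derivative - 1) (at t)" by (auto intro!: derivative_eq_intros)
      from DERIV_chain2[OF d this] show ?thesis by simp
    qed
    show "- y' (- t) \<le> - \<kappa> * y (- t) + b" for t using le[of "- t"] by simp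
    show "y (- t) \<le> B" for t by (rule B)
  qed
  then show ?thesis by simp
qed

subsection \<open>The zero-mean primitive\<close>

text \<open>Convolution with a sawtooth. It is linear, needs no base point, can be differentiated
  under the integral in \<open>x\<close> and in time, and inverts the derivative on zero-mean
  periodic functions.\<close>

definition prim :: "(real \<Rightarrow> real) \<Rightarrow> real \<Rightarrow> real" where
  "prim h x = cint (\<lambda>y. y * h (x + y + pi)) / (2 * pi)"

lemma cint_shift:
  assumes d: "\<And>x. (h has_real_derivative h' x) (at x)" and c: "continuous_on UNIV h'"
    and per: "\<And>x. h (x + 2 * pi) = h x"
  shows "cint (\<lambda>y. h (s + y)) = cint h"
proof -
  have hc: "continuous_on UNIV h"
    using d by (meson DERIV_isCont continuous_at_imp_continuous_on)
  have "((\<lambda>s. cint (\<lambda>y. h (s + y))) has_real_derivative 0) (at s)" for s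
  proof -
    have "((\<lambda>s. cint (\<lambda>y. h (s + y))) has_real_derivative cint (\<lambda>y. h' (s + y))) (at s)"
    proof (rule cint_has_derivative[where J = UNIV])
      show "((\<lambda>s. h (s + x)) has_real_derivative h' (t + x)) (at t)" for t x
        using d[of "t + x"] by (simp add: DERIV_shift)
      show "continuous_on UNIV (\<lambda>y. h (t + y))" for t
        by (rule continuous_on_compose2[OF hc]) (auto intro!: continuous_intros)
      show "continuous_on (UNIV \<times> UNIV) (\<lambda>(t, x). h' (t + x))"
        unfolding split_beta by (rule continuous_on_compose2[OF c]) (auto intro!: continuous_intros)
    qed auto
    moreover have "((\<lambda>y. h' (s + y)) has_integral 0) {-pi..pi}"
    proof (rule cint_total_derivative)
      show "((\<lambda>y. h (s + y)) has_real_derivative h' (s + y)) (at y)" for y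
        by (rule DERIV_chain'[where g = h, OF _ d, THEN DERIV_cong]) (auto intro!: derivative_eq_intros)
      show "h (s + pi) = h (s + - pi)" using per[of "s - pi"] by (simp add: add.commute)
    qed
    ultimately show ?thesis by (simp add: integral_unique)
  qed
  then have "\<exists>c. \<forall>s\<in>UNIV. cint (\<lambda>y. h (s + y)) = c"
    by (intro has_field_derivative_zero_constant[OF convex_UNIV]) (simp add: has_field_derivative_at_within)
  then obtain c where "\<And>s. cint (\<lambda>y. h (s + y)) = c" by blast
  from this[of s] this[of 0] show ?thesis by simp
qed

text \<open>In the integration by parts of \<open>y * h' (x + y + pi)\<close>, periodicity makes
  both ends contribute \<open>pi * h x\<close>, and the remaining integral is that of a translate of
  \<open>h\<close>.\<close>

lemma prim_derivative_eq:
  assumes d: "\<And>x. (h has_real_derivative h' x) (at x)" and c: "continuous_on UNIV h'"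
    and per: "\<And>x. h (x + 2 * pi) = h x"
  shows "prim h' x = h x - cint h / (2 * pi)"
proof -
  have hc: "continuous_on UNIV h"
    using d by (meson DERIV_isCont continuous_at_imp_continuous_on)
  have ci: "continuous_on A (\<lambda>y. h (x + y + pi))" "continuous_on A (\<lambda>y. h' (x + y + pi))" for A
    by (rule continuous_on_compose2[OF hc] continuous_on_compose2[OF c]; auto intro!: continuous_intros)+
  have "((\<lambda>y. h (x + y + pi) + y * h' (x + y + pi)) has_integral (pi * h (x + pi + pi) - (- pi) * h (x + - pi + pi))) {-pi..pi}"
  proof (rule fundamental_theorem_of_calculus)
    fix y
    have "((\<lambda>y. h (x + y + pi)) has_real_derivative h' (x + y + pi)) (at y)"
      by (rule DERIV_chain'[where g = h, OF _ d, THEN DERIV_cong]) (auto intro!: derivative_eq_intros)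
    then have "((\<lambda>y. y * h (x + y + pi)) has_real_derivative h (x + y + pi) + y * h' (x + y + pi)) (at y)"
      by (auto intro!: derivative_eq_intros)
    then show "((\<lambda>y. y * h (x + y + pi)) has_vector_derivative h (x + y + pi) + y * h' (x + y + pi)) (at y within {-pi..pi})"
      by (simp add: has_field_derivative_at_within flip: has_real_derivative_iff_has_vector_derivative)
  qed simp
  then have "cint (\<lambda>y. h (x + y + pi) + y * h' (x + y + pi)) = 2 * pi * h x"
    using per[of x] by (simp add: integral_unique add.assoc)
  moreover have "cint (\<lambda>y. h (x + y + pi) + y * h' (x + y + pi)) = cint (\<lambda>y. h (x + y + pi)) + cint (\<lambda>y. y * h' (x + y + pi))"
    by (intro cint_add continuous_intros ci)
  moreover have "cint (\<lambda>y. h (x + y + pi)) = cint (\<lambda>y. h ((x + pi) + y))"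
    by (simp add: add_ac)
  ultimately have "cint (\<lambda>y. h ((x + pi) + y)) + cint (\<lambda>y. y * h' (x + y + pi)) = 2 * pi * h x"
    by simp
  then show ?thesis
    unfolding prim_def cint_shift[OF d c per] by (simp add: field_simps)
qed

lemma prim_has_derivative:
  assumes d: "\<And>x. (h has_real_derivative h' x) (at x)" and c: "continuous_on UNIV h'"
  shows "(prim h has_real_derivative prim h' x) (at x)"
proof -
  have hc: "continuous_on UNIV h"
    using d by (meson DERIV_isCont continuous_at_imp_continuous_on)
  have "((\<lambda>x. cint (\<lambda>y. y * h (x + y + pi))) has_real_derivative cint (\<lambda>y. y * h' (x + y + pi))) (at x)"
  proof (rule cint_has_derivative[where J = UNIV])
    show "((\<lambda>x. y * h (x + y + pi)) has_real_derivative y * h' (x + y + pi)) (at x)" for x y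
    proof -
      have "((\<lambda>x. h (x + y + pi)) has_real_derivative h' (x + y + pi)) (at x)"
        by (rule DERIV_chain'[where g = h, OF _ d, THEN DERIV_cong]) (auto intro!: derivative_eq_intros)
      then show ?thesis by (auto intro!: derivative_eq_intros)
    qed
    show "continuous_on UNIV (\<lambda>y. y * h (x + y + pi))" for x
      by (intro continuous_intros continuous_on_compose2[OF hc]) auto
    show "continuous_on (UNIV \<times> UNIV) (\<lambda>(x, y). y * h' (x + y + pi))"
      unfolding split_beta by (intro continuous_intros continuous_on_compose2[OF c]) auto
  qed auto
  then show ?thesis unfolding prim_def[abs_def] by (auto intro!: derivative_eq_intros)
qed

section \<open>The primitive along a bounded trajectory\<close>

locale ks_bounded = ks_smooth UNIV "\<lambda>_. 1" a L u for a L u +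
  fixes N0 :: real
  assumes mean: "cint (u t) = 0" and bound: "cint (\<lambda>x. (u t x)\<^sup>2) \<le> N0" and L: "0 < L"
begin

abbreviation "E t \<equiv> cint (\<lambda>x. (u t x)\<^sup>2)"
abbreviation "D t \<equiv> cint (\<lambda>x. (dx 2 u t x)\<^sup>2)"
abbreviation "E' t \<equiv> cint (\<lambda>x. - 2 * (dx 2 u t x)\<^sup>2 - 2 * a * (u t x * dx 2 u t x))"

lemmas D0' = D0[OF UNIV_I] and D1' = D1[OF UNIV_I] and D2' = D2[OF UNIV_I] and D3' = D3[OF UNIV_I]
lemmas ends = per_ends0[OF UNIV_I] per_ends[OF UNIV_I]
lemma cs: "continuous_on A (u t)" "k \<le> 4 \<Longrightarrow> continuous_on A (dx k u t)"
  by (rule cslice0[OF UNIV_I] cslice[OF UNIV_I]; assumption)+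
lemma per0: "u t (x + 2 * pi) = u t x"
  using per[of t 0 x] by simp

lemma E_nonneg: "0 \<le> E t"
  by (intro cint_nonneg continuous_intros cs) auto
lemma E_deriv: "(E has_real_derivative E' t) (at t)"
  by (rule energy_derivative[OF UNIV_I])

lemma D_le: "D t \<le> a\<^sup>2 * E t - E' t"
  using energy_rate_le(2)[OF UNIV_I, of t] by linarith

definition P :: "real \<Rightarrow> real \<Rightarrow> real" where "P t = prim (u t)"

definition flux :: "real \<Rightarrow> real \<Rightarrow> real" where
  "flux t x = - dx 3 u t x - a * dx 1 u t x + (u t x)\<^sup>2 / 2 + L * dx 2 u t x"

text \<open>The equation reads \<open>u_t = flux_x\<close>, so the time derivative of
  \<open>P\<close> is the flux minus its mean. Only the square contributes to the mean:
  \<open>E t / 2\<close> divided by the period \<open>2 * pi\<close>.\<close>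

definition Pt :: "real \<Rightarrow> real \<Rightarrow> real" where "Pt t x = flux t x - E t / (4 * pi)"

lemma P_dx: "(P t has_real_derivative u t x) (at x)"
proof -
  have "(P t has_real_derivative prim (dx 1 u t) x) (at x)"
    unfolding P_def by (intro prim_has_derivative D0' cs) simp
  moreover have "prim (dx 1 u t) x = u t x"
    using prim_derivative_eq[OF D0' _ per0, of t x] cs(2)[of 1 UNIV t] mean[of t] by simp
  ultimately show ?thesis by simp
qed

lemma P_per: "P t (x + 2 * pi) = P t x"
proof -
  have "u t (x + 2 * pi + y + pi) = u t (x + y + pi)" for y
    using per0[of t "x + y + pi"] by (simp add: add_ac)
  then show ?thesis by (simp add: P_def prim_def)
qed

lemma P_ends: "P t pi = P t (- pi)"
  using P_per[of t "- pi"] by simp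

lemma flux_dx: "(flux t has_real_derivative dt u t x) (at x)"
  unfolding flux_def[abs_def] eqn[OF UNIV_I]
  by (rule derivative_eq_intros D0' D1' D2' D3' refl | simp)+

lemma cint_flux: "cint (flux t) = E t / 2"
proof -
  have "cint (flux t) = cint (\<lambda>x. (u t x)\<^sup>2 / 2)"
  proof (rule cint_mod_total_derivative)
    show "((\<lambda>x. - dx 2 u t x - a * u t x + L * dx 1 u t x) has_real_derivative - dx 3 u t x - a * dx 1 u t x + L * dx 2 u t x) (at x)" for x
      by (rule derivative_eq_intros D0' D1' D2' refl | simp)+
    show "continuous_on UNIV (flux t)" "continuous_on UNIV (\<lambda>x. (u t x)\<^sup>2 / 2)"
      unfolding flux_def by (intro continuous_intros cs; simp)+
  qed (simp_all add: ends flux_def)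
  then show ?thesis by simp
qed

lemma P_joint: "continuous_on (UNIV \<times> UNIV) (\<lambda>(t, x). P t x)"
proof -
  have uc: "continuous_on UNIV (\<lambda>p. u (fst p) (snd p))"
    using cjoint0 by (simp add: split_beta)
  have "continuous_on UNIV (\<lambda>p. integral (cbox (- pi) pi) (\<lambda>y. y * u (fst p) (snd p + y + pi)))"
  proof (rule integral_continuous_on_param)
    have "continuous_on (UNIV \<times> cbox (- pi) pi) (\<lambda>q. snd q * u (fst (fst (fst q), snd (fst q) + snd q + pi)) (snd (fst (fst q), snd (fst q) + snd q + pi)))"
      by (intro continuous_intros continuous_on_compose2[OF uc, where f = "\<lambda>q. (fst (fst q), snd (fst q) + snd q + pi)"]) auto
    then show "continuous_on (UNIV \<times> cbox (- pi) pi) (\<lambda>(p, y). y * u (fst p) (snd p + y + pi))"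
      by (simp add: split_beta)
  qed
  then show ?thesis
    by (simp add: P_def prim_def split_beta continuous_on_divide)
qed

lemma P_dt: "((\<lambda>s. P s x) has_real_derivative Pt t x) (at t)"
proof -
  have "((\<lambda>s. cint (\<lambda>y. y * u s (x + y + pi))) has_real_derivative cint (\<lambda>y. y * dt u t (x + y + pi))) (at t)"
  proof (rule cint_has_derivative[where J = UNIV])
    show "((\<lambda>s. y * u s (x + y + pi)) has_real_derivative y * dt u t (x + y + pi)) (at t)" for t y
      by (auto intro!: derivative_eq_intros Dt)
    show "continuous_on UNIV (\<lambda>y. y * u t (x + y + pi))" for t
      by (intro continuous_intros continuous_on_compose2[OF cs(1)]) auto
    have tc: "continuous_on UNIV (\<lambda>p. dt u (fst p) (snd p))"
      using cjointt by (simp add: split_beta)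
    have "continuous_on (UNIV \<times> UNIV) (\<lambda>p. snd p * dt u (fst (fst p, x + snd p + pi)) (snd (fst p, x + snd p + pi)))"
      by (intro continuous_intros continuous_on_compose2[OF tc, where f = "\<lambda>p. (fst p, x + snd p + pi)"]) auto
    then show "continuous_on (UNIV \<times> UNIV) (\<lambda>(t, y). y * dt u t (x + y + pi))"
      by (simp add: split_beta)
  qed auto
  then have "((\<lambda>s. P s x) has_real_derivative prim (dt u t) x) (at t)"
    unfolding P_def prim_def by (auto intro!: derivative_eq_intros)
  moreover have "prim (dt u t) x = Pt t x"
  proof -
    have "flux t (x + 2 * pi) = flux t x" for x
      using per0[of t x] per[of t 1 x] per[of t 2 x] per[of t 3 x] by (simp add: flux_def)
    from prim_derivative_eq[OF flux_dx cslicet[OF UNIV_I] this, of x] show ?thesis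
      by (simp add: Pt_def cint_flux)
  qed
  ultimately show ?thesis by simp
qed

lemma P_cont: "continuous_on A (P t)"
  using continuous_on_joint_slice[OF P_joint UNIV_I] .

text \<open>Interchanging the two integrals leaves the integral of a translate of \<open>u\<close>,
  which is zero.\<close>

lemma P_mean: "cint (P t) = 0"
proof -
  have "integral (cbox (- pi) pi) (\<lambda>x. integral (cbox (- pi) pi) (\<lambda>y. y * u t (x + y + pi)))
    = integral (cbox (- pi) pi) (\<lambda>y. integral (cbox (- pi) pi) (\<lambda>x. y * u t (x + y + pi)))"
  proof (rule integral_swap_continuous)
    show "continuous_on (cbox (- pi, - pi) (pi, pi)) (\<lambda>(x, y). y * u t (x + y + pi))"
      unfolding split_beta by (intro continuous_intros continuous_on_compose2[OF cs(1)[of UNIV t]]) auto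
  qed
  also have "(\<lambda>y. integral (cbox (- pi) pi) (\<lambda>x. y * u t (x + y + pi))) = (\<lambda>y. 0)"
  proof
    fix y
    have "cint (\<lambda>x. u t ((y + pi) + x)) = 0"
      using cint_shift[OF D0' _ per0, of t "y + pi"] cs(2)[of 1 UNIV t] mean[of t] by simp
    then show "integral (cbox (- pi) pi) (\<lambda>x. y * u t (x + y + pi)) = 0"
      by (simp add: add_ac)
  qed
  finally show ?thesis by (simp add: P_def prim_def[abs_def])
qed

lemma P_sup: "x \<in> {-pi..pi} \<Longrightarrow> (P t x)\<^sup>2 \<le> 2 * pi * E t"
  by (rule zero_mean_sup[OF P_dx cs(1) P_mean])

subsection \<open>The normal form\<close>

text \<open>Since \<open>k\<^sup>3 - m\<^sup>3 - n\<^sup>3 = 3 k m n\<close> whenever \<open>k = m + n\<close>, and no mode vanishes for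
  zero mean, adding \<open>P\<^sup>2 / (6 L)\<close> to \<open>u\<close> cancels the quadratic nonlinearity up to order \<open>1 / L\<close>.
  Testing against a wave that travels with the dispersion relation removes the dispersive term from
  the equation for the amplitude.\<close>

definition amp :: "real \<Rightarrow> real \<Rightarrow> real \<Rightarrow> real" where
  "amp k \<alpha> t = cint (\<lambda>x. (u t x + (P t x)\<^sup>2 / (6 * L)) * cos (k * x - L * k ^ 3 * t + \<alpha>))"

text \<open>\<open>rest / (6 * L)\<close> is what the amplitude equation retains besides its linear
  part. The third derivative in \<open>P * P_t\<close> has been moved by parts onto \<open>P\<close>
  and the wave, so \<open>u_xx\<close> is the highest derivative; each term is at least quadratic in
  \<open>u\<close>.\<close>

definition rest :: "real \<Rightarrow> real \<Rightarrow> real \<Rightarrow> real \<Rightarrow> real" where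
  "rest k \<alpha> t x =
    (2 * u t x * dx 2 u t x + 2 * a * (u t x)\<^sup>2 + P t x * (u t x)\<^sup>2 - 2 * (E t / (4 * pi)) * P t x
       - (a * k\<^sup>2 - k ^ 4) * (P t x)\<^sup>2) * cos (k * x - L * k ^ 3 * t + \<alpha>)
    - 2 * k * (P t x * dx 2 u t x + a * P t x * u t x) * sin (k * x - L * k ^ 3 * t + \<alpha>)"

lemma rest_cont: "continuous_on A (rest k \<alpha> t)"
  unfolding rest_def[abs_def] by (intro continuous_intros cs P_cont) auto

lemma amp_deriv:
  assumes k: "k = real n"
  shows "(amp k \<alpha> has_real_derivative (a * k\<^sup>2 - k ^ 4) * amp k \<alpha> t + cint (rest k \<alpha> t) / (6 * L)) (at t)"
proof -
  let ?c = "\<lambda>t x. cos (k * x - L * k ^ 3 * t + \<alpha>)" and ?s = "\<lambda>t x. sin (k * x - L * k ^ 3 * t + \<alpha>)"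
  let ?z = "\<lambda>t x. u t x + (P t x)\<^sup>2 / (6 * L)"
  let ?d = "\<lambda>t x. (dt u t x + P t x * Pt t x / (3 * L)) * ?c t x + ?z t x * (L * k ^ 3 * ?s t x)"
  define q m where "q = 1 / (6 * L)" and "m = E t / (4 * pi)"
  have "(amp k \<alpha> has_real_derivative cint (?d t)) (at t)"
    unfolding amp_def[abs_def]
  proof (rule cint_has_derivative[where J = UNIV])
    show "((\<lambda>s. ?z s x * ?c s x) has_real_derivative ?d t x) (at t)" for t x
      using L by (auto intro!: derivative_eq_intros Dt P_dt simp: field_simps)
    show "continuous_on UNIV (\<lambda>x. ?z t x * ?c t x)" for t
      using L by (intro continuous_intros cs P_cont) auto
    have Ec: "continuous_on UNIV E"
      using E_deriv by (meson DERIV_isCont continuous_at_imp_continuous_on)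
    have c: "continuous_on UNIV (\<lambda>p. u (fst p) (snd p))" "continuous_on UNIV (\<lambda>p. P (fst p) (snd p))"
      "continuous_on UNIV (\<lambda>p. dt u (fst p) (snd p))"
      using cjoint0 P_joint cjointt by (simp_all add: split_beta)
    have ck: "continuous_on UNIV (\<lambda>p. dx j u (fst p) (snd p))" if "j \<le> 4" for j
      using cjoint[OF that] by (simp add: split_beta)
    have "continuous_on UNIV (\<lambda>p. E (fst p))"
      by (rule continuous_on_compose2[OF Ec]) (auto intro!: continuous_intros)
    then have "continuous_on UNIV (\<lambda>p. Pt (fst p) (snd p))"
      unfolding Pt_def flux_def by (intro continuous_intros c ck) auto
    then show "continuous_on (UNIV \<times> UNIV) (\<lambda>(t, x). ?d t x)"
      unfolding split_beta UNIV_Times_UNIV using L by (intro continuous_intros c) auto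
  qed auto
  moreover have "cint (?d t) = cint (\<lambda>x. (a * k\<^sup>2 - k ^ 4) * (?z t x * ?c t x) + rest k \<alpha> t x / (6 * L))"
  proof (rule cint_mod_total_derivative)
    \<comment> \<open>The nonlinear terms independent of \<open>L\<close> are
      \<open>u * u_x + P * u_xx / 3\<close>, one sixth of the third derivative of
      \<open>P^2\<close>; integrated against the wave they cancel \<open>k^3 * P^2 / 6\<close> times
      the sine, which comes from the moving phase. The fourth line of the potential records this,
      the last one moves derivatives off \<open>u\<close> in \<open>P * P_t\<close>, and the first
      three treat the linear terms.\<close>
    let ?F = "\<lambda>x. - (dx 3 u t x * ?c t x + k * (dx 2 u t x * ?s t x) - k\<^sup>2 * (dx 1 u t x * ?c t x) - k ^ 3 * (u t x * ?s t x))
      - a * (dx 1 u t x * ?c t x + k * (u t x * ?s t x))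
      + L * (dx 2 u t x * ?c t x + k * (dx 1 u t x * ?s t x) - k\<^sup>2 * (u t x * ?c t x))
      + ((2 * (u t x)\<^sup>2 + 2 * (P t x * dx 1 u t x)) * ?c t x + k * (2 * (P t x * u t x) * ?s t x) - k\<^sup>2 * ((P t x)\<^sup>2 * ?c t x)) * (1 / 6)
      - q * (2 * (P t x * dx 2 u t x * ?c t x) + 2 * a * (P t x * u t x * ?c t x))"
    let ?f = "\<lambda>x. ?d t x - ((a * k\<^sup>2 - k ^ 4) * (?z t x * ?c t x) + rest k \<alpha> t x / (6 * L))"
    show "(?F has_real_derivative ?f x) (at x)" for x
      unfolding eqn[OF UNIV_I] Pt_def flux_def rest_def m_def[symmetric]
      by (rule derivative_eq_intros D0' D1' D2' D3' P_dx refl)+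
        (use L in \<open>simp add: q_def field_simps power2_eq_square power3_eq_cube power4_eq_xxxx\<close>)
    have e: "cos (k * pi - b) = cos (k * (- pi) - b)" "sin (k * pi - b) = sin (k * (- pi) - b)" for b
    proof -
      have eq: "k * pi - b = (k * (- pi) - b) + 2 * real n * pi" by (simp add: k algebra_simps)
      show "cos (k * pi - b) = cos (k * (- pi) - b)" "sin (k * pi - b) = sin (k * (- pi) - b)"
        unfolding eq cos_add sin_add cos_2npi sin_2npi by (simp_all only: mult_1_right mult_zero_right diff_zero add_0_right)
    qed
    have "?c t pi = ?c t (- pi)" "?s t pi = ?s t (- pi)"
      using e[of "L * k ^ 3 * t - \<alpha>"] by (simp_all add: algebra_simps)
    then show "?F pi = ?F (- pi)" by (simp add: ends P_ends)
    show "continuous_on UNIV (?d t)"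
      using L unfolding Pt_def flux_def by (intro continuous_intros cs P_cont cslicet[OF UNIV_I]) auto
    show "continuous_on UNIV (\<lambda>x. (a * k\<^sup>2 - k ^ 4) * (?z t x * ?c t x) + rest k \<alpha> t x / (6 * L))"
      using L by (intro continuous_intros cs P_cont rest_cont) auto
  qed simp
  moreover have "\<dots> = (a * k\<^sup>2 - k ^ 4) * amp k \<alpha> t + cint (rest k \<alpha> t) / (6 * L)"
    unfolding amp_def using L by (subst cint_add) (auto intro!: continuous_intros cs P_cont rest_cont)
  ultimately show ?thesis by simp
qed


text \<open>Coefficient of \<open>E\<close> in the bound for the remainder. \<open>N0\<close> enters
  through the cubic terms, where \<open>\<bar>P\<bar> \<le> 1 + 2 * pi * N0\<close>;
  \<open>L\<close> does not enter.\<close>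

definition crest :: "real \<Rightarrow> real" where
  "crest k = 2 + 2 * \<bar>a\<bar> + 2 * pi * N0 + \<bar>a\<bar> * k
     + 2 * pi * ((\<bar>a * k\<^sup>2 - k ^ 4\<bar> + k + \<bar>a\<bar> * k) * (2 * pi) + (1 + 2 * pi * N0) / (4 * pi))"

lemma N0_nonneg: "0 \<le> N0"
  using bound[of 0] E_nonneg[of 0] by linarith

lemma crest_nonneg: "0 \<le> k \<Longrightarrow> 0 \<le> crest k"
  unfolding crest_def using N0_nonneg by (intro add_nonneg_nonneg mult_nonneg_nonneg) auto

text \<open>Young's inequality splits \<open>2 * u * u_xx\<close> and
  \<open>2 * k * P * u_xx\<close>, leaving \<open>1 + k\<close> copies of \<open>D\<close>.
  Elsewhere \<open>P^2 \<le> 2 * pi * E\<close> holds pointwise, and in the cubic terms one factor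
  is bounded through \<open>N0\<close>.\<close>

lemma rest_le:
  assumes k: "0 \<le> k"
  shows "\<bar>cint (rest k \<alpha> t)\<bar> \<le> crest k * E t + (1 + k) * D t"
proof -
  define A where "A = 2 + 2 * \<bar>a\<bar> + 2 * pi * N0 + \<bar>a\<bar> * k"
  define B where "B = (\<bar>a * k\<^sup>2 - k ^ 4\<bar> + k + \<bar>a\<bar> * k) * (2 * pi * E t) + E t / (4 * pi) * (1 + 2 * pi * N0)"
  have "norm (cint (rest k \<alpha> t)) \<le> cint (\<lambda>x. (A * (u t x)\<^sup>2 + (1 + k) * (dx 2 u t x)\<^sup>2) + B)"
  proof (rule integral_norm_bound_integral)
    show "rest k \<alpha> t integrable_on {-pi..pi}" by (intro integrable_continuous_interval rest_cont)
    show "(\<lambda>x. (A * (u t x)\<^sup>2 + (1 + k) * (dx 2 u t x)\<^sup>2) + B) integrable_on {-pi..pi}"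
      by (intro integrable_continuous_interval continuous_intros cs) auto
    fix x assume x: "x \<in> {-pi..pi}"
    define v w p m l where "v = u t x" and "w = dx 2 u t x" and "p = P t x" and "m = E t / (4 * pi)" and "l = a * k\<^sup>2 - k ^ 4"
    define co si where "co = cos (k * x - L * k ^ 3 * t + \<alpha>)" and "si = sin (k * x - L * k ^ 3 * t + \<alpha>)"
    have p2: "p\<^sup>2 \<le> 2 * pi * E t" using P_sup[OF x] by (simp add: p_def)
    have "2 * pi * E t \<le> 2 * pi * N0" using bound[of t] by simp
    then have pN: "p\<^sup>2 \<le> 2 * pi * N0" using p2 by linarith
    have m0: "0 \<le> m" using E_nonneg by (simp add: m_def)
    have young: "\<bar>2 * y * z\<bar> \<le> y\<^sup>2 + z\<^sup>2" for y z :: real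
      using sum_squares_bound[of "\<bar>y\<bar>" "\<bar>z\<bar>"] by (simp add: abs_mult)
    have half: "2 * \<bar>p\<bar> \<le> 1 + p\<^sup>2" using young[of p 1] by (simp add: abs_mult)
    have 1: "\<bar>2 * v * w\<bar> \<le> v\<^sup>2 + w\<^sup>2" by (rule young)
    have 3: "\<bar>p * v\<^sup>2\<bar> \<le> (1 + 2 * pi * N0) * v\<^sup>2"
    proof -
      have "\<bar>p\<bar> \<le> 1 + 2 * pi * N0" using half pN zero_le_power2[of p] by linarith
      then show ?thesis unfolding abs_mult by (simp add: mult_right_mono)
    qed
    have 4: "\<bar>2 * m * p\<bar> \<le> m * (1 + 2 * pi * N0)"
    proof -
      have "m * (2 * \<bar>p\<bar>) \<le> m * (1 + 2 * pi * N0)" using half pN m0 by (intro mult_left_mono) auto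
      then show ?thesis using m0 by (simp add: abs_mult mult.commute mult.left_commute)
    qed
    have 5: "\<bar>l * p\<^sup>2\<bar> \<le> \<bar>l\<bar> * (2 * pi * E t)" unfolding abs_mult using p2 by (intro mult_left_mono) auto
    have 6: "\<bar>2 * k * (p * w + a * p * v)\<bar> \<le> k * (p\<^sup>2 + w\<^sup>2) + \<bar>a\<bar> * k * (p\<^sup>2 + v\<^sup>2)"
    proof -
      have "2 * k * (p * w + a * p * v) = k * (2 * p * w) + a * k * (2 * p * v)" by (simp add: algebra_simps)
      also have "\<bar>\<dots>\<bar> \<le> \<bar>k * (2 * p * w)\<bar> + \<bar>a * k * (2 * p * v)\<bar>" by (rule abs_triangle_ineq)
      also have "\<dots> = k * \<bar>2 * p * w\<bar> + (\<bar>a\<bar> * k) * \<bar>2 * p * v\<bar>" using k by (simp add: abs_mult)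
      also have "\<dots> \<le> k * (p\<^sup>2 + w\<^sup>2) + (\<bar>a\<bar> * k) * (p\<^sup>2 + v\<^sup>2)"
        using k by (intro add_mono mult_left_mono young) auto
      finally show ?thesis .
    qed
    have 7: "k * p\<^sup>2 \<le> k * (2 * pi * E t)" "\<bar>a\<bar> * k * p\<^sup>2 \<le> \<bar>a\<bar> * k * (2 * pi * E t)"
      using p2 k by (auto intro!: mult_left_mono)
    have "\<bar>rest k \<alpha> t x\<bar> \<le> \<bar>2 * v * w + 2 * a * v\<^sup>2 + p * v\<^sup>2 - 2 * m * p - l * p\<^sup>2\<bar> * \<bar>co\<bar> + \<bar>2 * k * (p * w + a * p * v)\<bar> * \<bar>si\<bar>"
      unfolding rest_def v_def w_def p_def m_def l_def co_def si_def abs_mult[symmetric] by (rule abs_triangle_ineq4)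
    also have "\<dots> \<le> \<bar>2 * v * w + 2 * a * v\<^sup>2 + p * v\<^sup>2 - 2 * m * p - l * p\<^sup>2\<bar> * 1 + \<bar>2 * k * (p * w + a * p * v)\<bar> * 1"
      by (intro add_mono mult_left_mono) (auto simp: co_def si_def)
    finally have "\<bar>rest k \<alpha> t x\<bar> \<le> \<bar>2 * v * w + 2 * a * v\<^sup>2 + p * v\<^sup>2 - 2 * m * p - l * p\<^sup>2\<bar> + \<bar>2 * k * (p * w + a * p * v)\<bar>"
      by (simp only: mult_1_right)
    moreover have "\<bar>2 * v * w + 2 * a * v\<^sup>2 + p * v\<^sup>2 - 2 * m * p - l * p\<^sup>2\<bar> \<le> \<bar>2 * v * w\<bar> + \<bar>2 * a * v\<^sup>2\<bar> + \<bar>p * v\<^sup>2\<bar> + \<bar>2 * m * p\<bar> + \<bar>l * p\<^sup>2\<bar>"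
      by linarith
    ultimately have "\<bar>rest k \<alpha> t x\<bar> \<le> \<bar>2 * v * w\<bar> + \<bar>2 * a * v\<^sup>2\<bar> + \<bar>p * v\<^sup>2\<bar> + \<bar>2 * m * p\<bar> + \<bar>l * p\<^sup>2\<bar> + \<bar>2 * k * (p * w + a * p * v)\<bar>"
      by linarith
    also have "\<bar>2 * a * v\<^sup>2\<bar> = 2 * \<bar>a\<bar> * v\<^sup>2" by (simp add: abs_mult)
    finally have "\<bar>rest k \<alpha> t x\<bar> \<le> (v\<^sup>2 + w\<^sup>2) + 2 * \<bar>a\<bar> * v\<^sup>2 + (1 + 2 * pi * N0) * v\<^sup>2 + m * (1 + 2 * pi * N0) + \<bar>l\<bar> * (2 * pi * E t)
        + (k * w\<^sup>2 + \<bar>a\<bar> * k * v\<^sup>2 + k * (2 * pi * E t) + \<bar>a\<bar> * k * (2 * pi * E t))"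
      using 1 3 4 5 6 7 by (simp add: distrib_left)
    also have "\<dots> = (A * v\<^sup>2 + (1 + k) * w\<^sup>2) + B"
      by (simp add: A_def B_def m_def l_def algebra_simps)
    finally show "norm (rest k \<alpha> t x) \<le> (A * (u t x)\<^sup>2 + (1 + k) * (dx 2 u t x)\<^sup>2) + B"
      by (simp add: v_def w_def)
  qed
  also have "\<dots> = A * E t + (1 + k) * D t + 2 * pi * B"
    by (subst cint_add, (intro continuous_intros cs; simp)+, subst cint_add) (auto intro!: continuous_intros cs)
  also have "\<dots> = crest k * E t + (1 + k) * D t"
    by (simp add: A_def B_def crest_def algebra_simps add_divide_distrib)
  finally show ?thesis by simp
qed

section \<open>Bounds for the amplitudes and the single modes\<close>

lemma P_sq_cos: "\<bar>cint (\<lambda>x. (P t x)\<^sup>2 * cos (k * x + \<beta>))\<bar> \<le> 4 * pi\<^sup>2 * E t"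
proof -
  have "norm (cint (\<lambda>x. (P t x)\<^sup>2 * cos (k * x + \<beta>))) \<le> cint (\<lambda>x. 2 * pi * E t)"
  proof (rule integral_norm_bound_integral)
    fix x assume "x \<in> {-pi..pi}"
    then have "(P t x)\<^sup>2 * \<bar>cos (k * x + \<beta>)\<bar> \<le> (2 * pi * E t) * 1"
      using E_nonneg by (intro mult_mono P_sup) auto
    then show "norm ((P t x)\<^sup>2 * cos (k * x + \<beta>)) \<le> 2 * pi * E t" by (simp add: abs_mult)
  qed (intro integrable_continuous_interval continuous_intros P_cont)+
  then show ?thesis by (simp add: power2_eq_square)
qed

lemma amp_split: "amp k \<alpha> t = cint (\<lambda>x. u t x * cos (k * x + (\<alpha> - L * k ^ 3 * t))) + cint (\<lambda>x. (P t x)\<^sup>2 * cos (k * x + (\<alpha> - L * k ^ 3 * t))) / (6 * L)"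
proof -
  have "amp k \<alpha> t = cint (\<lambda>x. u t x * cos (k * x + (\<alpha> - L * k ^ 3 * t)) + (P t x)\<^sup>2 * cos (k * x + (\<alpha> - L * k ^ 3 * t)) / (6 * L))"
    unfolding amp_def by (intro integral_cong) (simp add: algebra_simps)
  also have "\<dots> = cint (\<lambda>x. u t x * cos (k * x + (\<alpha> - L * k ^ 3 * t))) + cint (\<lambda>x. (P t x)\<^sup>2 * cos (k * x + (\<alpha> - L * k ^ 3 * t)) / (6 * L))"
    using L by (intro cint_add continuous_intros cs P_cont) auto
  finally show ?thesis by simp
qed

text \<open>What matters is finiteness uniformly in time: this boundedness is what selects the small
  solution of the amplitude equation.\<close>

lemma amp_bounded: "amp k \<alpha> t \<le> 2 * pi + N0 + 4 * pi\<^sup>2 * N0 / (6 * L)"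
proof -
  have "cint (\<lambda>x. u t x * cos (k * x + (\<alpha> - L * k ^ 3 * t))) \<le> cint (\<lambda>x. 1 + (u t x)\<^sup>2)"
  proof (rule cint_mono)
    fix x
    have "u t x * cos (k * x + (\<alpha> - L * k ^ 3 * t)) \<le> \<bar>u t x\<bar> * \<bar>cos (k * x + (\<alpha> - L * k ^ 3 * t))\<bar>"
      by (metis abs_ge_self abs_mult)
    also have "\<dots> \<le> \<bar>u t x\<bar> * 1" by (intro mult_left_mono) auto
    also have "\<dots> \<le> 1 + (u t x)\<^sup>2"
      using sum_squares_bound[of "\<bar>u t x\<bar>" 1] zero_le_power2[of "u t x"] by simp
    finally show "u t x * cos (k * x + (\<alpha> - L * k ^ 3 * t)) \<le> 1 + (u t x)\<^sup>2" .
  qed (intro continuous_intros cs)+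
  also have "\<dots> = 2 * pi + E t" by (subst cint_add) (auto intro!: continuous_intros cs)
  finally have 1: "cint (\<lambda>x. u t x * cos (k * x + (\<alpha> - L * k ^ 3 * t))) \<le> 2 * pi + N0" using bound[of t] by linarith
  have "cint (\<lambda>x. (P t x)\<^sup>2 * cos (k * x + (\<alpha> - L * k ^ 3 * t))) \<le> 4 * pi\<^sup>2 * E t"
    using P_sq_cos[of t k "\<alpha> - L * k ^ 3 * t"] by linarith
  also have "\<dots> \<le> 4 * pi\<^sup>2 * N0" using bound[of t] by (intro mult_left_mono) auto
  finally have "cint (\<lambda>x. (P t x)\<^sup>2 * cos (k * x + (\<alpha> - L * k ^ 3 * t))) / (6 * L) \<le> 4 * pi\<^sup>2 * N0 / (6 * L)"
    using L by (intro divide_right_mono) auto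
  then show ?thesis unfolding amp_split using 1 by linarith
qed

text \<open>Combines the bound for the amplitude with the correction \<open>P^2 / (6 * L)\<close>,
  which contributes \<open>4 * pi^2\<close>. The quotient is where a resonance
  \<open>a = k^2\<close> would blow up; \<open>L\<close> does not occur.\<close>

definition Q :: "real \<Rightarrow> real" where
  "Q k = ((crest k + (1 + k) * a\<^sup>2) / \<bar>a * k\<^sup>2 - k ^ 4\<bar> + (1 + k) + 4 * pi\<^sup>2) / 6"

lemma Q_nonneg: "0 \<le> k \<Longrightarrow> 0 \<le> Q k"
  unfolding Q_def using crest_nonneg[of k] by (intro divide_nonneg_nonneg add_nonneg_nonneg) auto

text \<open>The remainder is controlled by the dissipation \<open>D\<close>, which is at most \<open>a\<^sup>2 E - E'\<close>. The part
  \<open>- E'\<close> is absorbed by adding a multiple of \<open>E / L\<close> to a stable amplitude, or subtracting it from an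
  unstable one.\<close>

lemma amp_le:
  assumes k: "k = real n" and res: "a * k\<^sup>2 - k ^ 4 \<noteq> 0" and N: "\<And>t. E t \<le> N"
  shows "amp k \<alpha> t \<le> ((crest k + (1 + k) * a\<^sup>2) / \<bar>a * k\<^sup>2 - k ^ 4\<bar> + (1 + k)) * N / (6 * L)"
proof -
  define l where "l = a * k\<^sup>2 - k ^ 4"
  define c where "c = crest k + (1 + k) * a\<^sup>2"
  have k0: "0 \<le> k" by (simp add: k)
  have c0: "0 \<le> c" using crest_nonneg[OF k0] k0 by (simp add: c_def)
  define G where "G = (\<lambda>t. cint (rest k \<alpha> t))"
  have G: "\<bar>G t\<bar> \<le> c * E t - (1 + k) * E' t" for t
  proof -
    have "(1 + k) * D t \<le> (1 + k) * (a\<^sup>2 * E t - E' t)" using k0 by (intro mult_left_mono D_le) auto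
    then show ?thesis using rest_le[OF k0, of \<alpha> t] by (simp add: G_def c_def algebra_simps)
  qed
  have ad: "(amp k \<alpha> has_real_derivative l * amp k \<alpha> t + G t / (6 * L)) (at t)" for t
    using amp_deriv[OF k] by (simp add: l_def G_def)
  have Nc: "c * E t \<le> c * N" for t using N c0 by (intro mult_left_mono) auto
  show ?thesis
  proof (cases "l < 0")
    case True
    \<comment> \<open>In the derivative of this sum \<open>E'\<close> cancels against the bound for
      the remainder. The rate \<open>l\<close> acts on the added term as well, which produces
      \<open>- l * (1 + k)\<close> and, after division by \<open>- l\<close>, the summand
      \<open>1 + k\<close>.\<close>
    let ?y = "\<lambda>t. amp k \<alpha> t + (1 + k) * E t / (6 * L)"
    have "?y t \<le> ((c - l * (1 + k)) * N / (6 * L)) / (- l)"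
    proof (rule bounded_solution_le[where y = ?y and y' = "\<lambda>t. l * amp k \<alpha> t + G t / (6 * L) + (1 + k) * E' t / (6 * L)"
          and B = "2 * pi + N0 + 4 * pi\<^sup>2 * N0 / (6 * L) + (1 + k) * N0 / (6 * L)"])
      show "(?y has_real_derivative l * amp k \<alpha> t + G t / (6 * L) + (1 + k) * E' t / (6 * L)) (at t)" for t
        by (intro DERIV_add ad DERIV_cdivide DERIV_cmult E_deriv)
      show "?y t \<le> 2 * pi + N0 + 4 * pi\<^sup>2 * N0 / (6 * L) + (1 + k) * N0 / (6 * L)" for t
        using L k0 by (intro add_mono amp_bounded divide_right_mono mult_left_mono bound) auto
      show "0 < - l" using True by simp
      fix t
      have "G t + (1 + k) * E' t \<le> c * E t" using G[of t] by linarith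
      then have "(G t + (1 + k) * E' t) / (6 * L) \<le> c * E t / (6 * L)" using L by (intro divide_right_mono) auto
      moreover have "(c - l * (1 + k)) * E t / (6 * L) \<le> (c - l * (1 + k)) * N / (6 * L)"
      proof (intro divide_right_mono mult_left_mono N)
        have "l * (1 + k) \<le> 0" using True k0 by (intro mult_nonpos_nonneg) auto
        then show "0 \<le> c - l * (1 + k)" using c0 by linarith
      qed (use L in simp)
      ultimately show "l * amp k \<alpha> t + G t / (6 * L) + (1 + k) * E' t / (6 * L) \<le> - (- l) * ?y t + (c - l * (1 + k)) * N / (6 * L)"
        by (simp add: add_divide_distrib diff_divide_distrib algebra_simps)
    qed
    also have "\<dots> = (c / \<bar>l\<bar> + (1 + k)) * N / (6 * L)" using True L by (simp add: field_simps)
    finally have "?y t \<le> (c / \<bar>l\<bar> + (1 + k)) * N / (6 * L)" .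
    moreover have "0 \<le> (1 + k) * E t / (6 * L)" using k0 L E_nonneg by simp
    ultimately show ?thesis unfolding l_def c_def by linarith
  next
    case False
    then have l: "0 < l" using res by (simp add: l_def)
    \<comment> \<open>Here \<open>l\<close> times the subtracted term helps in the lower bound for
      the derivative, and \<open>1 + k\<close> reappears when the energy term is added back.\<close>
    let ?y = "\<lambda>t. amp k \<alpha> t - (1 + k) * E t / (6 * L)"
    have "?y t \<le> (c * N / (6 * L)) / l"
    proof (rule bounded_solution_le_backward[where y = ?y and y' = "\<lambda>t. l * amp k \<alpha> t + G t / (6 * L) - (1 + k) * E' t / (6 * L)"
          and B = "2 * pi + N0 + 4 * pi\<^sup>2 * N0 / (6 * L)"])
      show "(?y has_real_derivative l * amp k \<alpha> t + G t / (6 * L) - (1 + k) * E' t / (6 * L)) (at t)" for t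
        by (intro DERIV_diff ad DERIV_cdivide DERIV_cmult E_deriv)
      have nn: "0 \<le> (1 + k) * E t / (6 * L)" for t using k0 L E_nonneg by simp
      show "?y t \<le> 2 * pi + N0 + 4 * pi\<^sup>2 * N0 / (6 * L)" for t
        using amp_bounded[of k \<alpha> t] nn[of t] by linarith
      fix t
      have "- (c * N) \<le> G t - (1 + k) * E' t" using G[of t] Nc[of t] by linarith
      then have "- (c * N) / (6 * L) \<le> (G t - (1 + k) * E' t) / (6 * L)" using L by (intro divide_right_mono) auto
      moreover have "0 \<le> l * ((1 + k) * E t / (6 * L))" using l k0 L E_nonneg by simp
      ultimately show "l * ?y t - c * N / (6 * L) \<le> l * amp k \<alpha> t + G t / (6 * L) - (1 + k) * E' t / (6 * L)"
        by (simp add: diff_divide_distrib right_diff_distrib)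
    qed (rule l)
    moreover have "(1 + k) * E t / (6 * L) \<le> (1 + k) * N / (6 * L)"
      using k0 L N by (intro divide_right_mono mult_left_mono) auto
    ultimately have "amp k \<alpha> t \<le> (c * N / (6 * L)) / l + (1 + k) * N / (6 * L)" by linarith
    also have "\<dots> = (c / \<bar>l\<bar> + (1 + k)) * N / (6 * L)" using l L by (simp add: field_simps)
    finally show ?thesis unfolding l_def c_def .
  qed
qed

lemma mode_le:
  assumes k: "k = real n" and res: "a * k\<^sup>2 - k ^ 4 \<noteq> 0" and N: "\<And>t. E t \<le> N"
  shows "\<bar>cint (\<lambda>x. u t x * cos (k * x + \<beta>))\<bar> \<le> Q k * N / L"
proof -
  have *: "cint (\<lambda>x. u t x * cos (k * x + \<beta>)) \<le> Q k * N / L" for \<beta>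
  proof -
    \<comment> \<open>At the fixed time \<open>t\<close> this choice gives the wave the phase
      \<open>\<beta>\<close>; it is admissible because \<open>amp_le\<close> is uniform in the
      phase.\<close>
    have "amp k (\<beta> + L * k ^ 3 * t) t \<le> ((crest k + (1 + k) * a\<^sup>2) / \<bar>a * k\<^sup>2 - k ^ 4\<bar> + (1 + k)) * N / (6 * L)"
      by (rule amp_le[OF k res N])
    moreover have "- cint (\<lambda>x. (P t x)\<^sup>2 * cos (k * x + \<beta>)) / (6 * L) \<le> 4 * pi\<^sup>2 * N / (6 * L)"
    proof -
      have "4 * pi\<^sup>2 * E t \<le> 4 * pi\<^sup>2 * N" by (intro mult_left_mono N) auto
      then have "- cint (\<lambda>x. (P t x)\<^sup>2 * cos (k * x + \<beta>)) \<le> 4 * pi\<^sup>2 * N"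
        using P_sq_cos[of t k \<beta>] by linarith
      then show ?thesis using L by (intro divide_right_mono) auto
    qed
    ultimately have "cint (\<lambda>x. u t x * cos (k * x + \<beta>)) \<le> ((crest k + (1 + k) * a\<^sup>2) / \<bar>a * k\<^sup>2 - k ^ 4\<bar> + (1 + k)) * N / (6 * L) + 4 * pi\<^sup>2 * N / (6 * L)"
      unfolding amp_split by simp
    also have "(x + y) * N / (6 * L) + z * N / (6 * L) = (x + y + z) / 6 * N / L" for x y z
      by (simp add: algebra_simps add_divide_distrib)
    finally show ?thesis unfolding Q_def .
  qed
  \<comment> \<open>Shifting the phase by \<open>pi\<close> changes the sign, so the upper bound for
    all phases also gives the lower bound.\<close>
  have "cos (k * x + (\<beta> + pi)) = - cos (k * x + \<beta>)" for x
    using cos_periodic_pi[of "k * x + \<beta>"] by (simp add: add.assoc)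
  then have "cint (\<lambda>x. u t x * cos (k * x + (\<beta> + pi))) = - cint (\<lambda>x. u t x * cos (k * x + \<beta>))"
    by simp
  then show ?thesis using *[of \<beta>] *[of "\<beta> + pi"] by linarith
qed

end

subsection \<open>High modes\<close>

text \<open>The phases 0 and \<open>pi / 2\<close> pick out the real and the imaginary part, so a
  bound uniform in the phase, as in \<open>mode_le\<close>, bounds the whole coefficient.\<close>

lemma fourier_coeff_real_parts:
  assumes c: "continuous_on UNIV f"
  shows "(cmod (fourier_coeff f k))\<^sup>2 = ((cint (\<lambda>x. f x * cos (of_int k * x)))\<^sup>2 + (cint (\<lambda>x. f x * cos (of_int k * x + pi / 2)))\<^sup>2) / (2 * pi)\<^sup>2"
proof -
  have ci: "continuous_on A f" for A using c by (rule continuous_on_subset) simp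
  have i: "integrable circ (\<lambda>x. complex_of_real (f x) * cis (- of_int k * x))"
    by (intro integrable_circ_continuous continuous_intros ci)
  define Z where "Z = integral\<^sup>L circ (\<lambda>x. complex_of_real (f x) * cis (- of_int k * x))"
  have "Re Z = integral\<^sup>L circ (\<lambda>x. f x * cos (of_int k * x))"
    unfolding Z_def using integral_Re[OF i] by simp
  then have re: "Re Z = cint (\<lambda>x. f x * cos (of_int k * x))"
    by (subst (asm) integral_circ_continuous) (auto intro!: continuous_intros ci)
  have "Im Z = integral\<^sup>L circ (\<lambda>x. f x * cos (of_int k * x + pi / 2))"
    unfolding Z_def using integral_Im[OF i] by (simp add: cos_add)
  then have im: "Im Z = cint (\<lambda>x. f x * cos (of_int k * x + pi / 2))"
    by (subst (asm) integral_circ_continuous) (auto intro!: continuous_intros ci)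
  have "(cmod (fourier_coeff f k))\<^sup>2 = (cmod Z)\<^sup>2 / (2 * pi)\<^sup>2"
    by (simp add: fourier_coeff_def Z_def norm_divide norm_mult power_divide)
  then show ?thesis by (simp only: cmod_power2 re im)
qed

lemma fourier_coeff_second_derivative:
  assumes d: "\<And>x. (f has_real_derivative f1 x) (at x)" "\<And>x. (f1 has_real_derivative f2 x) (at x)"
    and c: "continuous_on UNIV f2" and e: "f pi = f (- pi)" "f1 pi = f1 (- pi)"
  shows "(cmod (fourier_coeff f2 k))\<^sup>2 = (real_of_int k ^ 4) * (cmod (fourier_coeff f k))\<^sup>2"
proof -
  have fc: "continuous_on UNIV f" using d(1) by (meson DERIV_isCont continuous_at_imp_continuous_on)
  have *: "cint (\<lambda>x. f2 x * cos (of_int k * x + \<beta>)) = - (of_int k)\<^sup>2 * cint (\<lambda>x. f x * cos (of_int k * x + \<beta>))" for \<beta>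
  proof -
    let ?c = "\<lambda>x. cos (of_int k * x + \<beta>)" and ?s = "\<lambda>x. sin (of_int k * x + \<beta>)"
    have "cint (\<lambda>x. f2 x * ?c x) = cint (\<lambda>x. - (of_int k)\<^sup>2 * (f x * ?c x))"
    proof (rule cint_mod_total_derivative)
      show "((\<lambda>x. f1 x * ?c x + of_int k * (f x * ?s x)) has_real_derivative f2 x * ?c x + (of_int k)\<^sup>2 * (f x * ?c x)) (at x)" for x
        by (rule derivative_eq_intros d refl | simp add: algebra_simps power2_eq_square)+
      have "of_int k * pi + \<beta> = (of_int k * (- pi) + \<beta>) + 2 * pi * of_int k" by (simp add: algebra_simps)
      then have "?c pi = ?c (- pi)" "?s pi = ?s (- pi)"
        using cos_int_2pin[of k] sin_int_2pin[of k] by (simp_all only: cos_add sin_add) simp_all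
      then show "f1 pi * ?c pi + of_int k * (f pi * ?s pi) = f1 (- pi) * ?c (- pi) + of_int k * (f (- pi) * ?s (- pi))"
        using e by simp
    qed (auto intro!: continuous_intros fc c)
    then show ?thesis by simp
  qed
  show ?thesis
    unfolding fourier_coeff_real_parts[OF fc] fourier_coeff_real_parts[OF c] *[of "pi / 2"] *[of 0, simplified]
    by (simp add: power_mult_distrib power2_eq_square power4_eq_xxxx algebra_simps add_divide_distrib)
qed

context ks_bounded
begin

text \<open>Beyond frequency \<open>K\<close> each coefficient of \<open>u_xx\<close> is at least
  \<open>K^2\<close> times that of \<open>u\<close> in modulus; Parseval for both functions then
  bounds the tail of the energy.\<close>

lemma high_modes:
  assumes K: "1 \<le> K"
  shows "E t \<le> 2 * pi * (\<Sum>k\<in>{-int K..int K}. (cmod (fourier_coeff (u t) k))\<^sup>2) + D t / real K ^ 4"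
proof -
  let ?S = "{-int K..int K}"
  let ?f = "\<lambda>k. (cmod (fourier_coeff (u t) k))\<^sup>2" and ?g = "\<lambda>k. (cmod (fourier_coeff (dx 2 u t) k))\<^sup>2"
  have H2: "in_H (dx 2 u t)"
  proof -
    have "set_integrable lborel {-pi..pi} (\<lambda>x. (dx 2 u t x)\<^sup>2)"
      by (intro borel_integrable_atLeastAtMost' continuous_intros cs) simp
    then show ?thesis
      using per[of t 2] borel_measurable_continuous_onI[OF cs(2)[of 2 UNIV t]] by (simp add: in_H_def)
  qed
  have "(hnorm (dx 2 u t))\<^sup>2 = D t / (2 * pi)"
    unfolding hnorm_sq by (subst integral_circ_continuous) (auto intro!: continuous_intros cs)
  then have g: "(?g has_sum (D t / (2 * pi))) UNIV" using parseval[OF H2] by simp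
  have f: "(?f has_sum (E t / (2 * pi))) UNIV"
    using parseval[OF in_H_u[OF UNIV_I, of t]] hnorm_u[OF UNIV_I, of t] by simp
  have low: "((\<lambda>k. if k \<in> ?S then ?f k else 0) has_sum (\<Sum>k\<in>?S. ?f k)) UNIV"
    by (rule has_sum_finite_neutralI[of ?S]) auto
  have "E t / (2 * pi) \<le> (\<Sum>k\<in>?S. ?f k) + 1 / real K ^ 4 * (D t / (2 * pi))"
  proof (rule has_sum_mono[OF f has_sum_add[OF low has_sum_cmult_right[OF g]]])
    fix k :: int
    have gk: "?g k = real_of_int k ^ 4 * ?f k"
      by (rule fourier_coeff_second_derivative[OF D0' D1' cs(2) ends(1) ends(2)]) auto
    show "?f k \<le> (if k \<in> ?S then ?f k else 0) + 1 / real K ^ 4 * ?g k"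
    proof (cases "k \<in> ?S")
      case False
      then have "real K \<le> \<bar>real_of_int k\<bar>" by auto
      then have "real K ^ 4 \<le> \<bar>real_of_int k\<bar> ^ 4" by (intro power_mono) auto
      then have "1 \<le> 1 / real K ^ 4 * real_of_int k ^ 4" using K by (simp add: power_abs)
      then have "1 * ?f k \<le> (1 / real K ^ 4 * real_of_int k ^ 4) * ?f k" by (intro mult_right_mono) auto
      then show ?thesis using False unfolding gk by simp
    qed simp
  qed
  then show ?thesis by (simp add: field_simps)
qed

text \<open>\<open>D\<close> is at least \<open>K^4\<close> times \<open>E\<close> minus its low
  modes, and at most \<open>a^2 * E - E'\<close>. For bounded \<open>E\<close> this gives
  \<open>E \<le> K^4 * l / (K^4 - a^2) \<le> 2 * l\<close>, and \<open>mode_le\<close> makes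
  \<open>l\<close> quadratic in \<open>N / L\<close>. Since \<open>N\<close> is separate from
  \<open>N0\<close>, the estimate can be repeated with smaller \<open>N\<close> and unchanged
  constants.\<close>

lemma energy_contract:
  assumes N: "\<And>t. E t \<le> N" and K: "1 \<le> K" "2 * a\<^sup>2 \<le> real K ^ 4"
    and res: "\<And>n. 1 \<le> n \<Longrightarrow> a \<noteq> (real n)\<^sup>2"
  shows "E t \<le> 2 * (2 * real K + 1) * (\<Sum>n=1..K. Q (real n))\<^sup>2 / pi * N\<^sup>2 / L\<^sup>2"
proof -
  define M where "M = (\<Sum>n=1..K. Q (real n)) * N / L"
  have N0: "0 \<le> N" using N[of 0] E_nonneg[of 0] by linarith
  \<comment> \<open>There are \<open>2 * K + 1\<close> low modes; each has squared modulus at most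
    \<open>2 * M^2 / (2 * pi)^2\<close>, since both phases are bounded by \<open>M\<close>.\<close>
  define l where "l = 2 * pi * ((2 * real K + 1) * (2 * M\<^sup>2 / (2 * pi)\<^sup>2))"
  have coef: "(cmod (fourier_coeff (u t) k))\<^sup>2 \<le> 2 * M\<^sup>2 / (2 * pi)\<^sup>2" if k: "k \<in> {-int K..int K}" for t k
  proof (cases "k = 0")
    case True
    have "fourier_coeff (u t) 0 = 0"
      using mean[of t] by (simp add: fourier_coeff_def integral_circ_continuous cs)
    then show ?thesis using True by simp
  next
    case False
    define n where "n = nat \<bar>k\<bar>"
    have n: "1 \<le> n" "n \<le> K" using k False by (auto simp: n_def)
    have "a * (real n)\<^sup>2 - real n ^ 4 = (real n)\<^sup>2 * (a - (real n)\<^sup>2)"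
      by (simp add: algebra_simps power2_eq_square power4_eq_xxxx)
    then have r: "a * (real n)\<^sup>2 - real n ^ 4 \<noteq> 0" using res[OF n(1)] n by simp
    have "Q (real n) * N / L \<le> M"
      unfolding M_def using n L N0 by (intro divide_right_mono mult_right_mono member_le_sum Q_nonneg) auto
    then have le: "\<bar>cint (\<lambda>x. u t x * cos (real n * x + \<beta>))\<bar> \<le> M" for \<beta>
      using mode_le[OF refl r N, of t \<beta>] by linarith
    have "\<bar>cint (\<lambda>x. u t x * cos (of_int k * x + \<beta>))\<bar> \<le> M" for \<beta>
    proof (cases "0 \<le> k")
      case True
      then have "of_int k = real n" by (simp add: n_def)
      then show ?thesis using le[of \<beta>] by simp
    next
      case False
      then have "of_int k = - real n" by (simp add: n_def)
      then have "cos (of_int k * x + \<beta>) = cos (real n * x + - \<beta>)" for x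
        using cos_minus[of "real n * x - \<beta>"] by simp
      then show ?thesis using le[of "- \<beta>"] by simp
    qed
    from this[of 0] this[of "pi / 2"]
    have "(cint (\<lambda>x. u t x * cos (of_int k * x)))\<^sup>2 \<le> M\<^sup>2" "(cint (\<lambda>x. u t x * cos (of_int k * x + pi / 2)))\<^sup>2 \<le> M\<^sup>2"
      by (auto intro!: power2_le_iff_abs_le[THEN iffD2] intro: order_trans[OF abs_ge_zero])
    then show ?thesis
      unfolding fourier_coeff_real_parts[OF cs(1)] by (intro divide_right_mono) auto
  qed
  have low: "2 * pi * (\<Sum>k\<in>{-int K..int K}. (cmod (fourier_coeff (u t) k))\<^sup>2) \<le> l" for t
  proof -
    have "(\<Sum>k\<in>{-int K..int K}. (cmod (fourier_coeff (u t) k))\<^sup>2) \<le> real (card {-int K..int K}) * (2 * M\<^sup>2 / (2 * pi)\<^sup>2)"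
      by (rule sum_bounded_above) (rule coef)
    moreover have "real (card {-int K..int K}) = 2 * real K + 1" by simp
    ultimately show ?thesis unfolding l_def by (intro mult_left_mono) (simp_all only:, simp)
  qed
  have l0: "0 \<le> l" by (simp add: l_def)
  have K4: "0 < real K ^ 4" using K by simp
  then have gap: "0 < real K ^ 4 - a\<^sup>2" using K(2) zero_le_power2[of a] by linarith
  have "E t \<le> (real K ^ 4 * l) / (real K ^ 4 - a\<^sup>2)"
  proof (rule bounded_solution_le[OF E_deriv _ gap bound])
    fix t
    have "real K ^ 4 * E t \<le> real K ^ 4 * (l + D t / real K ^ 4)"
      using high_modes[OF K(1), of t] low[of t] by (intro mult_left_mono) auto
    also have "\<dots> = real K ^ 4 * l + D t" using K4 by (simp add: distrib_left)
    finally show "E' t \<le> - (real K ^ 4 - a\<^sup>2) * E t + real K ^ 4 * l"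
      using D_le[of t] by (simp add: algebra_simps)
  qed
  also have "\<dots> \<le> 2 * l"
  proof -
    have "real K ^ 4 \<le> 2 * (real K ^ 4 - a\<^sup>2)" using K(2) by simp
    then have "real K ^ 4 * l \<le> 2 * (real K ^ 4 - a\<^sup>2) * l" using l0 by (rule mult_right_mono)
    then show ?thesis using gap by (simp add: divide_le_eq mult_ac)
  qed
  also have "2 * l = 2 * (2 * real K + 1) * (\<Sum>n=1..K. Q (real n))\<^sup>2 / pi * N\<^sup>2 / L\<^sup>2"
    unfolding l_def M_def using L by (simp add: power2_eq_square field_simps)
  finally show ?thesis .
qed

end

section \<open>Vanishing of the trajectory for large dispersion\<close>

theorem theorem4p6:
  fixes a :: real
  assumes "\<forall>k::nat. k \<ge> 1 \<longrightarrow> a \<noteq> (real k)\<^sup>2"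
  shows "\<forall>R>0. \<exists>L0. \<forall>L\<ge>L0. \<forall>A u.
           ks_global_attractor a L A \<longrightarrow>
           ks_complete_trajectory a L u \<longrightarrow>
           (\<forall>t. u t \<in> A) \<longrightarrow>
           (\<forall>t. hnorm (u t) \<le> R) \<longrightarrow>
           (\<forall>t. hnorm (u t) = 0)"
proof (intro allI impI)
  fix R :: real assume R: "0 < R"
  define N0 where "N0 = 2 * pi * R\<^sup>2"
  \<comment> \<open>From \<open>K \<ge> 2 * \<bar>a\<bar>\<close> and \<open>K \<ge> 1\<close>
    follows \<open>K^4 \<ge> K^2 \<ge> 4 * a^2\<close>, which dominates the required
    \<open>2 * a^2\<close>.\<close>
  define K where "K = Suc (nat \<lceil>2 * \<bar>a\<bar>\<rceil>)"
  have K1: "1 \<le> K" by (simp add: K_def)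
  have K2: "2 * a\<^sup>2 \<le> real K ^ 4"
  proof -
    have "2 * \<bar>a\<bar> \<le> real K" unfolding K_def by linarith
    then have "(2 * \<bar>a\<bar>)\<^sup>2 \<le> (real K)\<^sup>2" by (intro power_mono) auto
    moreover have "(real K)\<^sup>2 \<le> real K ^ 4" using K1 by (intro power_increasing) auto
    moreover have "0 \<le> a\<^sup>2" by simp
    moreover have "(2 * \<bar>a\<bar>)\<^sup>2 = 4 * a\<^sup>2" by (simp add: power_mult_distrib)
    ultimately show ?thesis by linarith
  qed
  \<comment> \<open>Outside the locale \<open>Q\<close> takes only \<open>a\<close> and
    \<open>N0\<close> as parameters, so \<open>c\<close> is fixed before \<open>L\<close>.\<close>
  define c where "c = 2 * (2 * real K + 1) * (\<Sum>n=1..K. ks_bounded.Q a N0 (real n))\<^sup>2 / pi"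
  have c0: "0 \<le> c" by (simp add: c_def)
  have N00: "0 \<le> N0" by (simp add: N0_def)
  show "\<exists>L0. \<forall>L\<ge>L0. \<forall>A u. ks_global_attractor a L A \<longrightarrow> ks_complete_trajectory a L u \<longrightarrow>
           (\<forall>t. u t \<in> A) \<longrightarrow> (\<forall>t. hnorm (u t) \<le> R) \<longrightarrow> (\<forall>t. hnorm (u t) = 0)"
  \<comment> \<open>The summand 1 gives \<open>L \<ge> 1\<close>, hence
    \<open>L^2 \<ge> L \<ge> 2 * c * N0\<close>, so that the factor \<open>c * N0 / L^2\<close> is
    at most 1/2.\<close>
  proof (rule exI[of _ "1 + 2 * c * N0"], intro allI impI)
    fix L A u t
    assume Lge: "1 + 2 * c * N0 \<le> L" and tr: "ks_complete_trajectory a L u" and uR: "\<forall>t. hnorm (u t) \<le> R"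
    have L1: "1 \<le> L" using Lge mult_nonneg_nonneg[OF c0 N00] by linarith
    interpret S: ks_smooth UNIV "\<lambda>_. 1" a L u by (rule complete_trajectory_smooth[OF tr])
    interpret ks_bounded a L u N0
    proof
      show "cint (u t) = 0" for t
        using tr by (simp add: ks_complete_trajectory_def in_H0_def LINT_circ integral_circ_continuous S.cslice0)
      show "cint (\<lambda>x. (u t x)\<^sup>2) \<le> N0" for t
        unfolding N0_def S.hnorm_u[OF UNIV_I] using uR hnorm_nonneg[of "u t"]
        by (intro mult_left_mono power_mono) auto
      show "0 < L" using L1 by simp
    qed
    \<comment> \<open>Each pass of the quadratic estimate halves the uniform bound: one factor
      \<open>N0 / 2 ^ n\<close> is estimated by \<open>N0\<close> and, together with
      \<open>c / L^2\<close>, gives at most 1/2. No supremum of \<open>E\<close> has to be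
      formed.\<close>
    have "\<forall>t. E t \<le> N0 / 2 ^ n" for n
    proof (induction n)
      case 0
      then show ?case using bound by simp
    next
      case (Suc n)
      have le: "N0 / 2 ^ n \<le> N0" using N00 by (simp add: divide_le_eq mult_le_cancel_left1)
      have nn: "0 \<le> N0 / 2 ^ n" using N00 by simp
      have "E t \<le> N0 / 2 ^ Suc n" for t
      proof -
        have "E t \<le> c * (N0 / 2 ^ n)\<^sup>2 / L\<^sup>2"
          unfolding c_def using assms Suc by (intro energy_contract K1 K2) auto
        also have "\<dots> \<le> (c * N0) * (N0 / 2 ^ n) / L\<^sup>2"
          unfolding power2_eq_square mult.assoc using c0 nn le by (intro divide_right_mono mult_left_mono mult_right_mono) auto
        also have "\<dots> \<le> (N0 / 2 ^ n) / 2"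
        proof -
          have "L * 1 \<le> L * L" using L1 by (intro mult_left_mono) auto
          then have "2 * (c * N0) \<le> L\<^sup>2" using Lge unfolding power2_eq_square mult.assoc by linarith
          then have "2 * (c * N0) * (N0 / 2 ^ n) \<le> L\<^sup>2 * (N0 / 2 ^ n)" using nn by (rule mult_right_mono)
          then show ?thesis using L1 by (simp add: divide_le_eq mult_ac)
        qed
        finally show ?thesis by (simp add: mult.commute)
      qed
      then show ?case by blast
    qed
    then have le: "E t \<le> N0 * (1 / 2) ^ n" for n by (simp add: power_divide)
    have "(\<lambda>n. N0 * (1 / 2) ^ n) \<longlonglongrightarrow> N0 * 0"
      by (intro tendsto_mult tendsto_const LIMSEQ_power_zero) simp
    then have "E t \<le> N0 * 0"
      by (rule tendsto_lowerbound) (use le in auto)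
    then have "E t = 0" using E_nonneg[of t] by simp
    then show "hnorm (u t) = 0"
      using S.hnorm_u[OF UNIV_I, of t] by simp
  qed
qed

end
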